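(* Let $g>0$ and let $\gamma:\mathbb{R}\to[0,\infty)$, $s\mapsto\gamma_s$, be smooth with $\gamma_s$, $\dot\gamma_s$, $\ddot\gamma_s$ bounded continuous functions, and set $\gamma:=\sup_s\gamma_s$. For $s\in\mathbb{R}$ let $$H_s=\frac12\begin{pmatrix} s& g\\ g& -s\end{pmatrix}=e_s(P_s^+-P_s^-),\qquad e_s=\tfrac12\sqrt{s^2+g^2},$$ with $P_s^\pm$ the eigenprojections of $H_s$ for the eigenvalues $\pm e_s$, and let $\mathcal{L}_s\rho=-i[H_s,\rho]-\frac{\gamma_s}{2}[\sqrt{H_s},[\sqrt{H_s},\rho]]$, where $\sqrt{H_s}:=\operatorname{sgn}(H_s)\sqrt{|H_s|}$. For $\epsilon>0$ let $\mathcal{U}_\epsilon(s,s')$, $s\geq s'$, be the propagator defined by $\epsilon\,\partial_s\mathcal{U}_\epsilon(s,s')=\mathcal{L}_s\mathcal{U}_\epsilon(s,s')$, $\mathcal{U}_\epsilon(s',s')=\mathbb{1}$, and let the transition probability be $$p(\epsilon,\gamma)=\lim_{T\to\infty}\operatorname{tr}\big(P_T^+\,\mathcal{U}_\epsilon(T,-T)P_{-T}^-\big).$$ Then $$p(\epsilon,\gamma)=\exp\Big(-\pi\frac{g^2}{2\epsilon}\Big)+\epsilon\int_{-\infty}^{\infty}\frac{\gamma_\tau}{1+\gamma_\tau^2}\,\frac{\operatorname{tr}\big(P_\tau^-(\dot P_\tau^+)^2P_\tau^-\big)}{e_\tau}\,d\tau+R,$$ where the remainder satisfies $|R|\leq C\gamma\epsilon^2$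 with a constant $C$ depending only on $g$ and on a bound for $\gamma_s,\dot\gamma_s,\ddot\gamma_s$.
   Context: All operators act on $\mathbb{C}^2$; super-operators act on $2\times2$ matrices. Dots denote derivatives with respect to $s$. *)

theory Defs
  imports "HOL-Analysis.Analysis"
begin

type_synonym mat2 = "complex^2^2"

definition adj :: "mat2 \<Rightarrow> mat2" where
  "adj A = (\<chi> i j. cnj (A $ j $ i))"

definition cscale :: "complex \<Rightarrow> mat2 \<Rightarrow> mat2" where
  "cscale c A = (\<chi> i j. c * A $ i $ j)"

definition comm :: "mat2 \<Rightarrow> mat2 \<Rightarrow> mat2" where
  "comm A B = A ** B - B ** A"

definition eigvals :: "mat2 \<Rightarrow> complex set" where
  "eigvals A = {lam. \<exists>v. v \<noteq> 0 \<and> A *v v = lam *s v}"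

definition eigproj :: "mat2 \<Rightarrow> complex \<Rightarrow> mat2" where
  "eigproj A lam = (THE P. P ** P = P \<and> adj P = P \<and>
                       (\<forall>v. P *v v = v \<longleftrightarrow> A *v v = lam *s v))"

definition mfun :: "(real \<Rightarrow> real) \<Rightarrow> mat2 \<Rightarrow> mat2" where
  "mfun f A = (\<Sum>lam\<in>eigvals A. f (Re lam) *\<^sub>R eigproj A lam)"

definition Hm :: "real \<Rightarrow> real \<Rightarrow> mat2" where
  "Hm g s = (\<chi> i j. complex_of_real (1/2 *
      (if i = 1 \<and> j = 1 then s else if i = 2 \<and> j = 2 then - s else g)))"

definition en :: "real \<Rightarrow> real \<Rightarrow> real" where
  "en g s = 1/2 * sqrt (s^2 + g^2)"

definition Pp :: "real \<Rightarrow> real \<Rightarrow> mat2" where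
  "Pp g s = eigproj (Hm g s) (complex_of_real (en g s))"

definition Pm :: "real \<Rightarrow> real \<Rightarrow> mat2" where
  "Pm g s = eigproj (Hm g s) (complex_of_real (- en g s))"

definition sqrtH :: "real \<Rightarrow> real \<Rightarrow> mat2" where
  "sqrtH g s = mfun (\<lambda>x. sgn x * sqrt \<bar>x\<bar>) (Hm g s)"

definition Lind :: "real \<Rightarrow> (real \<Rightarrow> real) \<Rightarrow> real \<Rightarrow> mat2 \<Rightarrow> mat2" where
  "Lind g gam s rho = cscale (- \<i>) (comm (Hm g s) rho)
      - (gam s / 2) *\<^sub>R comm (sqrtH g s) (comm (sqrtH g s) rho)"

definition is_propagator :: "real \<Rightarrow> (real \<Rightarrow> real) \<Rightarrow> real \<Rightarrow>
    (real \<Rightarrow> real \<Rightarrow> mat2 \<Rightarrow> mat2) \<Rightarrow> bool" where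
  "is_propagator g gam eps U \<longleftrightarrow>
     (\<forall>s' rho. U s' s' rho = rho \<and>
        (\<forall>s\<ge>s'. ((\<lambda>t. U t s' rho) has_vector_derivative
                    ((1/eps) *\<^sub>R Lind g gam s (U s s' rho))) (at s within {s'..})))"

definition smooth_fun :: "(real \<Rightarrow> real) \<Rightarrow> bool" where
  "smooth_fun f \<longleftrightarrow> (\<forall>n x. ((deriv ^^ n) f) differentiable (at x))"

end

theory Submission
  imports Defs "HOL-Probability.Distributions" "HOL-Probability.Sinc_Integral"
    "HOL-Complex_Analysis.Cauchy_Integral_Theorem" "HOL-Real_Asymp.Real_Asymp"
begin

text \<open>
  In Bloch coordinates adapted to the instantaneous eigenbasis, the Lindblad equation becomes a real
  population \<open>z\<close> coupled, with integrable strength \<open>g / (s\<^sup>2 + g\<^sup>2)\<close>, to a complex coherence \<open>w\<close> that rotates and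
  is damped at rate \<open>(i - \<gamma>) sqrt (s\<^sup>2 + g\<^sup>2) / \<epsilon>\<close>. A second-order adiabatic expansion shows that \<open>w\<close> follows
  \<open>z\<close> up to \<open>O(\<epsilon>\<^sup>2)\<close> and decays like \<open>|s|\<^sup>-\<^sup>3\<close> before the crossing.

  For \<open>\<gamma> = 0\<close> an exact solution is a contour integral of \<open>t\<^sup>-\<^sup>i\<^sup>\<kappa> exp (- t\<^sup>2 / 2 + c x t)\<close> with \<open>\<kappa> = g\<^sup>2 / (4 \<epsilon>)\<close>.
  Shifting the contour shows that it starts in the ground state, and comparing its values at \<open>x\<close> and \<open>- x\<close>
  through the jump \<open>exp (\<pi> \<kappa>)\<close> of the integrand at the branch point gives the Landau-Zener formula.

  Pairing the solution for \<open>\<gamma>\<close> with the time reversal of this exact solution expresses the deviation from the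
  Landau-Zener value as the integral of \<open>\<gamma>\<close> times a product of two coherences, one of which is small before and
  the other after the crossing. Inserting the adiabatic expansions yields the claimed integral and an error
  \<open>O(\<gamma> \<epsilon>\<^sup>2)\<close>.
\<close>

section \<open>Exponential transforms and contour shifts\<close>

text \<open>A series in powers of \<open>eps\<close> sees neither the exponentially small
  Landau-Zener term nor the proportionality of the remainder to the size of \<open>gam\<close>.
  Measuring the dephased solution against an exact one makes the zeroth order in \<open>gam\<close>
  exact, and everything else carries a factor \<open>gam\<close>. The price is a weight
  \<open>om / eps\<close>, growing like |s|, in the derivative of the pairing: for an integrable
  error of order \<open>eps^2\<close>, the product of the two coherences must be known up to
  \<open>eps^3 * om^(-3)\<close>. A forward solution decays like that only before the crossing;
  afterwards its coherence is known merely up to a uniform \<open>eps^2\<close>. Hence the reference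
  runs backwards in time: at each s one factor is O(\<open>eps * om^(-3)\<close>) and the error of
  the other is O(\<open>eps^2\<close>). The uniform \<open>eps^2\<close> takes two rounds: the crude
  bound \<open>cmod w \<le> 1\<close> yields \<open>w = O(eps)\<close>, and inserting this into the
  defect yields the second order. Since the claim covers every \<open>eps > 0\<close>, the case
  \<open>eps > 1\<close> is closed separately by crude bounds.\<close>

lemma integrable_gaussian_exp_abs:
  "integrable lborel (\<lambda>t::real. exp (- t\<^sup>2 / 2 + k * \<bar>t\<bar>))"
proof (rule Bochner_Integration.integrable_bound)
  have n: "integrable lborel (\<lambda>t. sqrt (2 * pi) * exp (k\<^sup>2 / 2) * normal_density m 1 t)" for m
    by (intro integrable_mult_right) (simp add: integrable_normal_density)
  show "integrable lborel (\<lambda>t. sqrt (2 * pi) * exp (k\<^sup>2 / 2) * normal_density k 1 t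
          + sqrt (2 * pi) * exp (k\<^sup>2 / 2) * normal_density (-k) 1 t)"
    by (intro Bochner_Integration.integrable_add n)
  show "AE t in lborel. norm (exp (- t\<^sup>2 / 2 + k * \<bar>t\<bar>)) \<le>
      norm (sqrt (2 * pi) * exp (k\<^sup>2 / 2) * normal_density k 1 t
          + sqrt (2 * pi) * exp (k\<^sup>2 / 2) * normal_density (-k) 1 t)"
  proof (rule AE_I2)
    fix t :: real
    have e: "sqrt (2 * pi) * exp (k\<^sup>2 / 2) * normal_density m 1 t = exp (- t\<^sup>2 / 2 + m * t)"
      if "m\<^sup>2 = k\<^sup>2" for m
    proof -
      have "k\<^sup>2 / 2 + - (t - m)\<^sup>2 / 2 = - t\<^sup>2 / 2 + m * t"
        using that by (simp add: power2_diff field_simps)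
      then show ?thesis
        by (simp add: normal_density_def flip: exp_add)
    qed
    have "exp (- t\<^sup>2 / 2 + k * \<bar>t\<bar>) \<le> exp (- t\<^sup>2 / 2 + k * t) + exp (- t\<^sup>2 / 2 + (-k) * t)"
      by (cases "t \<ge> 0") (auto simp: less_imp_le)
    then show "norm (exp (- t\<^sup>2 / 2 + k * \<bar>t\<bar>)) \<le>
      norm (sqrt (2 * pi) * exp (k\<^sup>2 / 2) * normal_density k 1 t
          + sqrt (2 * pi) * exp (k\<^sup>2 / 2) * normal_density (-k) 1 t)"
      unfolding e[OF refl] e[OF power2_minus] by simp
  qed
qed simp

text \<open>Differentiation under the integral sign through a quantitative Taylor remainder.
  Integrability against every exponential weight is a hypothesis that passes on to
  \<open>t * G t\<close>, so the lemma can be iterated for higher derivatives.\<close>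

lemma has_vector_derivative_exp_transform:
  fixes G :: "real \<Rightarrow> complex" and c :: complex
  assumes G [measurable]: "G \<in> borel_measurable lborel"
    and int: "\<And>k. integrable lborel (\<lambda>t. cmod (G t) * exp (k * \<bar>t\<bar>))"
  shows "integrable lborel (\<lambda>t. G t * exp (c * of_real x * of_real t))"
    and "((\<lambda>x. \<integral>t. G t * exp (c * of_real x * of_real t) \<partial>lborel) has_vector_derivative
      (\<integral>t. (c * of_real t * G t) * exp (c * of_real x * of_real t) \<partial>lborel)) (at x)"
proof -
  have ebound: "cmod (exp (c * of_real x * of_real t)) \<le> exp (cmod c * \<bar>x\<bar> * \<bar>t\<bar>)" for x t :: real
  proof -
    have "Re (c * of_real x * of_real t) \<le> cmod (c * of_real x * of_real t)"
      by (rule complex_Re_le_cmod)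
    then show ?thesis by (simp add: norm_mult)
  qed
  have I: "integrable lborel (\<lambda>t. G t * exp (c * of_real x * of_real t))" for x
  proof (rule Bochner_Integration.integrable_bound[OF int[of "cmod c * \<bar>x\<bar>"]])
    show "AE t in lborel. norm (G t * exp (c * of_real x * of_real t))
        \<le> norm (cmod (G t) * exp (cmod c * \<bar>x\<bar> * \<bar>t\<bar>))"
      using ebound by (intro AE_I2) (simp add: norm_mult mult_left_mono)
  qed measurable
  then show "integrable lborel (\<lambda>t. G t * exp (c * of_real x * of_real t))" .
  have tle: "\<bar>t\<bar> \<le> exp \<bar>t\<bar>" for t :: real
    using exp_ge_add_one_self[of "\<bar>t\<bar>"] by linarith
  have I1: "integrable lborel (\<lambda>t. (c * of_real t * G t) * exp (c * of_real x * of_real t))"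
  proof (rule Bochner_Integration.integrable_bound)
    show "integrable lborel (\<lambda>t. cmod c * (cmod (G t) * exp ((1 + cmod c * \<bar>x\<bar>) * \<bar>t\<bar>)))"
      by (intro integrable_mult_right int)
    show "AE t in lborel. norm (c * of_real t * G t * exp (c * of_real x * of_real t))
        \<le> norm (cmod c * (cmod (G t) * exp ((1 + cmod c * \<bar>x\<bar>) * \<bar>t\<bar>)))"
    proof (rule AE_I2)
      fix t :: real
      have "\<bar>t\<bar> * cmod (exp (c * of_real x * of_real t)) \<le> exp \<bar>t\<bar> * exp (cmod c * \<bar>x\<bar> * \<bar>t\<bar>)"
        by (intro mult_mono tle ebound) auto
      then have "cmod c * (cmod (G t) * (\<bar>t\<bar> * cmod (exp (c * of_real x * of_real t))))
        \<le> cmod c * (cmod (G t) * exp ((1 + cmod c * \<bar>x\<bar>) * \<bar>t\<bar>))"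
        by (intro mult_left_mono) (auto simp: exp_add[symmetric] algebra_simps)
      then show "norm (c * of_real t * G t * exp (c * of_real x * of_real t))
        \<le> norm (cmod c * (cmod (G t) * exp ((1 + cmod c * \<bar>x\<bar>) * \<bar>t\<bar>)))"
        by (simp add: norm_mult mult_ac)
    qed
  qed measurable
  let ?F = "\<lambda>x::real. \<integral>t. G t * exp (c * of_real x * of_real t) \<partial>lborel"
  let ?D = "\<integral>t. (c * of_real t * G t) * exp (c * of_real x * of_real t) \<partial>lborel"
  \<comment> \<open>The 2 absorbs \<open>t^2 \<le> exp (2 * |t|)\<close>,
    \<open>cmod c * |x|\<close> the kernel at x, and the last \<open>cmod c\<close> the exponential
    factor of the Taylor bound, where \<open>|h| \<le> 1\<close>.\<close>
  define k where "k = 2 + cmod c * \<bar>x\<bar> + cmod c"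
  define K where "K = (cmod c)\<^sup>2 * (\<integral>t. cmod (G t) * exp (k * \<bar>t\<bar>) \<partial>lborel)"
  have bound: "cmod (?F (x + h) - ?F x - h *\<^sub>R ?D) \<le> K * h\<^sup>2" if h: "\<bar>h\<bar> \<le> 1" for h
  proof -
    let ?E = "\<lambda>t. G t * exp (c * of_real (x + h) * of_real t) - G t * exp (c * of_real x * of_real t)
      - h *\<^sub>R ((c * of_real t * G t) * exp (c * of_real x * of_real t))"
    have "?F (x + h) - ?F x - h *\<^sub>R ?D = (\<integral>t. ?E t \<partial>lborel)"
      using I[of "x + h"] I[of x] I1 by (simp del: of_real_add)
    also have "cmod \<dots> \<le> (\<integral>t. (cmod c)\<^sup>2 * h\<^sup>2 * (cmod (G t) * exp (k * \<bar>t\<bar>)) \<partial>lborel)"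
    proof (rule Bochner_Integration.integral_norm_bound_integral)
      fix t :: real
      let ?z = "c * of_real h * of_real t"
      have E: "?E t = G t * exp (c * of_real x * of_real t) * (exp ?z - (\<Sum>i\<le>1. ?z ^ i / fact i))"
        by (simp add: algebra_simps exp_add scaleR_conv_of_real)
      have "\<bar>Re ?z\<bar> \<le> cmod ?z" by (rule abs_Re_le_cmod)
      also have "\<dots> = cmod c * \<bar>t\<bar> * \<bar>h\<bar>" by (simp add: norm_mult)
      also have "\<dots> \<le> cmod c * \<bar>t\<bar> * 1" using h by (intro mult_left_mono) auto
      finally have re: "exp \<bar>Re ?z\<bar> \<le> exp (cmod c * \<bar>t\<bar>)" by simp
      have "cmod ?z ^ Suc 1 = (cmod ?z)\<^sup>2" by (simp add: power2_eq_square)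
      also have "\<dots> = (cmod c)\<^sup>2 * h\<^sup>2 * t\<^sup>2" by (simp add: norm_mult power_mult_distrib)
      also have "\<dots> = (cmod c)\<^sup>2 * h\<^sup>2 * (\<bar>t\<bar> * \<bar>t\<bar>)" by (simp add: power2_eq_square)
      also have "\<dots> \<le> (cmod c)\<^sup>2 * h\<^sup>2 * (exp \<bar>t\<bar> * exp \<bar>t\<bar>)"
        by (intro mult_left_mono mult_mono tle) auto
      finally have sq: "cmod ?z ^ Suc 1 \<le> (cmod c)\<^sup>2 * h\<^sup>2 * (exp \<bar>t\<bar> * exp \<bar>t\<bar>)" .
      have "cmod (exp ?z - (\<Sum>i\<le>1. ?z ^ i / fact i)) \<le> exp \<bar>Re ?z\<bar> * cmod ?z ^ Suc 1 / fact 1"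
        by (rule Taylor_exp)
      also have "\<dots> \<le> exp (cmod c * \<bar>t\<bar>) * ((cmod c)\<^sup>2 * h\<^sup>2 * (exp \<bar>t\<bar> * exp \<bar>t\<bar>))"
        using mult_mono[OF re sq] by simp
      finally have T: "cmod (exp ?z - (\<Sum>i\<le>1. ?z ^ i / fact i))
        \<le> exp (cmod c * \<bar>t\<bar>) * ((cmod c)\<^sup>2 * h\<^sup>2 * (exp \<bar>t\<bar> * exp \<bar>t\<bar>))" .
      have "cmod (?E t) \<le> cmod (G t) * exp (cmod c * \<bar>x\<bar> * \<bar>t\<bar>) *
          (exp (cmod c * \<bar>t\<bar>) * ((cmod c)\<^sup>2 * h\<^sup>2 * (exp \<bar>t\<bar> * exp \<bar>t\<bar>)))"
        unfolding E norm_mult by (intro mult_mono ebound T) auto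
      also have "\<dots> = (cmod c)\<^sup>2 * h\<^sup>2 * (cmod (G t) * exp (k * \<bar>t\<bar>))"
        by (simp add: k_def exp_add[symmetric] algebra_simps)
      finally show "cmod (?E t) \<le> (cmod c)\<^sup>2 * h\<^sup>2 * (cmod (G t) * exp (k * \<bar>t\<bar>))" .
    qed (use I I1 int in \<open>auto intro!: integrable_mult_right Bochner_Integration.integrable_diff integrable_scaleR_right simp del: of_real_add\<close>)
    also have "\<dots> = K * h\<^sup>2" by (simp add: K_def)
    finally show ?thesis .
  qed
  have "((\<lambda>h. cmod (?F (x + h) - ?F x - h *\<^sub>R ?D) / norm h) \<longlongrightarrow> 0) (at 0)"
  proof (rule Lim_null_comparison)
    show "((\<lambda>h. K * \<bar>h\<bar>) \<longlongrightarrow> 0) (at 0)"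
      by (auto intro!: tendsto_eq_intros)
    show "\<forall>\<^sub>F h in at 0. norm (cmod (?F (x + h) - ?F x - h *\<^sub>R ?D) / norm h) \<le> K * \<bar>h\<bar>"
      unfolding eventually_at
    proof (intro exI[of _ 1] conjI ballI impI)
      fix h :: real assume h: "h \<noteq> 0 \<and> dist h 0 < 1"
      then have "cmod (?F (x + h) - ?F x - h *\<^sub>R ?D) / \<bar>h\<bar> \<le> K * h\<^sup>2 / \<bar>h\<bar>"
        by (intro divide_right_mono bound) auto
      also have "\<dots> = K * \<bar>h\<bar>" using h by (simp add: power2_eq_square abs_mult_self_eq field_simps flip: abs_mult)
      finally show "norm (cmod (?F (x + h) - ?F x - h *\<^sub>R ?D) / norm h) \<le> K * \<bar>h\<bar>" by simp
    qed simp
  qed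
  then show "(?F has_vector_derivative ?D) (at x)"
    unfolding has_vector_derivative_def has_derivative_at
    by (simp add: bounded_linear_scaleR_left)
qed

text \<open>Connects antiderivatives on compact intervals with Lebesgue integrals over the line:
  \<open>I n\<close> is typically a difference of boundary values whose limit is computed
  separately.\<close>

lemma has_integral_truncations_tendsto:
  fixes f :: "real \<Rightarrow> 'a::euclidean_space"
  assumes f: "integrable lborel f"
    and I: "\<And>n. (f has_integral I n) {- real n..real n}"
  shows "I \<longlonglongrightarrow> (\<integral>u. f u \<partial>lborel)"
proof -
  have [measurable]: "f \<in> borel_measurable lborel" using f by auto
  have "(\<lambda>n. \<integral>u. indicator {- real n..real n} u *\<^sub>R f u \<partial>lborel) \<longlonglongrightarrow> (\<integral>u. f u \<partial>lborel)"
  proof (rule integral_dominated_convergence[OF _ _ integrable_norm[OF f]])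
    show "AE u in lborel. (\<lambda>n. indicator {- real n..real n} u *\<^sub>R f u) \<longlonglongrightarrow> f u"
    proof (rule AE_I2)
      fix u :: real
      have "\<forall>\<^sub>F n in sequentially. \<bar>u\<bar> \<le> real n"
        using eventually_ge_at_top[of "nat \<lceil>\<bar>u\<bar>\<rceil>"] by eventually_elim linarith
      then have "\<forall>\<^sub>F n in sequentially. indicator {- real n..real n} u *\<^sub>R f u = f u"
        by eventually_elim (auto simp: indicator_def)
      then show "(\<lambda>n. indicator {- real n..real n} u *\<^sub>R f u) \<longlonglongrightarrow> f u"
        by (rule tendsto_eventually)
    qed
  qed (auto simp: indicator_def)
  moreover have "(\<integral>u. indicator {- real n..real n} u *\<^sub>R f u \<partial>lborel) = I n" for n
  proof -
    have "set_integrable lborel {- real n..real n} f"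
      unfolding set_integrable_def by (rule integrable_mult_indicator[OF _ f]) simp
    from set_borel_integral_eq_integral(2)[OF this] show ?thesis
      using integral_unique[OF I] unfolding set_lebesgue_integral_def by simp
  qed
  ultimately show ?thesis by simp
qed

text \<open>Holomorphy is asked only above the real axis, because the branch point of the later
  integrand sits on the axis. Lines at positive heights are compared by means of a primitive; the
  axis itself is reached as the height tends to 0, with \<open>K\<close> dominating all lines at
  once. The point u = 0, where no limit is assumed, is a null set.\<close>

lemma integral_shift_upper_half_plane:
  fixes h :: "complex \<Rightarrow> complex" and K :: "real \<Rightarrow> real"
  assumes hol: "h holomorphic_on {z. Im z > 0}"
    and "Y > 0"
    and meas [measurable]: "(\<lambda>u. h (of_real u)) \<in> borel_measurable lborel"
    and bd: "\<And>u y. 0 \<le> y \<Longrightarrow> y \<le> Y \<Longrightarrow> cmod (h (Complex u y)) \<le> K u"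
    and K: "integrable lborel K" "(K \<longlongrightarrow> 0) at_top" "(K \<longlongrightarrow> 0) at_bot"
    and lim: "\<And>u. u \<noteq> 0 \<Longrightarrow> ((\<lambda>y. h (Complex u y)) \<longlongrightarrow> h (of_real u)) (at_right 0)"
  shows "(\<integral>u. h (of_real u) \<partial>lborel) = (\<integral>u. h (Complex u Y) \<partial>lborel)"
proof -
  have cvx: "convex {z. Im z > 0}" by (rule convex_halfspace_Im_gt)
  have opn: "open {z. Im z > 0}" by (rule open_halfspace_Im_gt)
  obtain \<Phi> where \<Phi>: "\<And>z. Im z > 0 \<Longrightarrow> (\<Phi> has_field_derivative h z) (at z)"
    using holomorphic_convex_primitive'[OF cvx opn hol] by (auto simp: at_within_open[OF _ opn])
  have contC: "continuous_on UNIV (\<lambda>u. Complex u y)" for y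
    by (auto simp: Complex_eq intro!: continuous_intros)
  have cont: "continuous_on UNIV (\<lambda>u. h (Complex u y))" if "y > 0" for y
    by (rule continuous_on_compose2[OF holomorphic_on_imp_continuous_on[OF hol] contC])
      (use that in auto)
  have meas': "(\<lambda>u. h (Complex u y)) \<in> borel_measurable lborel" if "y > 0" for y
    using borel_measurable_continuous_onI[OF cont[OF that]] by simp
  have integ: "integrable lborel (\<lambda>u. h (Complex u y))" if "0 < y" "y \<le> Y" for y
    using that by (intro Bochner_Integration.integrable_bound[OF K(1)] meas' AE_I2)
      (auto intro: order_trans[OF bd abs_ge_self])
  have K0: "K u \<ge> 0" for u
    using bd[of 0 u] \<open>Y > 0\<close> norm_ge_zero order_trans by (metis less_imp_le order_refl)
  have trunc: "(\<lambda>n. \<Phi> (Complex (real n) y) - \<Phi> (Complex (- real n) y))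
      \<longlonglongrightarrow> (\<integral>u. h (Complex u y) \<partial>lborel)" if y: "0 < y" "y \<le> Y" for y
  proof -
    show ?thesis
    proof (rule has_integral_truncations_tendsto[OF integ[OF y]])
      fix n
      show "((\<lambda>u. h (Complex u y)) has_integral (\<Phi> (Complex (real n) y) - \<Phi> (Complex (- real n) y))) {- real n..real n}"
      proof (rule fundamental_theorem_of_calculus)
        fix u
        have "((\<lambda>u. Complex u y) has_vector_derivative 1) (at u within {- real n..real n})"
          unfolding Complex_eq by (auto intro!: derivative_eq_intros simp: has_vector_derivative_of_real)
        from field_vector_diff_chain_within[OF this, of \<Phi> "h (Complex u y)"]
        show "((\<lambda>u. \<Phi> (Complex u y)) has_vector_derivative h (Complex u y)) (at u within {- real n..real n})"
          using \<Phi>[of "Complex u y"] y by (auto simp: o_def intro: has_field_derivative_at_within)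
      qed simp
    qed
  qed
  have step: "cmod (\<Phi> (Complex v y) - \<Phi> (Complex v Y)) \<le> K v * (Y - y)" if y: "0 < y" "y \<le> Y" for v y
  proof -
    have seg: "Re z = v \<and> y \<le> Im z \<and> Im z \<le> Y" if "z \<in> closed_segment (Complex v y) (Complex v Y)" for z
      using that \<open>y \<le> Y\<close> unfolding closed_segment_same_Re[of "Complex v y" "Complex v Y", simplified]
      by (auto simp: closed_segment_eq_real_ivl)
    have "cmod (\<Phi> (Complex v y) - \<Phi> (Complex v Y)) \<le> K v * cmod (Complex v y - Complex v Y)"
    proof (rule field_differentiable_bound[where f' = h])
      show "convex (closed_segment (Complex v y) (Complex v Y))" by simp
    next
      fix z assume "z \<in> closed_segment (Complex v y) (Complex v Y)"
      note z = seg[OF this]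
      show "(\<Phi> has_field_derivative h z) (at z within closed_segment (Complex v y) (Complex v Y))"
        using z y by (intro has_field_derivative_at_within[OF \<Phi>]) auto
      have "z = Complex v (Im z)" using z by (simp add: complex_eq_iff)
      then show "cmod (h z) \<le> K v" using bd[of "Im z" v] z y by auto
    qed auto
    also have "cmod (Complex v y - Complex v Y) = Y - y"
      using y by (simp add: cmod_def)
    finally show ?thesis .
  qed
  have same: "(\<integral>u. h (Complex u y) \<partial>lborel) = (\<integral>u. h (Complex u Y) \<partial>lborel)"
    if y: "0 < y" "y \<le> Y" for y
  proof -
    \<comment> \<open>The difference of the truncated integrals at the two heights is the
      contribution of the two vertical sides, and \<open>K\<close> makes it vanish as n
      grows.\<close>
    have "(\<lambda>n. (\<Phi> (Complex (real n) y) - \<Phi> (Complex (- real n) y))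
        - (\<Phi> (Complex (real n) Y) - \<Phi> (Complex (- real n) Y))) \<longlonglongrightarrow> 0"
    proof (rule Lim_null_comparison)
      have "(\<lambda>n. K (real n)) \<longlonglongrightarrow> 0" "(\<lambda>n. K (- real n)) \<longlonglongrightarrow> 0"
        by (rule filterlim_compose[OF K(2) filterlim_real_sequentially],
            rule filterlim_compose[OF K(3)])
          (rule filterlim_compose[OF filterlim_uminus_at_bot_at_top filterlim_real_sequentially])
      then have "(\<lambda>n. K (real n) * (Y - y) + K (- real n) * (Y - y)) \<longlonglongrightarrow> 0 * (Y - y) + 0 * (Y - y)"
        by (intro tendsto_intros)
      then show "(\<lambda>n. K (real n) * (Y - y) + K (- real n) * (Y - y)) \<longlonglongrightarrow> 0" by simp
      show "\<forall>\<^sub>F n in sequentially. norm ((\<Phi> (Complex (real n) y) - \<Phi> (Complex (- real n) y))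
        - (\<Phi> (Complex (real n) Y) - \<Phi> (Complex (- real n) Y))) \<le> K (real n) * (Y - y) + K (- real n) * (Y - y)"
      proof (rule always_eventually, rule allI)
        fix n
        have "(\<Phi> (Complex (real n) y) - \<Phi> (Complex (- real n) y))
          - (\<Phi> (Complex (real n) Y) - \<Phi> (Complex (- real n) Y))
          = (\<Phi> (Complex (real n) y) - \<Phi> (Complex (real n) Y))
          - (\<Phi> (Complex (- real n) y) - \<Phi> (Complex (- real n) Y))" by simp
        then show "norm ((\<Phi> (Complex (real n) y) - \<Phi> (Complex (- real n) y))
        - (\<Phi> (Complex (real n) Y) - \<Phi> (Complex (- real n) Y))) \<le> K (real n) * (Y - y) + K (- real n) * (Y - y)"
          using step[OF y, of "real n"] step[OF y, of "- real n"]
          by (metis (no_types, lifting) add_mono norm_triangle_ineq4 order_trans)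
      qed
    qed
    moreover have "(\<lambda>n. (\<Phi> (Complex (real n) y) - \<Phi> (Complex (- real n) y))
        - (\<Phi> (Complex (real n) Y) - \<Phi> (Complex (- real n) Y))) \<longlonglongrightarrow>
        (\<integral>u. h (Complex u y) \<partial>lborel) - (\<integral>u. h (Complex u Y) \<partial>lborel)"
      using \<open>Y > 0\<close> by (intro tendsto_diff trunc y) auto
    ultimately show ?thesis using LIMSEQ_unique by fastforce
  qed
  define \<eta> where "\<eta> n = Y / (real n + 1)" for n
  have \<eta>: "0 < \<eta> n" "\<eta> n \<le> Y" for n
    using \<open>Y > 0\<close> by (auto simp: \<eta>_def field_simps)
  have "(\<lambda>n. \<eta> n) \<longlonglongrightarrow> 0"
    unfolding \<eta>_def using LIMSEQ_Suc[OF lim_const_over_n[of Y]] by (simp add: add.commute)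
  moreover have "\<eta> n \<noteq> 0" for n using \<eta>(1)[of n] by simp
  ultimately have \<eta>0: "filterlim \<eta> (at_right 0) sequentially"
    using \<eta>(1) by (auto simp: filterlim_at intro!: always_eventually)
  have "(\<lambda>n. \<integral>u. h (Complex u (\<eta> n)) \<partial>lborel) \<longlonglongrightarrow> (\<integral>u. h (of_real u) \<partial>lborel)"
  proof (rule integral_dominated_convergence[OF meas meas'[OF \<eta>(1)] K(1)])
    have "AE u in lborel. u \<noteq> (0::real)" by (rule AE_lborel_singleton)
    then show "AE u in lborel. (\<lambda>n. h (Complex u (\<eta> n))) \<longlonglongrightarrow> h (of_real u)"
      by eventually_elim (rule filterlim_compose[OF lim \<eta>0])
    show "AE u in lborel. norm (h (Complex u (\<eta> n))) \<le> K u" for n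
      using bd \<eta> by (intro AE_I2) (auto simp: less_imp_le)
  qed
  moreover have "(\<lambda>n. \<integral>u. h (Complex u (\<eta> n)) \<partial>lborel) = (\<lambda>n. \<integral>u. h (Complex u Y) \<partial>lborel)"
    using same \<eta> by auto
  ultimately have "(\<lambda>n::nat. \<integral>u. h (Complex u Y) \<partial>lborel) \<longlonglongrightarrow> (\<integral>u. h (of_real u) \<partial>lborel)"
    by simp
  then show ?thesis by (rule LIMSEQ_unique) (rule tendsto_const)
qed

section \<open>Comparison principles\<close>

text \<open>Since \<open>Re (lam s) \<le> 0\<close>, the linear term cannot increase the norm
  however fast it rotates, so only the forcing \<open>E\<close> counts and the bound is insensitive
  to the size of \<open>lam\<close>. Majorizing the forcing by the derivative of an explicit
  \<open>K\<close> turns the bound into an increment of \<open>K\<close>.\<close>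

lemma dissipative_comparison:
  fixes r :: "real \<Rightarrow> complex"
  assumes "a \<le> b"
    and r: "\<And>s. a \<le> s \<Longrightarrow> s \<le> b \<Longrightarrow>
          (r has_vector_derivative (lam s * r s + E s)) (at s within {a..b})"
    and lam: "\<And>s. a \<le> s \<Longrightarrow> s \<le> b \<Longrightarrow> Re (lam s) \<le> 0"
    and K: "\<And>s. a \<le> s \<Longrightarrow> s \<le> b \<Longrightarrow> (K has_real_derivative K' s) (at s within {a..b})"
    and E: "\<And>s. a \<le> s \<Longrightarrow> s \<le> b \<Longrightarrow> cmod (E s) \<le> K' s"
  shows "cmod (r b) \<le> cmod (r a) + (K b - K a)"
proof (cases "a = b")
  case False
  then have "a < b" using \<open>a \<le> b\<close> by simp
  show ?thesis
  proof (rule field_le_epsilon)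
    fix d :: real assume "d > 0"
    \<comment> \<open>the norm itself need not be differentiable where \<open>r\<close> vanishes\<close>
    define N where "N s = sqrt (r s \<bullet> r s + d\<^sup>2)" for s
    define N' where "N' s = (r s \<bullet> (lam s * r s + E s)) / N s" for s
    have pos: "r s \<bullet> r s + d\<^sup>2 > 0" for s
      using \<open>d > 0\<close> by (simp add: add_nonneg_pos)
    have dN: "((\<lambda>s. N s - K s) has_real_derivative (N' s - K' s)) (at s within {a..b})"
      if s: "a \<le> s" "s \<le> b" for s
    proof -
      have "((\<lambda>s. r s \<bullet> r s) has_real_derivative 2 * (r s \<bullet> (lam s * r s + E s))) (at s within {a..b})"
        unfolding has_real_derivative_iff_has_vector_derivative
        using bounded_bilinear.has_vector_derivative[OF bounded_bilinear_inner r[OF s] r[OF s]]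
        by (simp add: inner_commute)
      then have "(N has_real_derivative N' s) (at s within {a..b})"
        unfolding N_def N'_def using pos[of s]
        by (auto intro!: derivative_eq_intros simp: divide_simps)
      then show ?thesis by (intro DERIV_diff K s)
    qed
    have le: "N' s - K' s \<le> 0" if s: "a \<le> s" "s \<le> b" for s
    proof -
      have nN: "cmod (r s) \<le> N s"
        unfolding N_def by (rule real_le_rsqrt) (simp add: power2_norm_eq_inner)
      have "N s > 0" unfolding N_def using pos by simp
      have "r s \<bullet> (lam s * r s) = Re (lam s) * (cmod (r s))\<^sup>2"
        by (simp add: inner_complex_def cmod_power2) (simp add: algebra_simps power2_eq_square)
      also have "\<dots> \<le> 0" using lam[OF s] by (simp add: mult_nonpos_nonneg)
      finally have "r s \<bullet> (lam s * r s + E s) \<le> r s \<bullet> E s" by (simp add: inner_add_right)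
      also have "\<dots> \<le> cmod (r s) * cmod (E s)" by (rule norm_cauchy_schwarz)
      also have "\<dots> \<le> N s * K' s" by (intro mult_mono nN E s) (use \<open>N s > 0\<close> in auto)
      finally have "N' s \<le> K' s" unfolding N'_def using \<open>N s > 0\<close> by (simp add: divide_le_eq mult.commute)
      then show ?thesis by simp
    qed
    obtain x where x: "x \<in> {a<..<b}" "(N b - K b) - (N a - K a) = (N' x - K' x) * (b - a)"
      using mvt_simple[OF \<open>a < b\<close>, of "\<lambda>s. N s - K s" "\<lambda>x h. (N' x - K' x) * h"] dN
      by (auto simp: has_field_derivative_def)
    moreover have "(N' x - K' x) * (b - a) \<le> 0"
      using x le[of x] \<open>a < b\<close> by (intro mult_nonpos_nonneg) auto
    ultimately have "N b \<le> N a + (K b - K a)" by linarith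
    moreover have "cmod (r b) \<le> N b"
      unfolding N_def by (rule real_le_rsqrt) (simp add: power2_norm_eq_inner)
    moreover have "N a \<le> cmod (r a) + d"
      unfolding N_def using \<open>d > 0\<close>
      by (intro real_le_lsqrt) (auto simp: power2_sum power2_norm_eq_inner)
    ultimately show "cmod (r b) \<le> cmod (r a) + (K b - K a) + d" by linarith
  qed
qed simp

lemma abs_diff_le_comparison:
  fixes f :: "real \<Rightarrow> real"
  assumes "a \<le> b"
    and f: "\<And>s. a \<le> s \<Longrightarrow> s \<le> b \<Longrightarrow> (f has_real_derivative f' s) (at s within {a..b})"
    and K: "\<And>s. a \<le> s \<Longrightarrow> s \<le> b \<Longrightarrow> (K has_real_derivative K' s) (at s within {a..b})"
    and le: "\<And>s. a \<le> s \<Longrightarrow> s \<le> b \<Longrightarrow> \<bar>f' s\<bar> \<le> K' s"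
  shows "\<bar>f b - f a\<bar> \<le> K b - K a"
proof -
  have "cmod (of_real (f b - f a)) \<le> cmod (of_real (f a - f a)) + (K b - K a)"
  proof (rule dissipative_comparison[where lam = "\<lambda>_. 0" and E = "\<lambda>s. of_real (f' s)", OF \<open>a \<le> b\<close> _ _ K])
    fix s assume s: "a \<le> s" "s \<le> b"
    have "((\<lambda>s. f s - f a) has_real_derivative f' s) (at s within {a..b})"
      using f[OF s] by (auto intro!: derivative_eq_intros)
    then show "((\<lambda>s. complex_of_real (f s - f a)) has_vector_derivative
        (0 * of_real (f s - f a) + of_real (f' s))) (at s within {a..b})"
      using has_vector_derivative_of_real by fastforce
  qed (use le in auto)
  then show ?thesis by (simp del: of_real_diff)
qed

section \<open>The energy gap \<open>om\<close>, which is twice \<open>en\<close>, and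
  antiderivatives built from it\<close>

definition om :: "real \<Rightarrow> real \<Rightarrow> real" where
  "om g s = sqrt (s\<^sup>2 + g\<^sup>2)"

lemma om_pos: "g > 0 \<Longrightarrow> om g s > 0"
  by (simp add: om_def add_nonneg_pos)

lemma om_sq: "(om g s)\<^sup>2 = s\<^sup>2 + g\<^sup>2"
  by (simp add: om_def)

lemma om_ge: "g > 0 \<Longrightarrow> g \<le> om g s"
  by (simp add: om_def real_le_rsqrt)

lemma abs_le_om: "\<bar>s\<bar> \<le> om g s"
  by (simp add: om_def real_le_rsqrt)

lemma om_minus [simp]: "om g (- s) = om g s"
  by (simp add: om_def)

lemma om_mono: "\<bar>s\<bar> \<le> \<bar>t\<bar> \<Longrightarrow> om g s \<le> om g t"
  by (simp add: om_def abs_le_square_iff)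

lemma DERIV_om:
  assumes "g > 0"
  shows "(om g has_real_derivative s / om g s) (at s within S)"
  unfolding om_def using assms add_nonneg_pos[of "s\<^sup>2" "g\<^sup>2"]
  by (auto intro!: derivative_eq_intros simp: divide_simps)

lemma DERIV_inverse_om:
  assumes "g > 0"
  shows "((\<lambda>s. inverse (om g s)) has_real_derivative - (s * inverse (om g s) ^ 3)) (at s within S)"
  using om_pos[OF assms, of s]
  by (auto intro!: derivative_eq_intros DERIV_om[OF assms] simp: field_simps power3_eq_cube power2_eq_square)

text \<open>The rotation speed of the eigenbasis is \<open>g / om^2\<close>. This antiderivative is
  bounded, so errors weighted by \<open>1 / om^2\<close> accumulate to at most \<open>pi / g\<close>
  over any interval.\<close>

lemma DERIV_arctan_om:
  assumes "g > 0"
  shows "((\<lambda>s. arctan (s / g) / g) has_real_derivative (inverse (om g s))\<^sup>2) (at s within S)"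
proof -
  have "inverse (1 + (s / g)\<^sup>2) * (1 / g) / g = (inverse (om g s))\<^sup>2"
    using assms add_nonneg_pos[of "s^2" "g^2"] by (simp add: power_inverse om_sq divide_simps) (simp add: power2_eq_square)
  then show ?thesis
    using assms by (auto intro!: derivative_eq_intros)
qed

lemma arctan_diff_le:
  assumes "g > 0" shows "arctan (b / g) / g - arctan (a / g) / g \<le> pi / g"
  using arctan_bounded[of "b / g"] arctan_bounded[of "a / g"] assms
  by (simp add: diff_divide_distrib[symmetric] divide_right_mono)

section \<open>The Lindblad generator on Bloch vectors\<close>

text \<open>For \<open>\<sigma> = 1\<close> and \<open>\<sigma> = - 1\<close> these are the two
  spectral projections: half of the identity plus or minus the Pauli matrix along the unit vector
  \<open>(g, 0, s) / om\<close>. The parameter lets one computation treat both.\<close>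

definition spin_proj :: "real \<Rightarrow> real \<Rightarrow> real \<Rightarrow> mat2" where
  "spin_proj \<sigma> g s = (\<chi> i j. complex_of_real (1/2 *
     (if i = 1 \<and> j = 1 then 1 + \<sigma> * s / om g s
      else if i = 2 \<and> j = 2 then 1 - \<sigma> * s / om g s else \<sigma> * g / om g s)))"

lemmas mat2_simps = vec_eq_iff forall_2 matrix_matrix_mult_def matrix_vector_mult_def sum_2 adj_def

lemma spin_proj_nth:
  "spin_proj \<sigma> g s $ 1 $ 1 = of_real (1/2 * (1 + \<sigma> * s / om g s))"
  "spin_proj \<sigma> g s $ 1 $ 2 = of_real (1/2 * (\<sigma> * g / om g s))"
  "spin_proj \<sigma> g s $ 2 $ 1 = of_real (1/2 * (\<sigma> * g / om g s))"
  "spin_proj \<sigma> g s $ 2 $ 2 = of_real (1/2 * (1 - \<sigma> * s / om g s))"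
  by (simp_all add: spin_proj_def)

lemma Hm_nth:
  "Hm g s $ 1 $ 1 = of_real (1/2 * s)" "Hm g s $ 1 $ 2 = of_real (1/2 * g)"
  "Hm g s $ 2 $ 1 = of_real (1/2 * g)" "Hm g s $ 2 $ 2 = of_real (1/2 * (- s))"
  by (simp_all add: Hm_def)

lemma adj_mult: "adj (A ** B) = adj B ** adj A"
  by (simp add: mat2_simps mult.commute)

text \<open>The description in \<open>eigproj\<close> is unique because two self-adjoint idempotents
  with the same fixed vectors absorb one another: \<open>P ** Q = Q\<close> and
  \<open>Q ** P = P\<close>, and taking the adjoint of the first forces equality.\<close>

lemma eigproj_eqI:
  assumes "P ** P = P" "adj P = P" "\<And>v. P *v v = v \<longleftrightarrow> A *v v = lam *s v"
  shows "eigproj A lam = P"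
  unfolding eigproj_def
proof (rule the_equality)
  show "P ** P = P \<and> adj P = P \<and> (\<forall>v. P *v v = v \<longleftrightarrow> A *v v = lam *s v)"
    using assms by blast
next
  fix Q assume Q: "Q ** Q = Q \<and> adj Q = Q \<and> (\<forall>v. Q *v v = v \<longleftrightarrow> A *v v = lam *s v)"
  have range: "P1 ** P2 = P2"
    if "P2 ** P2 = P2" "\<And>v. P2 *v v = v \<Longrightarrow> P1 *v v = v" for P1 P2 :: mat2
    using that by (metis matrix_eq matrix_vector_mul_assoc)
  have "P ** Q = Q" "Q ** P = P" using Q assms by (auto intro!: range)
  then show "Q = P" using Q assms(2) by (metis adj_mult)
qed

lemma spin_proj_idem:
  assumes g: "g > 0" and \<sigma>: "\<sigma> = 1 \<or> \<sigma> = - 1"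
  shows "spin_proj \<sigma> g s ** spin_proj \<sigma> g s = spin_proj \<sigma> g s"
proof -
  have p: "om g s \<noteq> 0" using om_pos[OF g, of s] by simp
  have sq: "\<sigma> * \<sigma> = 1" using \<sigma> by auto
  have o2: "om g s * om g s = s * s + g * g" using om_sq[of g s] by (simp add: power2_eq_square)
  define a b where "a = \<sigma> * s / om g s" and "b = \<sigma> * g / om g s"
  have "a * a + b * b = (\<sigma> * \<sigma>) * (s * s + g * g) / (om g s * om g s)"
    by (simp add: a_def b_def add_divide_distrib algebra_simps)
  then have ab: "a * a + b * b = 1" using p sq o2 g by simp
  have f1: "(1/2 * (1 + a)) * (1/2 * (1 + a)) + (1/2 * b) * (1/2 * b) = 1/2 * (1 + a)"
    "(1/2 * b) * (1/2 * b) + (1/2 * (1 - a)) * (1/2 * (1 - a)) = 1/2 * (1 - a)"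
  proof -
    have 1: "(1/2 * (1 + a)) * (1/2 * (1 + a)) + (1/2 * b) * (1/2 * b) = 1/4 * (1 + 2 * a + (a * a + b * b))"
      by (simp add: field_simps)
    have 2: "(1/2 * b) * (1/2 * b) + (1/2 * (1 - a)) * (1/2 * (1 - a)) = 1/4 * (1 - 2 * a + (a * a + b * b))"
      by (simp add: field_simps)
    show "(1/2 * (1 + a)) * (1/2 * (1 + a)) + (1/2 * b) * (1/2 * b) = 1/2 * (1 + a)"
      unfolding 1 ab by simp
    show "(1/2 * b) * (1/2 * b) + (1/2 * (1 - a)) * (1/2 * (1 - a)) = 1/2 * (1 - a)"
      unfolding 2 ab by simp
  qed
  have f2: "(1/2 * (1 + a)) * (1/2 * b) + (1/2 * b) * (1/2 * (1 - a)) = 1/2 * b"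
    "(1/2 * b) * (1/2 * (1 + a)) + (1/2 * (1 - a)) * (1/2 * b) = 1/2 * b"
    by (simp_all add: field_simps)
  show ?thesis
    unfolding vec_eq_iff forall_2 matrix_matrix_mult_def vec_lambda_beta sum_2 spin_proj_nth
      a_def[symmetric] b_def[symmetric] of_real_mult[symmetric] of_real_add[symmetric] f1 f2
    by simp
qed

lemma spin_proj_is_eigproj:
  assumes g: "g > 0" and \<sigma>: "\<sigma> = 1 \<or> \<sigma> = - 1"
  shows "eigproj (Hm g s) (complex_of_real (\<sigma> * en g s)) = spin_proj \<sigma> g s"
proof (rule eigproj_eqI)
  have p: "om g s \<noteq> 0" using om_pos[OF g, of s] by simp
  show "spin_proj \<sigma> g s ** spin_proj \<sigma> g s = spin_proj \<sigma> g s"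
    by (rule spin_proj_idem[OF assms])
  show "adj (spin_proj \<sigma> g s) = spin_proj \<sigma> g s"
    by (simp add: mat2_simps spin_proj_def)
  show "spin_proj \<sigma> g s *v v = v \<longleftrightarrow> Hm g s *v v = complex_of_real (\<sigma> * en g s) *s v" for v
  proof -
    \<comment> \<open>One row of the two vector equations: their defects differ by the nonzero
      factor \<open>\<sigma> / om\<close>, because \<open>\<sigma>^2 = 1\<close>. The second row is
      the first with \<open>s\<close> replaced by \<open>- s\<close>.\<close>
    have aux: "(complex_of_real (1/2 * (1 + \<sigma> * t / om g s)) * x + of_real (1/2 * (\<sigma> * g / om g s)) * y = x)
        \<longleftrightarrow> (of_real (1/2 * t) * x + of_real (1/2 * g) * y = of_real (\<sigma> * (om g s / 2)) * x)" for t x y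
    proof -
      have "complex_of_real (1/2 * (1 + \<sigma> * t / om g s)) * x + of_real (1/2 * (\<sigma> * g / om g s)) * y - x
        = of_real (\<sigma> / om g s) * (of_real (1/2 * t) * x + of_real (1/2 * g) * y - of_real (\<sigma> * (om g s / 2)) * x)"
        using p \<sigma> by (auto simp: field_simps)
      moreover have "complex_of_real (\<sigma> / om g s) \<noteq> 0" using p \<sigma> by auto
      ultimately show ?thesis by (metis eq_iff_diff_eq_0 mult_eq_0_iff)
    qed
    have en: "en g s = om g s / 2" by (simp add: en_def om_def)
    have aux2: "(of_real (1/2 * (\<sigma> * g / om g s)) * y + complex_of_real (1/2 * (1 - \<sigma> * s / om g s)) * x = x)
        \<longleftrightarrow> (of_real (1/2 * g) * y + of_real (1/2 * (- s)) * x = of_real (\<sigma> * (om g s / 2)) * x)" for x y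
      using aux[of "- s" x y] by (simp add: add.commute)
    show ?thesis
      unfolding vec_eq_iff forall_2 matrix_vector_mult_def vec_lambda_beta sum_2 spin_proj_nth Hm_nth
        vector_scalar_mult_def en aux aux2 ..
  qed
qed

lemma eigvals_Hm:
  assumes g: "g > 0"
  shows "eigvals (Hm g s) = {complex_of_real (en g s), complex_of_real (- en g s)}"
proof (rule set_eqI)
  fix lam :: complex
  define G S E where "G = complex_of_real (g / 2)" and "S = complex_of_real (s / 2)" and "E = complex_of_real (en g s)"
  have E2: "E * E = S * S + G * G"
    by (simp add: G_def S_def E_def en_def power2_eq_square flip: of_real_mult of_real_add)
  have G: "G \<noteq> 0" using g by (simp add: G_def)
  have H: "Hm g s *v v = lam *s v \<longleftrightarrow> S * v$1 + G * v$2 = lam * v$1 \<and> G * v$1 - S * v$2 = lam * v$2" for v lam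
    by (simp add: mat2_simps Hm_def G_def S_def)
  show "lam \<in> eigvals (Hm g s) \<longleftrightarrow> lam \<in> {complex_of_real (en g s), complex_of_real (- en g s)}"
  proof
    assume "lam \<in> eigvals (Hm g s)"
    then obtain v where v0: "v \<noteq> 0" and "Hm g s *v v = lam *s v"
      unfolding eigvals_def by blast
    then have v1: "S * v$1 + G * v$2 = lam * v$1" and v2: "G * v$1 - S * v$2 = lam * v$2"
      using H[of v lam] by blast+
    \<comment> \<open>Applying the matrix twice multiplies by \<open>E^2\<close>, so
      \<open>lam^2 = E^2\<close> as soon as a component is nonzero.\<close>
    have "(lam - E) * (lam + E) * v$1 = 0" "(lam - E) * (lam + E) * v$2 = 0"
    proof -
      have "lam * (lam * v$1) = lam * (S * v$1 + G * v$2)" by (simp only: v1)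
      also have "\<dots> = S * (lam * v$1) + G * (lam * v$2)" by (simp add: algebra_simps)
      also have "\<dots> = S * (S * v$1 + G * v$2) + G * (G * v$1 - S * v$2)" by (simp only: v1 v2)
      also have "\<dots> = E * E * v$1" unfolding E2 by (simp add: algebra_simps)
      finally show "(lam - E) * (lam + E) * v$1 = 0" by (simp add: algebra_simps)
      have "lam * (lam * v$2) = lam * (G * v$1 - S * v$2)" by (simp only: v2)
      also have "\<dots> = G * (lam * v$1) - S * (lam * v$2)" by (simp add: algebra_simps)
      also have "\<dots> = G * (S * v$1 + G * v$2) - S * (G * v$1 - S * v$2)" by (simp only: v1 v2)
      also have "\<dots> = E * E * v$2" unfolding E2 by (simp add: algebra_simps)
      finally show "(lam - E) * (lam + E) * v$2 = 0" by (simp add: algebra_simps)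
    qed
    moreover have "v$1 \<noteq> 0 \<or> v$2 \<noteq> 0" using v0 by (auto simp: vec_eq_iff forall_2)
    ultimately have "lam = E \<or> lam = - E" by (auto simp: eq_neg_iff_add_eq_0)
    then show "lam \<in> {complex_of_real (en g s), complex_of_real (- en g s)}" by (auto simp: E_def)
  next
    assume "lam \<in> {complex_of_real (en g s), complex_of_real (- en g s)}"
    then have lam: "lam * lam = S * S + G * G" using E2 by (auto simp: E_def)
    \<comment> \<open>This vector solves the first row for every \<open>lam\<close> and is nonzero
      since \<open>G \<noteq> 0\<close>; the second row is then the characteristic equation.\<close>
    define v :: "complex^2" where "v = (\<chi> i. if i = 1 then G else lam - S)"
    have "v $ 1 = G" "v $ 2 = lam - S" by (simp_all add: v_def)
    then have "v \<noteq> 0" "Hm g s *v v = lam *s v"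
      unfolding H using G lam by (auto simp: algebra_simps)
    then show "lam \<in> eigvals (Hm g s)" unfolding eigvals_def by blast
  qed
qed

lemma
  assumes g: "g > 0"
  shows Pp_eq: "Pp g s = spin_proj 1 g s"
    and Pm_eq: "Pm g s = spin_proj (- 1) g s"
  using spin_proj_is_eigproj[OF g, of 1 s] spin_proj_is_eigproj[OF g, of "- 1" s]
  by (auto simp: Pp_def Pm_def)

text \<open>The signed square root is odd, so on the spectrum \<open>{e, - e}\<close> it agrees with
  multiplication by \<open>1 / sqrt e\<close>. The dissipator thus becomes a double commutator with
  the Hamiltonian itself, divided by \<open>e\<close>.\<close>

lemma sqrtH_eq:
  assumes g: "g > 0"
  shows "sqrtH g s = (1 / sqrt (en g s)) *\<^sub>R Hm g s"
proof -
  have e: "en g s > 0" using om_pos[OF g, of s] by (simp add: en_def om_def)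
  have eo: "en g s = om g s / 2" by (simp add: en_def om_def)
  have p: "om g s > 0" by (rule om_pos[OF g])
  have "sqrtH g s = sqrt (en g s) *\<^sub>R (spin_proj 1 g s - spin_proj (- 1) g s)"
    unfolding sqrtH_def mfun_def eigvals_Hm[OF g]
    using e Pp_eq[OF g, of s] Pm_eq[OF g, of s] by (simp add: Pp_def Pm_def scaleR_diff_right)
  also have "spin_proj 1 g s - spin_proj (- 1) g s = (1 / en g s) *\<^sub>R Hm g s"
    using p by (simp add: mat2_simps spin_proj_def Hm_def eo scaleR_conv_of_real[where 'a = complex] field_simps)
  also have "sqrt (en g s) *\<^sub>R (1 / en g s) *\<^sub>R Hm g s = (1 / sqrt (en g s)) *\<^sub>R Hm g s"
    using e by (simp add: real_div_sqrt divide_simps)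
  finally show ?thesis .
qed

text \<open>\<open>r1\<close>, \<open>r2\<close>, \<open>r3\<close> are the traces of
  \<open>\<rho>\<close> against the three Pauli matrices. They are complex here, as
  \<open>\<rho>\<close> is arbitrary; reality is recovered later from the initial state.\<close>

lemma Lind_bloch:
  fixes \<rho> :: mat2 and gam :: "real \<Rightarrow> real" and s :: real
  assumes g: "g > 0"
  defines "L \<equiv> Lind g gam s \<rho>"
  defines "v \<equiv> inverse (om g s)"
  defines "r1 \<equiv> \<rho>$1$2 + \<rho>$2$1" and "r2 \<equiv> \<i> * (\<rho>$1$2 - \<rho>$2$1)" and "r3 \<equiv> \<rho>$1$1 - \<rho>$2$2"
  shows "L$1$1 + L$2$2 = 0"
    and "L$1$2 + L$2$1 = - of_real s * r2 - of_real (gam s * v) * (of_real (s\<^sup>2) * r1 - of_real (g * s) * r3)"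
    and "\<i> * (L$1$2 - L$2$1) = of_real s * r1 - of_real g * r3 - of_real (gam s * v * (s\<^sup>2 + g\<^sup>2)) * r2"
    and "L$1$1 - L$2$2 = of_real g * r2 - of_real (gam s * v) * (of_real (g\<^sup>2) * r3 - of_real (g * s) * r1)"
proof -
  have e: "en g s > 0" using om_pos[OF g, of s] by (simp add: en_def om_def)
  have comm_scale: "comm (c *\<^sub>R A) B = c *\<^sub>R comm A B" "comm A (c *\<^sub>R B) = c *\<^sub>R comm A B" for c :: real and A B :: mat2
    by (simp_all add: comm_def mat2_simps scaleR_conv_of_real[where 'a = complex] algebra_simps)
  \<comment> \<open>This is \<open>1 / en\<close> with \<open>en\<close> half of \<open>om\<close>;
    the 2 cancels the 1/2 in front of the dissipator.\<close>
  have ee: "(1 / sqrt (en g s)) * (1 / sqrt (en g s)) = 2 * v"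
    using e om_pos[OF g, of s] by (simp add: v_def en_def om_def field_simps)
  have L: "L = cscale (- \<i>) (comm (Hm g s) \<rho>) - (gam s * v) *\<^sub>R comm (Hm g s) (comm (Hm g s) \<rho>)"
    unfolding L_def Lind_def sqrtH_eq[OF g] comm_scale using ee by (simp add: mult_ac)
  note simps = L r1_def r2_def r3_def comm_def cscale_def Hm_def mat2_simps scaleR_conv_of_real[where 'a = complex]
  show "L$1$1 + L$2$2 = 0" by (simp add: simps algebra_simps)
  show "L$1$2 + L$2$1 = - of_real s * r2 - of_real (gam s * v) * (of_real (s\<^sup>2) * r1 - of_real (g * s) * r3)"
    by (simp add: simps algebra_simps power2_eq_square)
  show "\<i> * (L$1$2 - L$2$1) = of_real s * r1 - of_real g * r3 - of_real (gam s * v * (s\<^sup>2 + g\<^sup>2)) * r2"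
    by (simp add: simps algebra_simps power2_eq_square)
  show "L$1$1 - L$2$2 = of_real g * r2 - of_real (gam s * v) * (of_real (g\<^sup>2) * r3 - of_real (g * s) * r1)"
    by (simp add: simps algebra_simps power2_eq_square)
qed

section \<open>Adiabatic expansion\<close>

text \<open>
  For the Bloch vector \<open>r\<close> of the density matrix, \<open>z\<close> is its component along the field
  \<open>n = (g, 0, s) / om\<close>, and \<open>w\<close> encodes the two components orthogonal to \<open>n\<close> in a frame that
  rotates with \<open>n\<close>; the rotation speed is \<open>g / om\<^sup>2\<close>. The initial state is \<open>z = -1\<close>, \<open>w = 0\<close>, and the
  transition probability is \<open>(1 + z) / 2\<close>.
\<close>

definition adiabatic_solution ::
    "real \<Rightarrow> (real \<Rightarrow> real) \<Rightarrow> real \<Rightarrow> real set \<Rightarrow> (real \<Rightarrow> real) \<Rightarrow> (real \<Rightarrow> complex) \<Rightarrow> bool" where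
  "adiabatic_solution g gam eps S z w \<longleftrightarrow> (\<forall>s\<in>S.
     (z has_real_derivative g * (inverse (om g s))\<^sup>2 * Re (w s)) (at s within S) \<and>
     (w has_vector_derivative (- of_real (g * (inverse (om g s))\<^sup>2 * z s)
        + of_real (om g s / eps) * (\<i> - of_real (gam s)) * w s)) (at s within S))"

lemma adiabatic_solution_subset:
  "adiabatic_solution g gam eps S z w \<Longrightarrow> T \<subseteq> S \<Longrightarrow> adiabatic_solution g gam eps T z w"
  unfolding adiabatic_solution_def
  by (meson DERIV_subset has_vector_derivative_within_subset subsetD)

text \<open>Linearity lets the contraction estimate below compare solutions that started at
  different times.\<close>

lemma adiabatic_solution_diff:
  assumes "adiabatic_solution g gam eps S z w" "adiabatic_solution g gam eps S z' w'"
  shows "adiabatic_solution g gam eps S (\<lambda>s. z s - z' s) (\<lambda>s. w s - w' s)"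
  using assms unfolding adiabatic_solution_def
  by (auto intro!: derivative_eq_intros simp: algebra_simps diff_divide_distrib add_divide_distrib)

lemma nonpos_derivative_within_imp_le:
  fixes f :: "real \<Rightarrow> real"
  assumes "a \<le> b"
    and "\<And>s. a \<le> s \<Longrightarrow> s \<le> b \<Longrightarrow> (f has_real_derivative f' s) (at s within {a..b})"
    and "\<And>s. a \<le> s \<Longrightarrow> s \<le> b \<Longrightarrow> f' s \<le> 0"
  shows "f b \<le> f a"
proof (cases "a = b")
  case False
  with \<open>a \<le> b\<close> have "a < b" by simp
  then obtain x where "x \<in> {a<..<b}" "f b - f a = f' x * (b - a)"
    using mvt_simple[of a b f "\<lambda>x h. f' x * h"] assms(2) by (auto simp: has_field_derivative_def)
  then show ?thesis
    using assms(3)[of x] \<open>a < b\<close> mult_nonpos_nonneg[of "f' x" "b - a"] by auto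
qed simp

text \<open>The coupling between \<open>z\<close> and \<open>w\<close> is antisymmetric and the gap
  only rotates \<open>w\<close>, so the squared Bloch length changes through damping alone.\<close>

lemma adiabatic_norm_derivative:
  assumes "adiabatic_solution g gam eps S z w" "s \<in> S"
  shows "((\<lambda>s. (z s)\<^sup>2 + (cmod (w s))\<^sup>2) has_real_derivative
    - 2 * gam s * (om g s / eps) * (cmod (w s))\<^sup>2) (at s within S)"
proof -
  have aux: "2 * x * (k * Re y) + 2 * (y \<bullet> (- of_real (k * x) + of_real e * (\<i> - of_real c) * y))
      = - 2 * c * e * (cmod y)\<^sup>2" for x k e c :: real and y
    by (simp add: inner_complex_def cmod_power2) (simp add: algebra_simps power2_eq_square)
  have z: "(z has_real_derivative g * (inverse (om g s))\<^sup>2 * Re (w s)) (at s within S)"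
    and w: "(w has_vector_derivative (- of_real (g * (inverse (om g s))\<^sup>2 * z s)
        + of_real (om g s / eps) * (\<i> - of_real (gam s)) * w s)) (at s within S)"
    using assms by (auto simp: adiabatic_solution_def)
  have "((\<lambda>s. w s \<bullet> w s) has_real_derivative 2 * (w s \<bullet> (- of_real (g * (inverse (om g s))\<^sup>2 * z s)
        + of_real (om g s / eps) * (\<i> - of_real (gam s)) * w s))) (at s within S)"
    unfolding has_real_derivative_iff_has_vector_derivative
    using bounded_bilinear.has_vector_derivative[OF bounded_bilinear_inner w w]
    by (simp add: inner_commute)
  moreover have "((\<lambda>s. (z s)\<^sup>2) has_real_derivative 2 * z s * (g * (inverse (om g s))\<^sup>2 * Re (w s))) (at s within S)"
    using z by (auto intro!: derivative_eq_intros)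
  ultimately have "((\<lambda>s. (z s)\<^sup>2 + w s \<bullet> w s) has_real_derivative
      2 * z s * (g * (inverse (om g s))\<^sup>2 * Re (w s)) + 2 * (w s \<bullet> (- of_real (g * (inverse (om g s))\<^sup>2 * z s)
        + of_real (om g s / eps) * (\<i> - of_real (gam s)) * w s))) (at s within S)"
    by (intro DERIV_add)
  moreover have "2 * z s * (g * (inverse (om g s))\<^sup>2 * Re (w s)) + 2 * (w s \<bullet> (- of_real (g * (inverse (om g s))\<^sup>2 * z s)
        + of_real (om g s / eps) * (\<i> - of_real (gam s)) * w s)) = - 2 * gam s * (om g s / eps) * (cmod (w s))\<^sup>2"
    by (rule aux)
  ultimately show ?thesis by (simp add: power2_norm_eq_inner)
qed

lemma adiabatic_norm_antimono:
  assumes sol: "adiabatic_solution g gam eps {a..} z w"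
    and "g > 0" "eps > 0" "\<And>s. gam s \<ge> 0" "a \<le> s" "s \<le> t"
  shows "(z t)\<^sup>2 + (cmod (w t))\<^sup>2 \<le> (z s)\<^sup>2 + (cmod (w s))\<^sup>2"
proof (rule nonpos_derivative_within_imp_le[OF \<open>s \<le> t\<close>])
  fix x assume x: "s \<le> x" "x \<le> t"
  have "adiabatic_solution g gam eps {s..t} z w"
    by (rule adiabatic_solution_subset[OF sol]) (use \<open>a \<le> s\<close> in auto)
  from adiabatic_norm_derivative[OF this, of x] x
  show "((\<lambda>s. (z s)\<^sup>2 + (cmod (w s))\<^sup>2) has_real_derivative
    - 2 * gam x * (om g x / eps) * (cmod (w x))\<^sup>2) (at x within {s..t})" by auto
  show "- 2 * gam x * (om g x / eps) * (cmod (w x))\<^sup>2 \<le> 0"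
    using assms(3,4) om_pos[OF \<open>g > 0\<close>, of x] by (auto intro!: mult_nonneg_nonneg divide_nonneg_nonneg simp: less_imp_le)
qed

lemma norm_of_real_mult_le: "cmod c \<le> 1 \<Longrightarrow> \<bar>x\<bar> \<le> y \<Longrightarrow> cmod (of_real x * c) \<le> y"
  using mult_mono[of "\<bar>x\<bar>" y "cmod c" 1] by (simp add: norm_mult)

text \<open>The summands \<open>3\<close> and one \<open>g * B\<close> come from the bound on
  \<open>be\<close>, the others from the bound on \<open>be1\<close>; hence \<open>g * B\<close>
  occurs twice.\<close>

definition defect_const :: "real \<Rightarrow> real \<Rightarrow> real" where
  "defect_const g B = 3 + 21 / g + g * B + 10 * B + g * B + 3 * g * B\<^sup>2"

text \<open>The derivatives of the rate are parameters, so that the zero rate is also an instance;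
  the reference Landau-Zener solution then inherits every estimate with the same
  \<open>B\<close>.\<close>

locale dephasing =
  fixes g B :: real and gam gam1 gam2 :: "real \<Rightarrow> real"
  assumes g: "g > 0"
    and gam_nonneg: "\<And>s. 0 \<le> gam s"
    and DERIV_gam: "\<And>s. (gam has_real_derivative gam1 s) (at s)"
    and DERIV_gam1: "\<And>s. (gam1 has_real_derivative gam2 s) (at s)"
    and gam1_le: "\<And>s. \<bar>gam1 s\<bar> \<le> B"
    and gam2_le: "\<And>s. \<bar>gam2 s\<bar> \<le> B"
begin

text \<open>
  Solving \<open>w' = - k z + lam w\<close> with \<open>k = g / om\<^sup>2\<close>, \<open>lam = (om / eps) / j\<close> formally in powers of \<open>eps\<close>
  gives \<open>w = (eps al + eps\<^sup>2 be + \<dots>) z\<close> with \<open>al = k j / om\<close> and \<open>be = al1 j / om\<close>, where \<open>al1\<close>, \<open>be1\<close>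
  are the derivatives of \<open>al\<close>, \<open>be\<close>. Here \<open>v = 1 / om\<close>.
\<close>

definition v where "v s = inverse (om g s)"
definition j where "j s = inverse (\<i> - complex_of_real (gam s))"
definition al where "al s = of_real (g * v s ^ 3) * j s"
definition al1 where
  "al1 s = of_real (- 3 * g * s * v s ^ 5) * j s + of_real (g * v s ^ 3 * gam1 s) * (j s * j s)"
definition be where
  "be s = of_real (- 3 * g * s * v s ^ 6) * (j s * j s) + of_real (g * v s ^ 4 * gam1 s) * (j s * j s * j s)"
definition be1 where
  "be1 s = of_real (- 3 * g * v s ^ 6 + 18 * g * s\<^sup>2 * v s ^ 8) * (j s * j s)
     + of_real (- 10 * g * s * v s ^ 6 * gam1 s + g * v s ^ 4 * gam2 s) * (j s * j s * j s)
     + of_real (3 * g * v s ^ 4 * (gam1 s)\<^sup>2) * (j s * j s * j s * j s)"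

lemma B: "0 \<le> B"
  using gam1_le[of 0] abs_ge_zero order_trans by blast

lemma v_pos: "v s > 0"
  by (simp add: v_def om_pos g)

lemma v_le: "v s \<le> 1 / g"
  using om_ge[OF g, of s] g by (simp add: v_def inverse_eq_divide divide_left_mono)

lemma om_v [simp]: "om g s * v s = 1"
  using om_pos[OF g, of s] by (simp add: v_def)

lemma abs_s_v: "\<bar>s\<bar> * v s \<le> 1"
  using abs_le_om[of s g] om_pos[OF g, of s] by (simp add: v_def field_simps)

lemma DERIV_v: "(v has_real_derivative - (s * v s ^ 3)) (at s within S)"
  unfolding v_def by (rule DERIV_inverse_om[OF g])

lemma i_gam_neq_0: "\<i> - complex_of_real (gam s) \<noteq> 0"
  by (simp add: complex_eq_iff)

lemma j_mult [simp]: "(\<i> - complex_of_real (gam s)) * j s = 1"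
  using i_gam_neq_0 by (simp add: j_def)

text \<open>The gap alone keeps \<open>\<i> - gam s\<close> away from 0, uniformly in the rate.
  Dividing by it is what makes the formal expansion possible.\<close>

lemma norm_j_le: "cmod (j s) \<le> 1"
proof -
  have "1 \<le> cmod (\<i> - complex_of_real (gam s))"
    by (simp add: cmod_def real_le_rsqrt)
  then show ?thesis by (simp add: j_def norm_inverse inverse_le_1_iff)
qed

lemma has_vector_derivative_j:
  "(j has_vector_derivative of_real (gam1 s) * (j s * j s)) (at s within S)"
proof -
  have "((\<lambda>s. \<i> - complex_of_real (gam s)) has_vector_derivative - of_real (gam1 s)) (at s within S)"
    using DERIV_gam[of s] by (auto intro!: derivative_eq_intros has_vector_derivative_of_real
        intro: has_field_derivative_at_within)
  from field_vector_diff_chain_within[OF this has_field_derivative_at_within[OF DERIV_inverse[OF i_gam_neq_0]]]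
  show ?thesis
    unfolding j_def o_def by (rule has_vector_derivative_eq_rhs) simp
qed

lemmas gam_derivs =
  has_field_derivative_at_within[OF DERIV_gam] has_field_derivative_at_within[OF DERIV_gam1]

lemma has_vector_derivative_al: "(al has_vector_derivative al1 s) (at s within S)"
proof -
  have "((\<lambda>s. g * v s ^ 3) has_real_derivative - 3 * g * s * v s ^ 5) (at s within S)"
    by (auto intro!: derivative_eq_intros DERIV_v simp: power_numeral_reduce)
  from has_vector_derivative_mult[OF has_vector_derivative_of_real[OF this] has_vector_derivative_j]
  show ?thesis unfolding al_def[abs_def] al1_def by (simp add: algebra_simps)
qed

lemma has_vector_derivative_be: "(be has_vector_derivative be1 s) (at s within S)"
proof -
  have 1: "((\<lambda>s. - 3 * g * s * v s ^ 6) has_real_derivative (- 3 * g * v s ^ 6 + 18 * g * s\<^sup>2 * v s ^ 8)) (at s within S)"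
    by (auto intro!: derivative_eq_intros DERIV_v simp: power_numeral_reduce algebra_simps)
  have 2: "((\<lambda>s. g * v s ^ 4 * gam1 s) has_real_derivative (- 4 * g * s * v s ^ 6 * gam1 s + g * v s ^ 4 * gam2 s)) (at s within S)"
    by (auto intro!: derivative_eq_intros DERIV_v gam_derivs simp: power_numeral_reduce algebra_simps)
  note j2 = has_vector_derivative_mult[OF has_vector_derivative_j has_vector_derivative_j]
  note j3 = has_vector_derivative_mult[OF j2 has_vector_derivative_j]
  from has_vector_derivative_add[OF has_vector_derivative_mult[OF has_vector_derivative_of_real[OF 1] j2]
      has_vector_derivative_mult[OF has_vector_derivative_of_real[OF 2] j3]]
  show ?thesis unfolding be_def[abs_def] be1_def
    by (rule has_vector_derivative_eq_rhs) (simp add: algebra_simps power2_eq_square)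
qed

lemma norm_al_le: "cmod (al s) \<le> g * v s ^ 3"
  unfolding al_def using v_pos[of s] g by (intro norm_of_real_mult_le norm_j_le) auto

text \<open>These trade surplus factors \<open>v\<close> against factors \<open>s\<close>, so that
  the terms of \<open>be\<close> and \<open>be1\<close> can all be bounded by multiples of
  \<open>v^4\<close>.\<close>

lemma v_facts: "v s ^ 2 \<le> 1 / g\<^sup>2" "\<bar>s\<bar> * v s ^ 2 \<le> 1 / g" "s\<^sup>2 * v s ^ 4 \<le> 1 / g\<^sup>2"
proof -
  show 1: "v s ^ 2 \<le> 1 / g\<^sup>2"
    using power_mono[OF v_le[of s], of 2] v_pos[of s] by (simp add: power_divide)
  show "\<bar>s\<bar> * v s ^ 2 \<le> 1 / g"
    using mult_mono[OF abs_s_v[of s] v_le[of s]] v_pos[of s] by (simp add: power2_eq_square mult_ac)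
  have "(\<bar>s\<bar> * v s)\<^sup>2 \<le> 1"
    using abs_s_v[of s] v_pos[of s] by (simp add: power_le_one)
  from mult_mono[OF this 1] v_pos[of s]
  show "s\<^sup>2 * v s ^ 4 \<le> 1 / g\<^sup>2"
    by (simp add: power_mult_distrib power_numeral_reduce mult_ac)
qed

lemma norm_jj: "cmod (j s * j s) \<le> 1" "cmod (j s * j s * j s) \<le> 1" "cmod (j s * j s * j s * j s) \<le> 1"
  using norm_j_le[of s] by (auto simp: norm_mult intro!: mult_le_one)

lemma norm_be_le: "cmod (be s) \<le> defect_const g B * v s ^ 4"
proof -
  have v4: "v s ^ 4 > 0" using v_pos[of s] by simp
  have "\<bar>- 3 * g * s * v s ^ 6\<bar> = 3 * g * (\<bar>s\<bar> * v s ^ 2) * v s ^ 4"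
    using g v_pos[of s] by (simp add: abs_mult power_numeral_reduce)
  also have "\<dots> \<le> 3 * g * (1 / g) * v s ^ 4"
    using g v4 v_facts(2)[of s] by (intro mult_right_mono mult_left_mono) auto
  finally have 1: "\<bar>- 3 * g * s * v s ^ 6\<bar> \<le> 3 * v s ^ 4" using g by simp
  have "\<bar>g * v s ^ 4 * gam1 s\<bar> \<le> g * v s ^ 4 * B"
    using g v4 gam1_le[of s] by (simp add: abs_mult mult_left_mono)
  then have 2: "\<bar>g * v s ^ 4 * gam1 s\<bar> \<le> (g * B) * v s ^ 4" by (simp add: mult_ac)
  have "cmod (be s) \<le> 3 * v s ^ 4 + (g * B) * v s ^ 4"
    unfolding be_def
    by (intro order_trans[OF norm_triangle_ineq add_mono] norm_of_real_mult_le norm_jj 1 2)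
  also have "\<dots> = (3 + g * B) * v s ^ 4" by (simp add: algebra_simps)
  also have "\<dots> \<le> defect_const g B * v s ^ 4"
    using g B v4 by (intro mult_right_mono) (auto simp: defect_const_def)
  finally show ?thesis .
qed

lemma norm_be1_le: "cmod (be1 s) \<le> defect_const g B * v s ^ 4"
proof -
  have v4: "v s ^ 4 > 0" using v_pos[of s] by simp
  have "\<bar>- 3 * g * v s ^ 6 + 18 * g * s\<^sup>2 * v s ^ 8\<bar> \<le> 3 * g * v s ^ 6 + 18 * g * s\<^sup>2 * v s ^ 8"
    using g v_pos[of s] by (intro abs_triangle_ineq[THEN order_trans]) (simp add: abs_mult)
  also have "\<dots> = (3 * g * (v s)\<^sup>2 + 18 * g * (s\<^sup>2 * v s ^ 4)) * v s ^ 4"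
    by (simp add: algebra_simps power_numeral_reduce)
  also have "\<dots> \<le> (3 * g * (1 / g\<^sup>2) + 18 * g * (1 / g\<^sup>2)) * v s ^ 4"
    using g v4 v_facts(1,3)[of s] by (intro mult_right_mono add_mono mult_left_mono) auto
  finally have 1: "\<bar>- 3 * g * v s ^ 6 + 18 * g * s\<^sup>2 * v s ^ 8\<bar> \<le> 21 / g * v s ^ 4"
    using g by (simp add: power2_eq_square field_simps)
  have "\<bar>- 10 * g * s * v s ^ 6 * gam1 s\<bar> = 10 * g * (\<bar>s\<bar> * (v s)\<^sup>2) * \<bar>gam1 s\<bar> * v s ^ 4"
    using g v_pos[of s] by (simp add: abs_mult power_numeral_reduce)
  also have "\<dots> \<le> 10 * g * (1 / g) * B * v s ^ 4"
    using g v4 v_facts(2)[of s] gam1_le[of s] by (intro mult_right_mono mult_mono) auto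
  finally have 2: "\<bar>- 10 * g * s * v s ^ 6 * gam1 s\<bar> \<le> 10 * B * v s ^ 4" using g by simp
  have "\<bar>g * v s ^ 4 * gam2 s\<bar> \<le> g * v s ^ 4 * B"
    using g v4 gam2_le[of s] by (simp add: abs_mult mult_left_mono)
  with 2 have 3: "\<bar>- 10 * g * s * v s ^ 6 * gam1 s + g * v s ^ 4 * gam2 s\<bar> \<le> (10 * B + g * B) * v s ^ 4"
    by (simp add: algebra_simps)
  have "(gam1 s)\<^sup>2 \<le> B\<^sup>2" using gam1_le[of s] by (simp add: abs_le_square_iff[symmetric])
  then have 4: "\<bar>3 * g * v s ^ 4 * (gam1 s)\<^sup>2\<bar> \<le> 3 * g * B\<^sup>2 * v s ^ 4"
    using g v4 by (simp add: abs_mult mult_ac mult_left_mono)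
  have "cmod (be1 s) \<le> 21 / g * v s ^ 4 + (10 * B + g * B) * v s ^ 4 + 3 * g * B\<^sup>2 * v s ^ 4"
    unfolding be1_def
    by (intro order_trans[OF norm_triangle_ineq add_mono] norm_of_real_mult_le norm_jj 1 3 4)
  also have "\<dots> = (21 / g + 10 * B + g * B + 3 * g * B\<^sup>2) * v s ^ 4" by (simp add: algebra_simps)
  also have "\<dots> \<le> defect_const g B * v s ^ 4"
    using g B v4 by (intro mult_right_mono) (auto simp: defect_const_def)
  finally show ?thesis .
qed

end

text \<open>\<open>g\<close> bounds the coefficient \<open>al\<close>, the defect constant bounds
  \<open>be\<close> and \<open>be1\<close>, and its quotient by \<open>g\<close> covers the terms in
  which one more factor \<open>1 / g\<close> arises from \<open>v\<close> or from the rotation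
  speed.\<close>

definition est_const :: "real \<Rightarrow> real \<Rightarrow> real" where
  "est_const g B = g + defect_const g B + defect_const g B / g"

section \<open>The equation for the remainder of the expansion\<close>

context dephasing
begin

abbreviation (input) N where "N \<equiv> est_const g B"

text \<open>The part of \<open>w\<close> that is not slaved to \<open>z\<close>. Two terms are
  subtracted because the first alone leaves a defect of order \<open>eps\<close>, too large for a
  second-order claim.\<close>

definition rem where
  "rem eps z w s = w s - of_real (eps * z s) * al s - of_real (eps\<^sup>2 * z s) * be s"

text \<open>What the expansion fails to compensate: the motion of \<open>z\<close> in both terms,
  and the derivative \<open>be1\<close> of the last coefficient.\<close>

definition err where
  "err eps z w s = - of_real (eps * (g * (v s)\<^sup>2 * Re (w s))) * al s
     - of_real (eps\<^sup>2 * z s) * be1 s - of_real (eps\<^sup>2 * (g * (v s)\<^sup>2 * Re (w s))) * be s"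

lemma defect_const_nonneg: "0 \<le> defect_const g B"
  using g B by (auto simp: defect_const_def)

lemma N_facts: "0 < N" "g \<le> N" "defect_const g B \<le> N" "defect_const g B / g \<le> N"
    "defect_const g B + defect_const g B / g \<le> N"
proof -
  have "0 \<le> defect_const g B / g" using g defect_const_nonneg by simp
  then show "0 < N" "g \<le> N" "defect_const g B \<le> N" "defect_const g B / g \<le> N"
    "defect_const g B + defect_const g B / g \<le> N"
    using g defect_const_nonneg unfolding est_const_def by linarith+
qed

lemma norm_of_real_mult_mono: "\<bar>x\<bar> \<le> X \<Longrightarrow> cmod c \<le> Y \<Longrightarrow> cmod (of_real x * c) \<le> X * Y"
  using mult_mono[of "\<bar>x\<bar>" X "cmod c" Y] by (simp add: norm_mult)

text \<open>This identity and the next are the recursion behind the expansion: the leading term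
  reproduces the source that drives \<open>w\<close>, and the second one cancels the derivative of
  the first coefficient.\<close>

lemma lam_al: "eps \<noteq> 0 \<Longrightarrow> of_real (om g s / eps) * (\<i> - of_real (gam s)) * (of_real (eps * x) * al s)
    = of_real (g * (v s)\<^sup>2 * x)"
proof -
  assume "eps \<noteq> 0"
  have "of_real (om g s / eps) * (\<i> - of_real (gam s)) * (of_real (eps * x) * al s)
    = of_real (om g s / eps * (eps * x) * (g * v s ^ 3)) * ((\<i> - of_real (gam s)) * j s)"
    by (simp add: al_def mult_ac)
  also have "om g s / eps * (eps * x) * (g * v s ^ 3) = (om g s * v s) * (g * (v s)\<^sup>2 * x)"
    using \<open>eps \<noteq> 0\<close> by (simp add: field_simps power_numeral_reduce)
  finally show ?thesis by simp
qed

lemma lam_be: "eps \<noteq> 0 \<Longrightarrow> of_real (om g s / eps) * (\<i> - of_real (gam s)) * (of_real (eps\<^sup>2 * x) * be s)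
    = of_real (eps * x) * al1 s"
proof -
  assume "eps \<noteq> 0"
  have b: "be s = of_real (v s) * j s * al1 s"
    by (simp add: be_def al1_def algebra_simps power_numeral_reduce)
  have "of_real (om g s / eps) * (\<i> - of_real (gam s)) * (of_real (eps\<^sup>2 * x) * be s)
    = of_real (om g s / eps * (eps\<^sup>2 * x) * v s) * ((\<i> - of_real (gam s)) * j s) * al1 s"
    by (simp add: b mult_ac)
  also have "om g s / eps * (eps\<^sup>2 * x) * v s = (om g s * v s) * (eps * x)"
    using \<open>eps \<noteq> 0\<close> by (simp add: field_simps power2_eq_square)
  finally show ?thesis by simp
qed

lemma has_vector_derivative_rem:
  assumes "adiabatic_solution g gam eps S z w" "s \<in> S" "eps \<noteq> 0"
  shows "(rem eps z w has_vector_derivative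
    (of_real (om g s / eps) * (\<i> - of_real (gam s)) * rem eps z w s + err eps z w s)) (at s within S)"
proof -
  have z: "(z has_real_derivative g * (v s)\<^sup>2 * Re (w s)) (at s within S)"
    and w: "(w has_vector_derivative (- of_real (g * (v s)\<^sup>2 * z s)
        + of_real (om g s / eps) * (\<i> - of_real (gam s)) * w s)) (at s within S)"
    using assms by (auto simp: adiabatic_solution_def v_def)
  have z': "((\<lambda>s. of_real (c * z s)) has_vector_derivative complex_of_real (c * (g * (v s)\<^sup>2 * Re (w s)))) (at s within S)" for c
    using has_vector_derivative_of_real[OF DERIV_cmult[OF z]] .
  define L where "L = of_real (om g s / eps) * (\<i> - complex_of_real (gam s))"
  have "(rem eps z w has_vector_derivative
     (- of_real (g * (v s)\<^sup>2 * z s) + L * w s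
     - (of_real (eps * z s) * al1 s + of_real (eps * (g * (v s)\<^sup>2 * Re (w s))) * al s)
     - (of_real (eps\<^sup>2 * z s) * be1 s + of_real (eps\<^sup>2 * (g * (v s)\<^sup>2 * Re (w s))) * be s))) (at s within S)"
    unfolding rem_def L_def
    by (intro has_vector_derivative_diff has_vector_derivative_mult w z'
        has_vector_derivative_al has_vector_derivative_be)
  then show ?thesis
    unfolding L_def[symmetric]
  proof (rule has_vector_derivative_eq_rhs)
    have LR: "L * rem eps z w s = L * w s - of_real (g * (v s)\<^sup>2 * z s) - of_real (eps * z s) * al1 s"
  proof -
    have "L * (of_real (eps * z s) * al s) = of_real (g * (v s)\<^sup>2 * z s)"
      and "L * (of_real (eps\<^sup>2 * z s) * be s) = of_real (eps * z s) * al1 s"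
      unfolding L_def by (rule lam_al[OF \<open>eps \<noteq> 0\<close>], rule lam_be[OF \<open>eps \<noteq> 0\<close>])
    then show ?thesis by (simp only: rem_def right_diff_distrib)
    qed
    show "- of_real (g * (v s)\<^sup>2 * z s) + L * w s
     - (of_real (eps * z s) * al1 s + of_real (eps * (g * (v s)\<^sup>2 * Re (w s))) * al s)
     - (of_real (eps\<^sup>2 * z s) * be1 s + of_real (eps\<^sup>2 * (g * (v s)\<^sup>2 * Re (w s))) * be s)
     = L * rem eps z w s + err eps z w s"
      unfolding LR err_def by simp
  qed
qed

text \<open>The factor \<open>cmod (w s)\<close> is kept next to \<open>eps\<close> on purpose. With
  \<open>cmod w \<le> 1\<close> the bound is of order \<open>eps\<close>; once \<open>w\<close> is
  known to be of order \<open>eps\<close>, the same bound is of order \<open>eps^2\<close>.\<close>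

lemma norm_err_le:
  assumes "\<bar>z s\<bar> \<le> 1" "cmod (w s) \<le> 1" "eps > 0"
  shows "cmod (err eps z w s) \<le> N * (eps * cmod (w s) + eps\<^sup>2) * v s ^ 4"
proof -
  let ?M = "defect_const g B" and ?W = "cmod (w s)"
  note M = defect_const_nonneg
  have v: "v s > 0" by (rule v_pos)
  have k: "\<bar>g * (v s)\<^sup>2 * Re (w s)\<bar> \<le> g * (v s)\<^sup>2 * ?W"
    using g abs_Re_le_cmod[of "w s"] by (simp add: abs_mult mult_left_mono)
  have "g * (v s)\<^sup>2 * ?W \<le> g * (1 / g\<^sup>2) * 1"
    using g v_facts(1)[of s] assms by (intro mult_mono) auto
  then have k2: "g * (v s)\<^sup>2 * ?W \<le> 1 / g" using g by (simp add: power2_eq_square)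
  \<comment> \<open>The \<open>al\<close> term carries \<open>v^5\<close>; this spends the surplus
    factor.\<close>
  have gv: "g * v s \<le> 1" using v_le[of s] g by (simp add: field_simps)
  have "cmod (of_real (eps * (g * (v s)\<^sup>2 * Re (w s))) * al s) \<le> (eps * (g * (v s)\<^sup>2 * ?W)) * (g * v s ^ 3)"
    using assms mult_left_mono[OF k, of eps] by (intro norm_of_real_mult_mono norm_al_le) (simp add: abs_mult)
  also have "\<dots> = (g * v s) * (g * eps * ?W * v s ^ 4)"
    by (simp add: power_numeral_reduce)
  also have "\<dots> \<le> 1 * (g * eps * ?W * v s ^ 4)"
    using g v assms by (intro mult_right_mono gv) auto
  also have "\<dots> \<le> N * (eps * ?W) * v s ^ 4"
    using mult_right_mono[OF N_facts(2), of "eps * ?W * v s ^ 4"] v assms by (simp add: mult_ac)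
  finally have 1: "cmod (of_real (eps * (g * (v s)\<^sup>2 * Re (w s))) * al s) \<le> N * (eps * ?W) * v s ^ 4" .
  have 2: "cmod (of_real (eps\<^sup>2 * z s) * be1 s) \<le> eps\<^sup>2 * 1 * (?M * v s ^ 4)"
    using assms by (intro norm_of_real_mult_mono norm_be1_le) (simp add: abs_mult mult_left_le)
  have 3: "cmod (of_real (eps\<^sup>2 * (g * (v s)\<^sup>2 * Re (w s))) * be s) \<le> eps\<^sup>2 * (1 / g) * (?M * v s ^ 4)"
    using mult_left_mono[OF order_trans[OF k k2], of "eps\<^sup>2"]
    by (intro norm_of_real_mult_mono norm_be_le) (simp add: abs_mult)
  have "cmod (err eps z w s) \<le> N * (eps * ?W) * v s ^ 4 + eps\<^sup>2 * 1 * (?M * v s ^ 4) + eps\<^sup>2 * (1 / g) * (?M * v s ^ 4)"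
    unfolding err_def mult_minus_left
    using 1 2 3 by (intro order_trans[OF norm_triangle_ineq4] add_mono) auto
  also have "\<dots> = N * (eps * ?W) * v s ^ 4 + (?M + ?M / g) * (eps\<^sup>2 * v s ^ 4)" by (simp add: algebra_simps)
  also have "\<dots> \<le> N * (eps * ?W) * v s ^ 4 + N * (eps\<^sup>2 * v s ^ 4)"
    using v N_facts(5) by (intro add_left_mono mult_right_mono) auto
  also have "\<dots> = N * (eps * ?W + eps\<^sup>2) * v s ^ 4" by (simp add: algebra_simps)
  finally show ?thesis .
qed

lemma norm_rem_diff_le:
  assumes "\<bar>z s\<bar> \<le> 1" "eps > 0"
  shows "cmod (rem eps z w s - w s) \<le> N * (eps + eps\<^sup>2) * v s ^ 3"
    and "cmod (rem eps z w s - (w s - of_real (eps * z s) * al s)) \<le> N * eps\<^sup>2 * v s ^ 3"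
proof -
  have v: "v s > 0" by (rule v_pos)
  have "cmod (of_real (eps * z s) * al s) \<le> (eps * 1) * (g * v s ^ 3)"
    using assms by (intro norm_of_real_mult_mono norm_al_le) (simp add: abs_mult)
  also have "\<dots> \<le> N * eps * v s ^ 3"
    using mult_right_mono[OF N_facts(2), of "eps * v s ^ 3"] v assms by (simp add: mult_ac)
  finally have 1: "cmod (of_real (eps * z s) * al s) \<le> N * eps * v s ^ 3" .
  have "cmod (of_real (eps\<^sup>2 * z s) * be s) \<le> (eps\<^sup>2 * 1) * (defect_const g B * v s ^ 4)"
    using assms by (intro norm_of_real_mult_mono norm_be_le) (simp add: abs_mult mult_left_le)
  also have "\<dots> = defect_const g B * eps\<^sup>2 * v s ^ 3 * v s"
    by (simp add: power_numeral_reduce)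
  also have "\<dots> \<le> defect_const g B * eps\<^sup>2 * v s ^ 3 * (1 / g)"
    using v defect_const_nonneg by (intro mult_left_mono v_le) auto
  also have "\<dots> \<le> N * eps\<^sup>2 * v s ^ 3"
    using mult_right_mono[OF N_facts(4), of "eps\<^sup>2 * v s ^ 3"] v by (simp add: mult_ac)
  finally have 2: "cmod (of_real (eps\<^sup>2 * z s) * be s) \<le> N * eps\<^sup>2 * v s ^ 3" .
  have "rem eps z w s - (w s - of_real (eps * z s) * al s) = - (of_real (eps\<^sup>2 * z s) * be s)"
    by (simp add: rem_def)
  then show "cmod (rem eps z w s - (w s - of_real (eps * z s) * al s)) \<le> N * eps\<^sup>2 * v s ^ 3"
    using 2 by (simp only: norm_minus_cancel)
  have eq: "rem eps z w s - w s = - (of_real (eps * z s) * al s) - of_real (eps\<^sup>2 * z s) * be s"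
    by (simp add: rem_def)
  have "cmod (rem eps z w s - w s) \<le> N * eps * v s ^ 3 + N * eps\<^sup>2 * v s ^ 3"
    using 1 2 norm_triangle_ineq4[of "- (of_real (eps * z s) * al s)" "of_real (eps\<^sup>2 * z s) * be s"]
    unfolding norm_minus_cancel eq by linarith
  then show "cmod (rem eps z w s - w s) \<le> N * (eps + eps\<^sup>2) * v s ^ 3"
    by (simp add: algebra_simps)
qed

section \<open>Bounds on the coherence before and across the crossing\<close>

lemma v_mono: "\<bar>s\<bar> \<le> \<bar>t\<bar> \<Longrightarrow> v t \<le> v s"
  using om_mono[of s t g] om_pos[OF g] by (simp add: v_def)

text \<open>The defect is of order \<open>v^4\<close>, and its integral from minus infinity up to a
  point \<open>s \<le> 0\<close> is of order \<open>v^3\<close>. Beyond the crossing the accumulated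
  integral no longer shrinks, so this argument works on one side only.\<close>

lemma decay_before_crossing:
  assumes sol: "adiabatic_solution g gam eps {a..} z w" and eps: "eps > 0"
    and z1: "\<And>s. s \<ge> a \<Longrightarrow> \<bar>z s\<bar> \<le> 1" and w1: "\<And>s. s \<ge> a \<Longrightarrow> cmod (w s) \<le> 1"
    and s: "a \<le> s" "s \<le> 0"
  shows "cmod (w s) \<le> cmod (w a) + 5 * N * (eps + eps\<^sup>2) * v s ^ 3"
proof -
  define c where "c = N * (eps + eps\<^sup>2)"
  have c: "c > 0" using N_facts(1) eps by (simp add: c_def add_pos_pos)
  \<comment> \<open>\<open>om - s\<close> satisfies \<open>(om - s)' = - (om - s) / om\<close> and lies between \<open>om\<close> and \<open>2 om\<close> for \<open>s \<le> 0\<close>\<close>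
  define K where "K t = 8 / 3 * c * inverse (om g t - t) ^ 3" for t
  define K' where "K' t = 8 * c * inverse (om g t - t) ^ 3 * v t" for t
  have "cmod (rem eps z w s) \<le> cmod (rem eps z w a) + (K s - K a)"
  proof (rule dissipative_comparison[OF s(1)])
    fix t assume t: "a \<le> t" "t \<le> s"
    show "(rem eps z w has_vector_derivative
      (of_real (om g t / eps) * (\<i> - of_real (gam t))) * rem eps z w t + err eps z w t) (at t within {a..s})"
      by (rule has_vector_derivative_rem[OF adiabatic_solution_subset[OF sol]]) (use t eps in auto)
    show "Re (of_real (om g t / eps) * (\<i> - of_real (gam t))) \<le> 0"
      using om_pos[OF g, of t] gam_nonneg[of t] eps by simp
    have p: "om g t - t > 0" "om g t - t \<le> 2 * om g t"
      using t s om_pos[OF g, of t] abs_le_om[of t g] by linarith+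
    have d: "((\<lambda>t. om g t - t) has_real_derivative (t / om g t - 1)) (at t within {a..s})"
      by (auto intro!: derivative_eq_intros DERIV_om[OF g])
    have "(K has_real_derivative 8 / 3 * c * (of_nat 3 * (- (inverse (om g t - t) * (t / om g t - 1)
        * inverse (om g t - t)) * inverse (om g t - t) ^ (3 - Suc 0)))) (at t within {a..s})"
      unfolding K_def by (intro DERIV_cmult DERIV_power DERIV_inverse' d) (use p in auto)
    moreover have "inverse (om g t - t) * (t / om g t - 1) = - v t"
      using p om_pos[OF g, of t] by (simp add: v_def divide_simps)
    ultimately show "(K has_real_derivative K' t) (at t within {a..s})"
      by (simp add: K'_def power_numeral_reduce mult_ac)
    have "cmod (err eps z w t) \<le> N * (eps * cmod (w t) + eps\<^sup>2) * v t ^ 4"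
      by (rule norm_err_le) (use z1 w1 t eps in auto)
    also have "\<dots> \<le> N * (eps * 1 + eps\<^sup>2) * v t ^ 4"
      using w1[of t] t eps v_pos[of t] N_facts(1)
      by (intro mult_right_mono mult_left_mono add_right_mono) auto
    \<comment> \<open>The 8 compensates the cube of the 2 in \<open>om - t \<le> 2 * om\<close>;
      integration then turns it into 8/3.\<close>
    also have "\<dots> = 8 * c * inverse (2 * om g t) ^ 3 * v t"
      by (simp add: c_def v_def power_mult_distrib power_numeral_reduce)
    also have "\<dots> \<le> K' t"
      unfolding K'_def using p c v_pos[of t]
      by (intro mult_right_mono mult_left_mono power_mono le_imp_inverse_le) auto
    finally show "cmod (err eps z w t) \<le> K' t" .
  qed
  moreover have "K a \<ge> 0"
    using c s om_pos[OF g, of a] abs_le_om[of a g] by (auto simp: K_def)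
  moreover have "K s \<le> 8 / 3 * c * v s ^ 3"
    unfolding K_def v_def using c s om_pos[OF g, of s]
    by (intro mult_left_mono power_mono le_imp_inverse_le) auto
  moreover have "cmod (w s) \<le> cmod (rem eps z w s) + c * v s ^ 3"
    using norm_rem_diff_le(1)[of z s eps w] z1[OF s(1)] eps norm_triangle_ineq3[of "rem eps z w s" "w s"]
    unfolding c_def by linarith
  moreover have "cmod (rem eps z w a) \<le> cmod (w a) + c * v a ^ 3"
    using norm_rem_diff_le(1)[of z a eps w] z1[of a] eps norm_triangle_ineq3[of "rem eps z w a" "w a"]
    unfolding c_def by linarith
  moreover have "c * v a ^ 3 \<le> c * v s ^ 3"
    using s c v_pos[of a] by (intro mult_left_mono power_mono v_mono) auto
  moreover have "0 \<le> c * v s ^ 3" using c v_pos[of s] by simp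
  \<comment> \<open>8/3 from the accumulated defect plus 1 for each of the two conversions between
    \<open>w\<close> and its remainder is at most 5.\<close>
  ultimately have "cmod (w s) \<le> cmod (w a) + 5 * (c * v s ^ 3)" by linarith
  then show ?thesis by (simp add: c_def algebra_simps)
qed

text \<open>Of the four factors \<open>v\<close> in the defect, two are bounded by
  \<open>1 / g^2\<close> and two are integrated across the crossing. The majorant \<open>c\<close>
  stays free because the bound is run twice, with \<open>c\<close> of order \<open>eps\<close> and
  then, up to initial data, of order \<open>eps^2\<close>.\<close>

lemma rem_bound:
  assumes sol: "adiabatic_solution g gam eps {a..} z w" and eps: "eps > 0"
    and z1: "\<And>s. s \<ge> a \<Longrightarrow> \<bar>z s\<bar> \<le> 1" and w1: "\<And>s. s \<ge> a \<Longrightarrow> cmod (w s) \<le> 1"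
    and s: "a \<le> s" and c: "\<And>t. a \<le> t \<Longrightarrow> eps * cmod (w t) + eps\<^sup>2 \<le> c"
  shows "cmod (rem eps z w s) \<le> cmod (rem eps z w a) + N * c * (pi / g ^ 3)"
proof -
  have "0 \<le> eps * cmod (w a) + eps\<^sup>2" using eps by simp
  with c[OF order_refl] have c0: "0 \<le> c" by linarith
  define K where "K t = N * c / g\<^sup>2 * (arctan (t / g) / g)" for t
  define K' where "K' t = N * c / g\<^sup>2 * (inverse (om g t))\<^sup>2" for t
  have "cmod (rem eps z w s) \<le> cmod (rem eps z w a) + (K s - K a)"
  proof (rule dissipative_comparison[OF s(1)])
    fix t assume t: "a \<le> t" "t \<le> s"
    show "(rem eps z w has_vector_derivative
      (of_real (om g t / eps) * (\<i> - of_real (gam t))) * rem eps z w t + err eps z w t) (at t within {a..s})"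
      by (rule has_vector_derivative_rem[OF adiabatic_solution_subset[OF sol]]) (use t eps in auto)
    show "Re (of_real (om g t / eps) * (\<i> - of_real (gam t))) \<le> 0"
      using om_pos[OF g, of t] gam_nonneg[of t] eps by simp
    show "(K has_real_derivative K' t) (at t within {a..s})"
      unfolding K_def K'_def by (intro DERIV_cmult DERIV_arctan_om g)
    have "cmod (err eps z w t) \<le> N * (eps * cmod (w t) + eps\<^sup>2) * v t ^ 4"
      by (rule norm_err_le) (use z1 w1 t eps in auto)
    also have "\<dots> \<le> N * c * v t ^ 4"
      using c[OF t(1)] v_pos[of t] N_facts(1) by (intro mult_right_mono mult_left_mono) auto
    also have "\<dots> = N * c * (v t)\<^sup>2 * (v t)\<^sup>2" by (simp add: power_numeral_reduce)
    also have "\<dots> \<le> N * c * (v t)\<^sup>2 * (1 / g\<^sup>2)"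
      using c0 N_facts(1) by (intro mult_left_mono v_facts(1)) auto
    finally show "cmod (err eps z w t) \<le> K' t" by (simp add: K'_def v_def)
  qed
  also have "K s - K a = N * c / g\<^sup>2 * (arctan (s / g) / g - arctan (a / g) / g)"
    by (simp add: K_def right_diff_distrib)
  also have "\<dots> \<le> N * c / g\<^sup>2 * (pi / g)"
    using c0 N_facts(1) by (intro mult_left_mono arctan_diff_le g) auto
  also have "\<dots> = N * c * (pi / g ^ 3)" by (simp add: power_numeral_reduce)
  finally show ?thesis by simp
qed

end

text \<open>The 6 leaves room for \<open>pi \<le> 4\<close> from the accumulated defect and for one
  conversion between \<open>w\<close> and its remainder at either end.\<close>

definition glob_const :: "real \<Rightarrow> real \<Rightarrow> real" where
  "glob_const g B = 6 * est_const g B / g ^ 3"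

text \<open>One summand for each of the five contributions collected at the end of the second-order
  bound; the last comes from replacing \<open>z\<close> by -1.\<close>

definition second_const :: "real \<Rightarrow> real \<Rightarrow> real" where
  "second_const g B = 1 + 2 * est_const g B + glob_const g B * (1 + 2 * glob_const g B)
     + glob_const g B + (4 + 8 * glob_const g B) / g\<^sup>2"

text \<open>The first summand serves \<open>eps \<le> 1\<close>, the second
  \<open>eps > 1\<close>.\<close>

definition pair_const :: "real \<Rightarrow> real \<Rightarrow> real" where
  "pair_const g B = (10 * est_const g B + g) * (2 * second_const g B) + (10 * est_const g B + 1 / g)"

context dephasing
begin

abbreviation (input) N2 where "N2 \<equiv> glob_const g B"

lemma N2_nonneg: "0 \<le> N2"
  using N_facts(1) g by (simp add: glob_const_def)

lemma second_const_nonneg: "0 \<le> second_const g B"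
  using N2_nonneg N_facts(1) g by (auto simp: second_const_def intro!: add_nonneg_nonneg mult_nonneg_nonneg divide_nonneg_nonneg)

lemma v3_le: "v s ^ 3 \<le> 1 / g ^ 3"
  using power_mono[OF v_le[of s], of 3] v_pos[of s] by (simp add: power_divide)

lemma N_v3_le: "N * v s ^ 3 \<le> N2 / 6"
  using mult_left_mono[OF v3_le[of s], of N] N_facts(1) by (simp add: glob_const_def)

lemma global_bound:
  assumes sol: "adiabatic_solution g gam eps {a..} z w" and eps: "eps > 0"
    and z1: "\<And>s. s \<ge> a \<Longrightarrow> \<bar>z s\<bar> \<le> 1" and w1: "\<And>s. s \<ge> a \<Longrightarrow> cmod (w s) \<le> 1"
    and s: "a \<le> s"
  shows "cmod (w s) \<le> cmod (w a) + N2 * (eps + eps\<^sup>2)"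
proof -
  have e: "0 \<le> eps + eps\<^sup>2" using eps by simp
  have "cmod (rem eps z w s) \<le> cmod (rem eps z w a) + N * (eps + eps\<^sup>2) * (pi / g ^ 3)"
    by (rule rem_bound[OF sol eps z1 w1 s]) (use w1 eps in \<open>auto simp: mult_left_le\<close>)
  also have "N * (eps + eps\<^sup>2) * (pi / g ^ 3) \<le> N * (eps + eps\<^sup>2) * (4 / g ^ 3)"
    using N_facts(1) e g pi_less_4 by (intro mult_left_mono divide_right_mono) auto
  also have "\<dots> = 4 / 6 * (N2 * (eps + eps\<^sup>2))" by (simp add: glob_const_def)
  finally have r: "cmod (rem eps z w s) \<le> cmod (rem eps z w a) + 4 / 6 * (N2 * (eps + eps\<^sup>2))" by simp
  have d: "cmod (rem eps z w t - w t) \<le> 1 / 6 * (N2 * (eps + eps\<^sup>2))" if "a \<le> t" for t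
  proof -
    have "cmod (rem eps z w t - w t) \<le> N * v t ^ 3 * (eps + eps\<^sup>2)"
      using norm_rem_diff_le(1)[of z t eps w] z1[OF that] eps by (simp add: mult_ac)
    also have "\<dots> \<le> N2 / 6 * (eps + eps\<^sup>2)"
      by (intro mult_right_mono N_v3_le e)
    finally show ?thesis by simp
  qed
  show ?thesis
    using r d[OF s] d[OF order_refl] norm_triangle_ineq3[of "rem eps z w s" "w s"]
      norm_triangle_ineq3[of "rem eps z w a" "w a"] by linarith
qed

text \<open>The second round of the bootstrap. \<open>w\<close> of order \<open>eps\<close> makes
  the defect second order, and it also lets \<open>z\<close> move by only O(\<open>eps\<close>), so
  \<open>z\<close> may be replaced by -1 in the leading term. The defects of the initial data are
  kept, so that the bound serves both for a start at a finite time and in the limit of a start at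
  minus infinity.\<close>

lemma second_order_bound:
  assumes sol: "adiabatic_solution g gam eps {a..} z w" and eps: "eps > 0" "eps \<le> 1"
    and z1: "\<And>s. s \<ge> a \<Longrightarrow> \<bar>z s\<bar> \<le> 1" and w1: "\<And>s. s \<ge> a \<Longrightarrow> cmod (w s) \<le> 1"
    and s: "a \<le> s"
  shows "cmod (w s + of_real eps * al s)
     \<le> second_const g B * (eps\<^sup>2 + cmod (w a) + \<bar>z a + 1\<bar> + eps * v a ^ 3)"
proof -
  let ?D = "cmod (w a)"
  have e2: "eps\<^sup>2 \<le> eps" using eps by (simp add: power2_eq_square mult_left_le)
  have W: "cmod (w t) \<le> ?D + 2 * N2 * eps" if "a \<le> t" for t
  proof -
    have "N2 * (eps + eps\<^sup>2) \<le> N2 * (2 * eps)"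
      using e2 N2_nonneg by (intro mult_left_mono) auto
    then show ?thesis using global_bound[OF sol eps(1) z1 w1 that] by simp
  qed
  define c where "c = (1 + 2 * N2) * (?D + eps\<^sup>2)"
  have c: "eps * cmod (w t) + eps\<^sup>2 \<le> c" if "a \<le> t" for t
  proof -
    have "eps * cmod (w t) \<le> eps * (?D + 2 * N2 * eps)"
      using W[OF that] eps by (intro mult_left_mono) auto
    moreover have "eps * ?D \<le> ?D" using eps by (simp add: mult_left_le_one_le)
    moreover have "0 \<le> N2 * ?D" using N2_nonneg by simp
    ultimately show ?thesis by (simp add: c_def algebra_simps power2_eq_square)
  qed
  have c0: "0 \<le> c" using N2_nonneg by (auto simp: c_def)
  have "cmod (rem eps z w s) \<le> cmod (rem eps z w a) + N * c * (pi / g ^ 3)"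
    by (rule rem_bound[OF sol eps(1) z1 w1 s c])
  also have "N * c * (pi / g ^ 3) \<le> N * c * (6 / g ^ 3)"
    using N_facts(1) c0 g pi_less_4 by (intro mult_left_mono divide_right_mono) auto
  also have "\<dots> = N2 * c" by (simp add: glob_const_def)
  finally have r: "cmod (rem eps z w s) \<le> cmod (rem eps z w a) + N2 * c" by simp
  have "N * (eps + eps\<^sup>2) * v a ^ 3 \<le> N * (2 * eps) * v a ^ 3"
    using N_facts(1) e2 v_pos[of a] by (intro mult_right_mono mult_left_mono) auto
  then have ra: "cmod (rem eps z w a) \<le> ?D + 2 * N * (eps * v a ^ 3)"
    using norm_rem_diff_le(1)[of z a eps w] z1[of a] eps norm_triangle_ineq3[of "rem eps z w a" "w a"]
    by simp
  have "N * eps\<^sup>2 * v s ^ 3 \<le> N2 / 6 * eps\<^sup>2"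
    using mult_right_mono[OF N_v3_le[of s], of "eps\<^sup>2"] by (simp add: mult_ac)
  also have "\<dots> \<le> N2 * eps\<^sup>2" using N2_nonneg by (intro mult_right_mono) auto
  finally have rs: "cmod (w s - of_real (eps * z s) * al s) \<le> cmod (rem eps z w s) + N2 * eps\<^sup>2"
    using norm_rem_diff_le(2)[of z s eps w] z1[OF s] eps
      norm_triangle_ineq3[of "rem eps z w s" "w s - of_real (eps * z s) * al s"] by linarith
  \<comment> \<open>The integrated rotation speed is at most \<open>pi\<close>, so \<open>z\<close>
    moves by at most \<open>pi\<close> times the uniform bound on \<open>w\<close>.\<close>
  have "\<bar>z s - z a\<bar> \<le> g * (?D + 2 * N2 * eps) * (arctan (s / g) / g) - g * (?D + 2 * N2 * eps) * (arctan (a / g) / g)"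
  proof (rule abs_diff_le_comparison[OF s])
    fix t assume t: "a \<le> t" "t \<le> s"
    show "(z has_real_derivative g * (inverse (om g t))\<^sup>2 * Re (w t)) (at t within {a..s})"
      using adiabatic_solution_subset[OF sol, of "{a..s}"] t by (auto simp: adiabatic_solution_def)
    show "((\<lambda>s. g * (?D + 2 * N2 * eps) * (arctan (s / g) / g)) has_real_derivative
      g * (?D + 2 * N2 * eps) * (inverse (om g t))\<^sup>2) (at t within {a..s})"
      by (intro DERIV_cmult DERIV_arctan_om g)
    have "\<bar>Re (w t)\<bar> \<le> ?D + 2 * N2 * eps" using W[OF t(1)] abs_Re_le_cmod order_trans by blast
    then have "g * (inverse (om g t))\<^sup>2 * \<bar>Re (w t)\<bar> \<le> g * (inverse (om g t))\<^sup>2 * (?D + 2 * N2 * eps)"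
      using g by (intro mult_left_mono) auto
    then show "\<bar>g * (inverse (om g t))\<^sup>2 * Re (w t)\<bar> \<le> g * (?D + 2 * N2 * eps) * (inverse (om g t))\<^sup>2"
      using g by (simp add: abs_mult mult_ac)
  qed
  also have "\<dots> = g * (?D + 2 * N2 * eps) * (arctan (s / g) / g - arctan (a / g) / g)"
    by (simp add: right_diff_distrib)
  also have "\<dots> \<le> g * (?D + 2 * N2 * eps) * (pi / g)"
    using g N2_nonneg eps by (intro mult_left_mono arctan_diff_le) auto
  also have "\<dots> = (?D + 2 * N2 * eps) * pi" using g by simp
  also have "\<dots> \<le> (?D + 2 * N2 * eps) * 4"
    using N2_nonneg eps pi_less_4 by (intro mult_left_mono) auto
  finally have zz: "\<bar>z s + 1\<bar> \<le> \<bar>z a + 1\<bar> + 4 * ?D + 8 * N2 * eps" by simp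
  have "g * v s ^ 3 \<le> g * (1 / g ^ 3)" using g by (intro mult_left_mono v3_le) auto
  then have al: "cmod (al s) \<le> 1 / g\<^sup>2"
    using norm_al_le[of s] g by (simp add: power_numeral_reduce)
  have "cmod (of_real (eps * (z s + 1)) * al s) \<le> (eps * (\<bar>z a + 1\<bar> + 4 * ?D + 8 * N2 * eps)) * (1 / g\<^sup>2)"
    using eps zz by (intro norm_of_real_mult_mono al) (simp add: abs_mult)
  also have "\<dots> = (eps * (\<bar>z a + 1\<bar> + 4 * ?D) + 8 * N2 * eps\<^sup>2) / g\<^sup>2"
    by (simp add: algebra_simps power2_eq_square add_divide_distrib)
  also have "\<dots> \<le> ((\<bar>z a + 1\<bar> + 4 * ?D) + 8 * N2 * eps\<^sup>2) / g\<^sup>2"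
    using eps by (intro divide_right_mono add_right_mono mult_left_le_one_le) auto
  finally have za: "cmod (of_real (eps * (z s + 1)) * al s) \<le> ((\<bar>z a + 1\<bar> + 4 * ?D) + 8 * N2 * eps\<^sup>2) / g\<^sup>2" .
  have "w s + of_real eps * al s = (w s - of_real (eps * z s) * al s) + of_real (eps * (z s + 1)) * al s"
    by (simp add: algebra_simps)
  then have "cmod (w s + of_real eps * al s) \<le> cmod (w s - of_real (eps * z s) * al s) + cmod (of_real (eps * (z s + 1)) * al s)"
    by (metis norm_triangle_ineq)
  also have "\<dots> \<le> ?D + 2 * N * (eps * v a ^ 3) + N2 * c + N2 * eps\<^sup>2 + ((\<bar>z a + 1\<bar> + 4 * ?D) + 8 * N2 * eps\<^sup>2) / g\<^sup>2"
    using rs za r ra by linarith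
  also have "\<dots> \<le> second_const g B * (eps\<^sup>2 + cmod (w a) + \<bar>z a + 1\<bar> + eps * v a ^ 3)"
  proof -
    define S where "S = eps\<^sup>2 + ?D + \<bar>z a + 1\<bar> + eps * v a ^ 3"
    have ev: "0 \<le> eps * v a ^ 3" using eps v_pos[of a] by simp
    have 1: "?D \<le> 1 * S" "2 * N * (eps * v a ^ 3) \<le> 2 * N * S" "N2 * eps\<^sup>2 \<le> N2 * S"
      using N2_nonneg N_facts(1) ev eps by (auto simp: S_def intro!: mult_left_mono)
    have 2: "N2 * c \<le> N2 * (1 + 2 * N2) * S"
      unfolding c_def mult.assoc using N2_nonneg ev by (intro mult_left_mono) (auto simp: S_def)
    have S: "eps\<^sup>2 \<le> S" "?D \<le> S" "\<bar>z a + 1\<bar> + 4 * ?D \<le> 4 * S" "0 \<le> S"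
      using ev by (auto simp: S_def)
    have "8 * N2 * eps\<^sup>2 \<le> 8 * N2 * S"
      using S(1) N2_nonneg by (intro mult_left_mono) auto
    then have "(\<bar>z a + 1\<bar> + 4 * ?D) + 8 * N2 * eps\<^sup>2 \<le> (4 + 8 * N2) * S"
      using S(3) by (simp add: algebra_simps)
    then have 3: "((\<bar>z a + 1\<bar> + 4 * ?D) + 8 * N2 * eps\<^sup>2) / g\<^sup>2 \<le> (4 + 8 * N2) / g\<^sup>2 * S"
      using g by (simp add: divide_right_mono)
    have "second_const g B * S = 1 * S + 2 * N * S + N2 * (1 + 2 * N2) * S + N2 * S + (4 + 8 * N2) / g\<^sup>2 * S"
      by (simp add: second_const_def algebra_simps)
    then show ?thesis using 1 2 3 unfolding S_def[symmetric] by linarith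
  qed
  finally show ?thesis .
qed

lemma tendsto_v_at_bot: "(v \<longlongrightarrow> 0) at_bot"
proof -
  have "filterlim (om g) at_top at_bot"
  proof (rule filterlim_at_top_mono)
    show "filterlim (\<lambda>x::real. - x) at_top at_bot" by (rule filterlim_uminus_at_top_at_bot)
    show "\<forall>\<^sub>F x in at_bot. - x \<le> om g x"
      using abs_le_om[of _ g] by (intro always_eventually allI) (metis abs_ge_minus_self order_trans)
  qed
  then show ?thesis unfolding v_def[abs_def] by (rule tendsto_inverse_0_at_top)
qed

text \<open>The starting time tends to minus infinity, where the data converge to the ground state
  and \<open>v\<close> to 0; only the part of each bound that is independent of the start
  survives.\<close>

lemma bounds_from_minus_infinity:
  assumes sol: "adiabatic_solution g gam eps UNIV z w" and eps: "eps > 0"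
    and z1: "\<And>s. \<bar>z s\<bar> \<le> 1" and w1: "\<And>s. cmod (w s) \<le> 1"
    and lim: "(z \<longlongrightarrow> - 1) at_bot" "(w \<longlongrightarrow> 0) at_bot"
  shows "s \<le> 0 \<Longrightarrow> cmod (w s) \<le> 5 * N * (eps + eps\<^sup>2) * v s ^ 3"
    and "eps \<le> 1 \<Longrightarrow> cmod (w s + of_real eps * al s) \<le> second_const g B * eps\<^sup>2"
proof -
  have sol': "adiabatic_solution g gam eps {a..} z w" for a
    by (rule adiabatic_solution_subset[OF sol]) simp
  have ev: "\<forall>\<^sub>F a in at_bot. a \<le> s" by (rule eventually_le_at_bot)
  show "cmod (w s) \<le> 5 * N * (eps + eps\<^sup>2) * v s ^ 3" if "s \<le> 0"
  proof (rule tendsto_le[OF trivial_limit_at_bot_linorder])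
    show "((\<lambda>a. cmod (w a) + 5 * N * (eps + eps\<^sup>2) * v s ^ 3) \<longlongrightarrow> 5 * N * (eps + eps\<^sup>2) * v s ^ 3) at_bot"
      using tendsto_add[OF tendsto_norm[OF lim(2)] tendsto_const] by simp
    show "\<forall>\<^sub>F a in at_bot. cmod (w s) \<le> cmod (w a) + 5 * N * (eps + eps\<^sup>2) * v s ^ 3"
      using ev by eventually_elim (rule decay_before_crossing[OF sol' eps z1 w1 _ that])
  qed (rule tendsto_const)
  show "cmod (w s + of_real eps * al s) \<le> second_const g B * eps\<^sup>2" if "eps \<le> 1"
  proof (rule tendsto_le[OF trivial_limit_at_bot_linorder])
    have "((\<lambda>a. second_const g B * (eps\<^sup>2 + cmod (w a) + \<bar>z a + 1\<bar> + eps * v a ^ 3)) \<longlongrightarrow>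
        second_const g B * (eps\<^sup>2 + cmod 0 + \<bar>- 1 + 1\<bar> + eps * 0 ^ 3)) at_bot"
      by (intro tendsto_intros lim tendsto_v_at_bot)
    then show "((\<lambda>a. second_const g B * (eps\<^sup>2 + cmod (w a) + \<bar>z a + 1\<bar> + eps * v a ^ 3)) \<longlongrightarrow>
        second_const g B * eps\<^sup>2) at_bot" by simp
    show "\<forall>\<^sub>F a in at_bot. cmod (w s + of_real eps * al s)
        \<le> second_const g B * (eps\<^sup>2 + cmod (w a) + \<bar>z a + 1\<bar> + eps * v a ^ 3)"
      using ev by eventually_elim (rule second_order_bound[OF sol' eps that z1 w1])
  qed (rule tendsto_const)
qed

end

text \<open>The splitting puts smallness on \<open>X\<close> and \<open>y\<close> only, so
  \<open>Y\<close> may lack decay as long as it is close to \<open>y\<close>.\<close>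

lemma norm_mult_diff_le:
  fixes X Y x y :: complex
  assumes "cmod X \<le> a" "cmod (Y - y) \<le> b" "cmod y \<le> c" "cmod (X - x) \<le> b"
  shows "cmod (X * Y - x * y) \<le> (a + c) * b"
proof -
  have "X * Y - x * y = X * (Y - y) + (X - x) * y" by (simp add: algebra_simps)
  also have "cmod \<dots> \<le> cmod X * cmod (Y - y) + cmod (X - x) * cmod y"
    by (metis norm_mult norm_triangle_ineq)
  also have "\<dots> \<le> a * b + b * c"
    using assms by (intro add_mono mult_mono) (auto intro: order_trans[OF norm_ge_zero])
  finally show ?thesis by (simp add: algebra_simps)
qed

context dephasing
begin

text \<open>\<open>X\<close> stands for the reversed reference coherence \<open>W (- s)\<close> and
  \<open>Y\<close> for the dephased one. On either side of the crossing one of them decays, and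
  \<open>norm_mult_diff_le\<close> is used with the decaying one in front.\<close>

lemma pairing_error:
  assumes eps: "eps > 0"
    and w1: "cmod Y \<le> 1" and W1: "cmod X \<le> 1"
    and X: "s \<ge> 0 \<Longrightarrow> cmod X \<le> 5 * N * (eps + eps\<^sup>2) * v s ^ 3"
    and Y: "s \<le> 0 \<Longrightarrow> cmod Y \<le> 5 * N * (eps + eps\<^sup>2) * v s ^ 3"
    and X2: "eps \<le> 1 \<Longrightarrow> cmod (X + of_real eps * (of_real (g * v s ^ 3) * inverse \<i>)) \<le> 2 * second_const g B * eps\<^sup>2"
    and Y2: "eps \<le> 1 \<Longrightarrow> cmod (Y + of_real eps * al s) \<le> 2 * second_const g B * eps\<^sup>2"
  shows "\<bar>Re (X * Y) + eps\<^sup>2 * g\<^sup>2 * v s ^ 6 / (1 + (gam s)\<^sup>2)\<bar> \<le> pair_const g B * eps ^ 3 * v s ^ 3"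
proof -
  define x where "x = - (of_real eps * (of_real (g * v s ^ 3) * inverse \<i>))"
  define y where "y = - (of_real eps * al s)"
  have v: "v s > 0" by (rule v_pos)
  \<comment> \<open>This real part is the origin of the weight \<open>1 / (1 + gam^2)\<close> in the
    claimed integral.\<close>
  have "Re (inverse \<i> * j s) = - 1 / (1 + (gam s)\<^sup>2)"
    by (simp add: j_def complex_inverse cmod_power2 power2_eq_square add.commute)
  moreover have "x * y = of_real (eps\<^sup>2 * g\<^sup>2 * v s ^ 6) * (inverse \<i> * j s)"
    by (simp add: x_def y_def al_def power_numeral_reduce)
  ultimately have re: "Re (x * y) = - (eps\<^sup>2 * g\<^sup>2 * v s ^ 6 / (1 + (gam s)\<^sup>2))"
  proof -
    assume *: "Re (inverse \<i> * j s) = - 1 / (1 + (gam s)\<^sup>2)"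
      and xy: "x * y = of_real (eps\<^sup>2 * g\<^sup>2 * v s ^ 6) * (inverse \<i> * j s)"
    have "Re (of_real r * c) = r * Re c" for r c by simp
    then show ?thesis unfolding xy by (simp only: *) simp
  qed
  have "\<bar>Re (X * Y) + eps\<^sup>2 * g\<^sup>2 * v s ^ 6 / (1 + (gam s)\<^sup>2)\<bar> = \<bar>Re (X * Y - x * y)\<bar>"
    unfolding minus_complex.sel(1) re by simp
  also have "\<dots> \<le> cmod (X * Y - x * y)" by (rule abs_Re_le_cmod)
  also have "\<dots> \<le> pair_const g B * eps ^ 3 * v s ^ 3"
  proof (cases "eps \<le> 1")
    case True
    have "5 * N * (eps + eps\<^sup>2) * v s ^ 3 \<le> 5 * N * (2 * eps) * v s ^ 3"
      using True eps v N_facts(1) by (intro mult_right_mono mult_left_mono) (auto simp: power2_eq_square mult_left_le)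
    then have le: "5 * N * (eps + eps\<^sup>2) * v s ^ 3 \<le> 10 * N * eps * v s ^ 3" by simp
    have x: "cmod x \<le> g * eps * v s ^ 3" using g eps v by (simp add: x_def norm_mult norm_inverse norm_power)
    have y: "cmod y \<le> g * eps * v s ^ 3"
      using mult_left_mono[OF norm_al_le[of s], of eps] eps by (simp add: y_def norm_mult mult_ac)
    have Xx: "cmod (X - x) \<le> 2 * second_const g B * eps\<^sup>2"
      and Yy: "cmod (Y - y) \<le> 2 * second_const g B * eps\<^sup>2"
      using X2[OF True] Y2[OF True] by (auto simp: x_def y_def)
    have "cmod (X * Y - x * y) \<le> (10 * N * eps * v s ^ 3 + g * eps * v s ^ 3) * (2 * second_const g B * eps\<^sup>2)"
    proof (cases "s \<ge> 0")
      case True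
      show ?thesis by (rule norm_mult_diff_le[OF order_trans[OF X[OF True] le] Yy y Xx])
    next
      case False
      then have "s \<le> 0" by simp
      have "cmod (Y * X - y * x) \<le> (10 * N * eps * v s ^ 3 + g * eps * v s ^ 3) * (2 * second_const g B * eps\<^sup>2)"
        by (rule norm_mult_diff_le[OF order_trans[OF Y[OF \<open>s \<le> 0\<close>] le] Xx x Yy])
      then show ?thesis by (simp add: mult.commute)
    qed
    also have "\<dots> = (10 * N + g) * (2 * second_const g B) * (eps ^ 3 * v s ^ 3)"
      by (simp add: algebra_simps power_numeral_reduce)
    also have "\<dots> \<le> pair_const g B * (eps ^ 3 * v s ^ 3)"
      using v eps g N_facts(1) by (intro mult_right_mono) (auto simp: pair_const_def)
    finally show ?thesis by (simp add: mult_ac)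
  next
    case False
    \<comment> \<open>For \<open>eps > 1\<close> higher powers of \<open>eps\<close> are larger, so
      both products are separately of order \<open>eps^3 * v^3\<close> and no cancellation is
      used.\<close>
    have "eps ^ 2 \<le> eps ^ 3" "eps \<le> eps ^ 2" using False power_increasing[of 2 3 eps] power_increasing[of 1 2 eps] by auto
    have e: "eps + eps\<^sup>2 \<le> 2 * eps ^ 3" using \<open>eps ^ 2 \<le> eps ^ 3\<close> \<open>eps \<le> eps ^ 2\<close> by linarith
    have le: "5 * N * (eps + eps\<^sup>2) * v s ^ 3 \<le> 5 * N * (2 * eps ^ 3) * v s ^ 3"
      using e v N_facts(1) by (intro mult_right_mono mult_left_mono) auto
    have "cmod (X * Y) \<le> 5 * N * (2 * eps ^ 3) * v s ^ 3"
    proof (cases "s \<ge> 0")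
      case True
      have "cmod X * cmod Y \<le> cmod X" using w1 by (simp add: mult_left_le)
      then show ?thesis using X[OF True] le by (simp add: norm_mult)
    next
      case False
      have "cmod X * cmod Y \<le> cmod Y" using W1 by (simp add: mult_left_le_one_le)
      then show ?thesis using Y False le by (simp add: norm_mult)
    qed
    moreover have "cmod (x * y) \<le> 1 / g * (eps ^ 3 * v s ^ 3)"
    proof -
      have "cmod x = g * eps * v s ^ 3" using g eps v by (simp add: x_def norm_mult norm_inverse norm_power)
      moreover have "cmod y \<le> eps * (g * v s ^ 3)"
        using mult_left_mono[OF norm_al_le[of s], of eps] eps by (simp add: y_def norm_mult mult_ac)
      ultimately have "cmod (x * y) \<le> (g * eps * v s ^ 3) * (eps * (g * v s ^ 3))"
        unfolding norm_mult using g eps v by (intro mult_mono) auto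
      also have "\<dots> \<le> (g * eps * v s ^ 3) * (eps * (g * (1 / g ^ 3)))"
        using g eps v by (intro mult_left_mono v3_le) auto
      also have "\<dots> = 1 / g * (eps\<^sup>2 * v s ^ 3)"
        using g by (simp add: power_numeral_reduce)
      also have "\<dots> \<le> 1 / g * (eps ^ 3 * v s ^ 3)"
        using g v \<open>eps ^ 2 \<le> eps ^ 3\<close> by (intro mult_left_mono mult_right_mono) auto
      finally show ?thesis .
    qed
    ultimately have "cmod (X * Y - x * y) \<le> (10 * N + 1 / g) * (eps ^ 3 * v s ^ 3)"
      using norm_triangle_ineq4[of "X * Y" "x * y"] by (simp add: algebra_simps)
    also have "\<dots> \<le> pair_const g B * (eps ^ 3 * v s ^ 3)"
      using v eps g N_facts(1) second_const_nonneg by (intro mult_right_mono) (auto simp: pair_const_def)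
    finally show ?thesis by (simp add: mult_ac)
  qed
  finally show ?thesis .
qed

end

section \<open>The Landau-Zener solution\<close>

lemma gaussian_moments:
  shows "integrable lborel (\<lambda>v::real. exp (- v\<^sup>2 / 2))" "(\<integral>v. exp (- v\<^sup>2 / 2) \<partial>lborel) = sqrt (2 * pi)"
    and "integrable lborel (\<lambda>v::real. v * exp (- v\<^sup>2 / 2))" "(\<integral>v. v * exp (- v\<^sup>2 / 2) \<partial>lborel) = (0::real)"
    and "integrable lborel (\<lambda>v::real. \<bar>v\<bar> * exp (- v\<^sup>2 / 2))"
    and "integrable lborel (\<lambda>v::real. v\<^sup>2 * exp (- v\<^sup>2 / 2))"
proof -
  have e: "exp (- v\<^sup>2 / 2) = sqrt (2 * pi) * std_normal_density v" for v
    by (simp add: std_normal_density_def)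
  show "integrable lborel (\<lambda>v::real. exp (- v\<^sup>2 / 2))" "(\<integral>v. exp (- v\<^sup>2 / 2) \<partial>lborel) = sqrt (2 * pi)"
    using std_normal_moment_even[of 0] unfolding e
    by (auto simp: has_bochner_integral_iff)
  show "integrable lborel (\<lambda>v::real. v * exp (- v\<^sup>2 / 2))" "(\<integral>v. v * exp (- v\<^sup>2 / 2) \<partial>lborel) = (0::real)"
    using has_bochner_integral_mult_right[OF std_normal_moment_odd[of 0], of "sqrt (2 * pi)"] unfolding e
    by (auto simp: has_bochner_integral_iff mult_ac)
  show "integrable lborel (\<lambda>v::real. \<bar>v\<bar> * exp (- v\<^sup>2 / 2))"
    using integrable_mult_right[OF integrable_std_normal_moment_abs[of 1], of "sqrt (2 * pi)"]
    unfolding e by (simp add: mult_ac)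
  show "integrable lborel (\<lambda>v::real. v\<^sup>2 * exp (- v\<^sup>2 / 2))"
    using integrable_mult_right[OF integrable_std_normal_moment[of 2], of "sqrt (2 * pi)"]
    unfolding e by (simp add: mult_ac)
qed

lemma gaussian_exp_abs_tendsto_0:
  "((\<lambda>u::real. exp (- u\<^sup>2 / 2 + k * \<bar>u\<bar>)) \<longlongrightarrow> 0) at_top"
  "((\<lambda>u::real. exp (- u\<^sup>2 / 2 + k * \<bar>u\<bar>)) \<longlongrightarrow> 0) at_bot"
proof -
  have "((\<lambda>u::real. exp (- u\<^sup>2 / 2 + k * u)) \<longlongrightarrow> 0) at_top" by real_asymp
  moreover have "\<forall>\<^sub>F u in at_top. exp (- u\<^sup>2 / 2 + k * u) = exp (- u\<^sup>2 / 2 + k * \<bar>u::real\<bar>)"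
    using eventually_ge_at_top[of 0] by eventually_elim simp
  ultimately show "((\<lambda>u::real. exp (- u\<^sup>2 / 2 + k * \<bar>u\<bar>)) \<longlongrightarrow> 0) at_top"
    by (rule Lim_transform_eventually)
  then show "((\<lambda>u::real. exp (- u\<^sup>2 / 2 + k * \<bar>u\<bar>)) \<longlongrightarrow> 0) at_bot"
    unfolding at_bot_mirror filterlim_filtermap by simp
qed

text \<open>The branch of \<open>t powr (- \<i> kap)\<close> on the closed upper half plane that is continuous off 0.\<close>

definition phi :: "real \<Rightarrow> complex \<Rightarrow> complex" where
  "phi kap t = (if t = 0 then 1 else exp (- \<i> * of_real kap * (Ln (- \<i> * t) + \<i> * of_real pi / 2)))"

lemma norm_phi_eq: "t \<noteq> 0 \<Longrightarrow> cmod (phi kap t) = exp (kap * (Im (Ln (- \<i> * t)) + pi / 2))"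
  by (simp add: phi_def algebra_simps)

text \<open>On the closed upper half plane the modulus is \<open>exp (kap * arg t)\<close> with
  \<open>arg t\<close> between 0 and \<open>pi\<close>; the value 1 chosen at 0 respects the same
  bounds. The lower bound will keep the exact solution from vanishing.\<close>

lemma norm_phi:
  assumes "kap > 0" "Im t \<ge> 0"
  shows "1 \<le> cmod (phi kap t)" "cmod (phi kap t) \<le> exp (pi * kap)"
proof -
  have "1 \<le> cmod (phi kap t) \<and> cmod (phi kap t) \<le> exp (pi * kap)"
  proof (cases "t = 0")
    case False
    then have "\<bar>Im (Ln (- \<i> * t))\<bar> \<le> pi / 2"
      using assms Re_Ln_pos_le[of "- \<i> * t"] by simp
    then have "0 \<le> Im (Ln (- \<i> * t)) + pi / 2" "Im (Ln (- \<i> * t)) + pi / 2 \<le> pi" by linarith+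
    then have "0 \<le> kap * (Im (Ln (- \<i> * t)) + pi / 2)" "kap * (Im (Ln (- \<i> * t)) + pi / 2) \<le> pi * kap"
      using assms mult_left_mono[of "Im (Ln (- \<i> * t)) + pi / 2" pi kap] by (auto simp: mult.commute)
    then show ?thesis unfolding norm_phi_eq[OF False] by simp
  qed (use assms in \<open>simp add: phi_def\<close>)
  then show "1 \<le> cmod (phi kap t)" "cmod (phi kap t) \<le> exp (pi * kap)" by auto
qed

lemma phi_has_field_derivative:
  assumes "- \<i> * t \<notin> \<real>\<^sub>\<le>\<^sub>0"
  shows "(phi kap has_field_derivative - \<i> * of_real kap / t * phi kap t) (at t)"
proof -
  have "t \<noteq> 0" using assms by auto
  have ev: "\<forall>\<^sub>F t in nhds t. phi kap t = exp (- \<i> * of_real kap * (Ln (- \<i> * t) + \<i> * of_real pi / 2))"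
    using t1_space_nhds[OF \<open>t \<noteq> 0\<close>] by eventually_elim (simp add: phi_def)
  have "((\<lambda>t. exp (- \<i> * of_real kap * (Ln (- \<i> * t) + \<i> * of_real pi / 2))) has_field_derivative
      - \<i> * of_real kap / t * exp (- \<i> * of_real kap * (Ln (- \<i> * t) + \<i> * of_real pi / 2))) (at t)"
    using assms \<open>t \<noteq> 0\<close> by (auto intro!: derivative_eq_intros simp: field_simps)
  then show ?thesis
    unfolding DERIV_cong_ev[OF refl ev refl] using \<open>t \<noteq> 0\<close> by (simp add: phi_def)
qed

text \<open>Multiplying by \<open>- \<i>\<close> places the cut of \<open>Ln\<close> on the negative
  imaginary axis, so both halves of the real axis lie in the domain of differentiability.\<close>

lemma minus_i_times_notin_nonpos:
  "Im t > 0 \<Longrightarrow> - \<i> * t \<notin> \<real>\<^sub>\<le>\<^sub>0" "u \<noteq> 0 \<Longrightarrow> - \<i> * complex_of_real u \<notin> \<real>\<^sub>\<le>\<^sub>0"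
  by (auto simp: complex_nonpos_Reals_iff)

lemma phi_of_real_pos: "u > 0 \<Longrightarrow> phi kap (of_real u) = exp (- \<i> * of_real kap * of_real (ln u))"
  using Ln_times_of_real[of u "- \<i>"] by (simp add: phi_def mult.commute Ln_of_real)

text \<open>Going from \<open>u\<close> to \<open>- u\<close> through the upper half plane raises
  the argument by \<open>pi\<close>.\<close>

lemma phi_of_real_neg:
  assumes "u > 0"
  shows "phi kap (- of_real u) = of_real (exp (pi * kap)) * phi kap (of_real u)"
proof -
  have "phi kap (- of_real u) = exp (- \<i> * of_real kap * (of_real (ln u) + \<i> * of_real pi))"
    using assms Ln_times_of_real[of u "\<i>"] by (simp add: phi_def mult.commute Ln_of_real algebra_simps)
  also have "- \<i> * of_real kap * (of_real (ln u) + \<i> * of_real pi)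
      = of_real (pi * kap) + - \<i> * of_real kap * of_real (ln u)"
    by (simp add: algebra_simps)
  also have "exp \<dots> = of_real (exp (pi * kap)) * exp (- \<i> * of_real kap * of_real (ln u))"
    unfolding exp_add exp_of_real ..
  finally show ?thesis using assms by (simp add: phi_of_real_pos)
qed

lemma phi_of_real_measurable [measurable]: "(\<lambda>u. phi kap (of_real u)) \<in> borel_measurable borel"
proof -
  have "(\<lambda>u. phi kap (of_real u)) = (\<lambda>u. if u = 0 then 1 else if u > 0
     then exp (- \<i> * of_real kap * of_real (ln u))
     else of_real (exp (pi * kap)) * exp (- \<i> * of_real kap * of_real (ln (- u))))"
  proof (rule ext)
    fix u :: real
    show "phi kap (of_real u) = (if u = 0 then 1 else if u > 0
     then exp (- \<i> * of_real kap * of_real (ln u))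
     else of_real (exp (pi * kap)) * exp (- \<i> * of_real kap * of_real (ln (- u))))"
      using phi_of_real_pos[of u kap] phi_of_real_pos[of "- u" kap] phi_of_real_neg[of "- u" kap]
      by (cases "u = 0") (auto simp: phi_def[of _ 0])
  qed
  then show ?thesis by simp
qed

text \<open>This is \<open>exp (- \<i> * pi / 4)\<close>, a square root of
  \<open>- \<i>\<close>.\<close>

definition cc :: complex where "cc = Complex (1 / sqrt 2) (- 1 / sqrt 2)"

definition lzG :: "real \<Rightarrow> real \<Rightarrow> complex" where
  "lzG kap t = phi kap (of_real t) * of_real (exp (- t\<^sup>2 / 2))"

text \<open>
  Laplace's method applied to the equation \<open>F'' + \<i> x F' + (\<i> + kap) F = 0\<close> that is satisfied, up to a phase,
  by the first spinor component; the contour is rotated by \<open>cc\<close> so that the integrand is Gaussian.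
\<close>

definition lzF :: "real \<Rightarrow> real \<Rightarrow> complex" where
  "lzF kap x = (\<integral>t. lzG kap t * exp (cc * of_real x * of_real t) \<partial>lborel)"

definition lzF1 :: "real \<Rightarrow> real \<Rightarrow> complex" where
  "lzF1 kap x = (\<integral>t. (cc * of_real t * lzG kap t) * exp (cc * of_real x * of_real t) \<partial>lborel)"

definition lzF2 :: "real \<Rightarrow> real \<Rightarrow> complex" where
  "lzF2 kap x = (\<integral>t. (cc * of_real t * (cc * of_real t * lzG kap t)) * exp (cc * of_real x * of_real t) \<partial>lborel)"

lemma cc_sq: "cc * cc = - \<i>"
  by (simp add: cc_def complex_eq_iff field_simps)

lemma norm_cc: "cmod cc = 1"
  by (simp add: cc_def cmod_def power_divide)

lemma lzG_measurable [measurable]: "lzG kap \<in> borel_measurable borel"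
  unfolding lzG_def[abs_def] by measurable

lemma norm_lzG: "kap > 0 \<Longrightarrow> cmod (lzG kap t) \<le> exp (pi * kap) * exp (- t\<^sup>2 / 2)"
  using norm_phi(2)[of kap "of_real t"] by (simp add: lzG_def norm_mult)

lemma abs_le_exp_abs: "\<bar>t\<bar> \<le> exp \<bar>t\<bar>" for t :: real
  using exp_ge_add_one_self[of "\<bar>t\<bar>"] by linarith

lemma lzG_exp_integrable:
  assumes "kap > 0"
  shows "integrable lborel (\<lambda>t. cmod (lzG kap t) * exp (k * \<bar>t\<bar>))"
    and "integrable lborel (\<lambda>t. cmod (cc * of_real t * lzG kap t) * exp (k * \<bar>t\<bar>))"
    and "integrable lborel (\<lambda>t. cmod (cc * of_real t * (cc * of_real t * lzG kap t)) * exp (k * \<bar>t\<bar>))"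
proof -
  have I: "integrable lborel (\<lambda>t. cmod (lzG kap t) * exp (k * \<bar>t\<bar>))" for k
  proof (rule Bochner_Integration.integrable_bound)
    show "integrable lborel (\<lambda>t::real. exp (pi * kap) * exp (- t\<^sup>2 / 2 + k * \<bar>t\<bar>))"
      by (intro integrable_mult_right integrable_gaussian_exp_abs)
    show "AE t in lborel. norm (cmod (lzG kap t) * exp (k * \<bar>t\<bar>))
        \<le> norm (exp (pi * kap) * exp (- t\<^sup>2 / 2 + k * \<bar>t\<bar>))"
    proof (rule AE_I2)
      fix t
      show "norm (cmod (lzG kap t) * exp (k * \<bar>t\<bar>)) \<le> norm (exp (pi * kap) * exp (- t\<^sup>2 / 2 + k * \<bar>t\<bar>))"
        using mult_right_mono[OF norm_lzG[OF assms, of t], of "exp (k * \<bar>t\<bar>)"]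
        unfolding exp_add by (simp add: mult_ac)
    qed
  qed measurable
  have step: "integrable lborel (\<lambda>t. cmod (cc * of_real t * f t) * exp (k * \<bar>t\<bar>))"
    if [measurable]: "f \<in> borel_measurable borel" and f: "\<And>k. integrable lborel (\<lambda>t. cmod (f t) * exp (k * \<bar>t\<bar>))"
    for f k
  proof (rule Bochner_Integration.integrable_bound[OF f[of "k + 1"]])
    show "AE t in lborel. norm (cmod (cc * of_real t * f t) * exp (k * \<bar>t\<bar>))
        \<le> norm (cmod (f t) * exp ((k + 1) * \<bar>t\<bar>))"
    proof (rule AE_I2)
      fix t :: real
      have "\<bar>t\<bar> * (cmod (f t) * exp (k * \<bar>t\<bar>)) \<le> exp \<bar>t\<bar> * (cmod (f t) * exp (k * \<bar>t\<bar>))"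
        by (intro mult_right_mono abs_le_exp_abs) auto
      also have "\<dots> = cmod (f t) * exp ((k + 1) * \<bar>t\<bar>)"
        by (simp add: exp_add[symmetric] algebra_simps)
      finally show "norm (cmod (cc * of_real t * f t) * exp (k * \<bar>t\<bar>)) \<le> norm (cmod (f t) * exp ((k + 1) * \<bar>t\<bar>))"
        by (simp add: norm_mult norm_cc abs_mult mult_ac)
    qed
  qed measurable
  show "integrable lborel (\<lambda>t. cmod (lzG kap t) * exp (k * \<bar>t\<bar>))" by (rule I)
  have I1: "integrable lborel (\<lambda>t. cmod (cc * of_real t * lzG kap t) * exp (k * \<bar>t\<bar>))" for k
    by (rule step[OF _ I]) simp
  then show "integrable lborel (\<lambda>t. cmod (cc * of_real t * lzG kap t) * exp (k * \<bar>t\<bar>))" .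
  show "integrable lborel (\<lambda>t. cmod (cc * of_real t * (cc * of_real t * lzG kap t)) * exp (k * \<bar>t\<bar>))"
    by (rule step[OF _ I1]) measurable
qed

lemma lz_integrands_measurable:
  "lzG kap \<in> borel_measurable lborel" "(\<lambda>t. cc * of_real t * lzG kap t) \<in> borel_measurable lborel"
  "(\<lambda>t. cc * of_real t * (cc * of_real t * lzG kap t)) \<in> borel_measurable lborel"
  by measurable

lemmas lz_transform =
  has_vector_derivative_exp_transform[OF lz_integrands_measurable(1) lzG_exp_integrable(1)]
  has_vector_derivative_exp_transform[OF lz_integrands_measurable(2) lzG_exp_integrable(2)]
  has_vector_derivative_exp_transform(1)[OF lz_integrands_measurable(3) lzG_exp_integrable(3)]

lemma lzF_derivs:
  assumes "kap > 0"
  shows "(lzF kap has_vector_derivative lzF1 kap x) (at x)"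
    and "(lzF1 kap has_vector_derivative lzF2 kap x) (at x)"
  unfolding lzF_def[abs_def] lzF1_def[abs_def] lzF2_def
  by (rule lz_transform[OF assms])+

text \<open>Up to a factor \<open>\<i>\<close>, the left side is the integral of the total
  derivative of t times the integrand of \<open>lzF\<close>, and the boundary values at infinity
  vanish.\<close>

lemma lzF_ode:
  assumes kap: "kap > 0"
  shows "lzF2 kap x + \<i> * of_real x * lzF1 kap x + (\<i> + of_real kap) * lzF kap x = 0"
proof -
  let ?e = "\<lambda>t::real. exp (cc * of_real x * of_real t)"
  define P where "P t = of_real t * (phi kap (of_real t) * exp (- (of_real t)\<^sup>2 / 2 + cc * of_real x * of_real t))" for t :: real
  define p where "p t = (1 - \<i> * of_real kap - of_real t * of_real t + cc * of_real x * of_real t)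
    * (lzG kap t * ?e t)" for t :: real
  have Peq: "P t = of_real t * (lzG kap t * ?e t)" for t
    unfolding P_def lzG_def exp_add by (simp add: exp_of_real[symmetric] mult_ac)
  have dP: "(P has_vector_derivative p t) (at t)" if "t \<noteq> 0" for t
  proof -
    have "((\<lambda>t. t * (phi kap t * exp (- t\<^sup>2 / 2 + cc * of_real x * t))) has_field_derivative
        (1 * (phi kap (of_real t) * exp (- (of_real t)\<^sup>2 / 2 + cc * of_real x * of_real t)) +
        ((- \<i> * of_real kap / of_real t * phi kap (of_real t)) * exp (- (of_real t)\<^sup>2 / 2 + cc * of_real x * of_real t)
        + (exp (- (of_real t)\<^sup>2 / 2 + cc * of_real x * of_real t) * (- of_real t + cc * of_real x)) * phi kap (of_real t)) * of_real t)) (at (of_real t))"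
      by (rule DERIV_mult DERIV_ident phi_has_field_derivative minus_i_times_notin_nonpos that)+
        (auto intro!: derivative_eq_intros)
    from has_vector_derivative_real_field[OF this]
    have "(P has_vector_derivative
        (1 * (phi kap (of_real t) * exp (- (of_real t)\<^sup>2 / 2 + cc * of_real x * of_real t)) +
        ((- \<i> * of_real kap / of_real t * phi kap (of_real t)) * exp (- (of_real t)\<^sup>2 / 2 + cc * of_real x * of_real t)
        + (exp (- (of_real t)\<^sup>2 / 2 + cc * of_real x * of_real t) * (- of_real t + cc * of_real x)) * phi kap (of_real t)) * of_real t)) (at t)"
      by (simp add: P_def[abs_def])
    then show ?thesis
    proof (rule has_vector_derivative_eq_rhs)
      have e: "lzG kap t * ?e t = phi kap (of_real t) * exp (- (of_real t)\<^sup>2 / 2 + cc * of_real x * of_real t)"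
        unfolding lzG_def exp_add by (simp add: exp_of_real[symmetric] mult_ac)
      show "(1 * (phi kap (of_real t) * exp (- (of_real t)\<^sup>2 / 2 + cc * of_real x * of_real t)) +
        ((- \<i> * of_real kap / of_real t * phi kap (of_real t)) * exp (- (of_real t)\<^sup>2 / 2 + cc * of_real x * of_real t)
        + (exp (- (of_real t)\<^sup>2 / 2 + cc * of_real x * of_real t) * (- of_real t + cc * of_real x)) * phi kap (of_real t)) * of_real t) = p t"
        unfolding p_def e using that by (simp add: algebra_simps)
    qed
  qed
  have Pbound: "cmod (P t) \<le> exp (pi * kap) * exp (- t\<^sup>2 / 2 + (\<bar>x\<bar> + 1) * \<bar>t\<bar>)" for t
  proof -
    have "Re (cc * of_real x * of_real t) \<le> \<bar>x\<bar> * \<bar>t\<bar>"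
      using complex_Re_le_cmod[of "cc * of_real x * of_real t"] by (simp add: norm_mult norm_cc)
    then have "cmod (?e t) \<le> exp (\<bar>x\<bar> * \<bar>t\<bar>)" by simp
    then have "\<bar>t\<bar> * (cmod (lzG kap t) * cmod (?e t)) \<le> exp \<bar>t\<bar> * ((exp (pi * kap) * exp (- t\<^sup>2 / 2)) * exp (\<bar>x\<bar> * \<bar>t\<bar>))"
      by (intro mult_mono abs_le_exp_abs norm_lzG kap) auto
    also have "\<dots> = exp (pi * kap) * exp (- t\<^sup>2 / 2 + (\<bar>x\<bar> + 1) * \<bar>t\<bar>)"
      by (simp add: exp_add[symmetric] algebra_simps)
    finally show ?thesis unfolding Peq by (simp add: norm_mult)
  qed
  \<comment> \<open>The factor \<open>t\<close> makes \<open>P\<close> continuous at the branch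
    point, so the fundamental theorem applies with the single exceptional point 0.\<close>
  have cont: "isCont P t" for t
  proof (cases "t = 0")
    case True
    have "(P \<longlongrightarrow> 0) (at 0)"
    proof (rule Lim_null_comparison)
      have "((\<lambda>t. \<bar>t\<bar> * (exp (pi * kap) * exp (- t\<^sup>2 / 2) * cmod (?e t))) \<longlongrightarrow> \<bar>0\<bar> * (exp (pi * kap) * exp (- 0\<^sup>2 / 2) * cmod (?e 0))) (at 0)"
        by (intro tendsto_intros) auto
      then show "((\<lambda>t. \<bar>t\<bar> * (exp (pi * kap) * exp (- t\<^sup>2 / 2) * cmod (?e t))) \<longlongrightarrow> 0) (at 0)" by simp
      show "\<forall>\<^sub>F t in at 0. norm (P t) \<le> \<bar>t\<bar> * (exp (pi * kap) * exp (- t\<^sup>2 / 2) * cmod (?e t))"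
        unfolding Peq norm_mult
        by (intro always_eventually allI mult_mono norm_lzG kap) auto
    qed
    then show ?thesis using True by (simp add: isCont_def Peq)
  next
    case False
    then show ?thesis using dP has_vector_derivative_continuous by blast
  qed
  have FTC: "(p has_integral (P (real n) - P (- real n))) {- real n..real n}" for n
    by (rule fundamental_theorem_of_calculus_interior_strong[of "{0}"])
      (use dP cont in \<open>auto intro: continuous_at_imp_continuous_on\<close>)
  have pexp: "p t = (1 - \<i> * of_real kap) * (lzG kap t * ?e t)
      - \<i> * ((cc * of_real t * (cc * of_real t * lzG kap t)) * ?e t)
      + of_real x * ((cc * of_real t * lzG kap t) * ?e t)" for t
  proof -
    have "of_real t * of_real t = \<i> * (cc * of_real t * (cc * of_real t))"
      using cc_sq by (simp add: algebra_simps)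
    then show ?thesis unfolding p_def by (auto simp: algebra_simps)
  qed
  note ints = lz_transform(1,3,5)[OF kap, of cc x]
  have int_p: "integrable lborel p"
    unfolding pexp[abs_def]
    by (intro Bochner_Integration.integrable_add Bochner_Integration.integrable_diff integrable_mult_right ints)
  have I: "(\<integral>t. p t \<partial>lborel) = (1 - \<i> * of_real kap) * lzF kap x - \<i> * lzF2 kap x + of_real x * lzF1 kap x"
    unfolding pexp lzF_def lzF1_def lzF2_def
    using ints by (simp add: Bochner_Integration.integral_add Bochner_Integration.integral_diff)
  have l1: "(\<lambda>n. P (real n) - P (- real n)) \<longlonglongrightarrow> (\<integral>t. p t \<partial>lborel)"
    by (rule has_integral_truncations_tendsto[OF int_p FTC])
  have l2: "(\<lambda>n. P (real n) - P (- real n)) \<longlonglongrightarrow> 0 - 0"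
  proof (intro tendsto_diff)
    have lim: "(\<lambda>n. exp (pi * kap) * exp (- (y n)\<^sup>2 / 2 + (\<bar>x\<bar> + 1) * \<bar>y n\<bar>)) \<longlonglongrightarrow> 0"
      if "filterlim y at_top sequentially \<or> filterlim y at_bot sequentially" for y :: "nat \<Rightarrow> real"
      using that filterlim_compose[OF gaussian_exp_abs_tendsto_0(1)] filterlim_compose[OF gaussian_exp_abs_tendsto_0(2)]
      by (intro tendsto_mult_right_zero) blast
    have n: "filterlim real at_top sequentially" "filterlim (\<lambda>n. - real n) at_bot sequentially"
      by (rule filterlim_real_sequentially,
          rule filterlim_compose[OF filterlim_uminus_at_bot_at_top filterlim_real_sequentially])
    show "(\<lambda>n. P (real n)) \<longlonglongrightarrow> 0"
      using n by (intro Lim_null_comparison[OF always_eventually[OF allI[OF Pbound]] lim]) blast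
    show "(\<lambda>n. P (- real n)) \<longlonglongrightarrow> 0"
      using n by (intro Lim_null_comparison[OF always_eventually[OF allI[OF Pbound]] lim]) blast
  qed
  have "(1 - \<i> * of_real kap) * lzF kap x - \<i> * lzF2 kap x + of_real x * lzF1 kap x = 0"
    using LIMSEQ_unique[OF l1 l2] unfolding I by simp
  then have "\<i> * ((1 - \<i> * of_real kap) * lzF kap x - \<i> * lzF2 kap x + of_real x * lzF1 kap x) = 0" by simp
  then show ?thesis by (simp add: algebra_simps)
qed

text \<open>The exponent \<open>- t^2 / 2 + a * t\<close> has its saddle point at \<open>a\<close>,
  which lies in the upper half plane. Moving the line through it and completing the square leaves a
  real centred Gaussian. The case \<open>n = 1\<close> is for the combination that defines the
  second spinor component.\<close>

lemma lz_shift: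
  assumes kap: "kap > 0" and X: "X > 0" and n: "n \<le> 1"
  defines "a \<equiv> Complex (- X) X"
  shows "(\<integral>u. (of_real u - a) ^ n * (lzG kap u * exp (a * of_real u)) \<partial>lborel)
     = exp (a\<^sup>2 / 2) * (\<integral>v. of_real v ^ n * (phi kap (a + of_real v) * of_real (exp (- v\<^sup>2 / 2))) \<partial>lborel)"
proof -
  define h where "h t = (t - a) ^ n * (phi kap t * exp (- t\<^sup>2 / 2 + a * t))" for t
  have hr: "h (of_real u) = (of_real u - a) ^ n * (lzG kap u * exp (a * of_real u))" for u
    unfolding h_def lzG_def exp_add by (simp add: exp_of_real[symmetric] mult_ac)
  define K where "K u = (1 + 3 * X) * exp (pi * kap) * exp (X\<^sup>2 / 2) * exp (- u\<^sup>2 / 2 + (X + 1) * \<bar>u\<bar>)" for u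
  have "(\<integral>u. h (of_real u) \<partial>lborel) = (\<integral>u. h (Complex u X) \<partial>lborel)"
  proof (rule integral_shift_upper_half_plane[OF _ X])
    have "phi kap holomorphic_on {z. 0 < Im z}"
      using phi_has_field_derivative[OF minus_i_times_notin_nonpos(1)]
      by (intro holomorphic_onI) (auto simp: field_differentiable_def intro: has_field_derivative_at_within)
    then show "h holomorphic_on {z. 0 < Im z}"
      unfolding h_def[abs_def] by (intro holomorphic_intros) auto
    show "(\<lambda>u. h (of_real u)) \<in> borel_measurable lborel" unfolding hr by measurable
    show "cmod (h (Complex u y)) \<le> K u" if y: "0 \<le> y" "y \<le> X" for u y
    proof -
      let ?t = "Complex u y"
      have "cmod (?t - a) \<le> \<bar>u + X\<bar> + \<bar>y - X\<bar>"
        using cmod_le[of "?t - a"] by (simp add: a_def)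
      also have "\<dots> \<le> exp \<bar>u\<bar> + 3 * X * 1" using abs_le_exp_abs[of u] y X by linarith
      also have "\<dots> \<le> exp \<bar>u\<bar> + 3 * X * exp \<bar>u\<bar>" using X by (intro add_left_mono mult_left_mono) auto
      also have "\<dots> = (1 + 3 * X) * exp \<bar>u\<bar>" by (simp add: algebra_simps)
      finally have 1: "cmod (?t - a) \<le> (1 + 3 * X) * exp \<bar>u\<bar>" .
      have "1 * 1 \<le> (1 + 3 * X) * exp \<bar>u\<bar>" using X by (intro mult_mono) auto
      with 1 n have 2: "cmod (?t - a) ^ n \<le> (1 + 3 * X) * exp \<bar>u\<bar>"
        by (cases n) auto
      have "Re (- ?t\<^sup>2 / 2 + a * ?t) = - u\<^sup>2 / 2 + y\<^sup>2 / 2 - X * u - X * y"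
        by (simp add: a_def power2_eq_square algebra_simps diff_divide_distrib)
      also have "\<dots> \<le> X\<^sup>2 / 2 + (- u\<^sup>2 / 2 + X * \<bar>u\<bar>)"
      proof -
        have "y\<^sup>2 \<le> X\<^sup>2" using y by (intro power_mono) auto
        moreover have "- (X * u) \<le> X * \<bar>u\<bar>" using X by (simp add: abs_if)
        moreover have "0 \<le> X * y" using X y by simp
        ultimately show ?thesis by linarith
      qed
      finally have 3: "cmod (exp (- ?t\<^sup>2 / 2 + a * ?t)) \<le> exp (X\<^sup>2 / 2 + (- u\<^sup>2 / 2 + X * \<bar>u\<bar>))"
        by (simp only: norm_exp_eq_Re exp_le_cancel_iff)
      have "cmod (h ?t) \<le> ((1 + 3 * X) * exp \<bar>u\<bar>) * (exp (pi * kap) * exp (X\<^sup>2 / 2 + (- u\<^sup>2 / 2 + X * \<bar>u\<bar>)))"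
        unfolding h_def norm_mult norm_power
        using X y by (intro mult_mono 2 3 norm_phi kap) auto
      also have "\<dots> = K u"
        unfolding K_def exp_add by (simp add: distrib_right exp_add)
      finally show ?thesis .
    qed
    show "integrable lborel K"
      unfolding K_def by (intro integrable_mult_right integrable_gaussian_exp_abs)
    show "(K \<longlongrightarrow> 0) at_top"
      unfolding K_def by (rule tendsto_mult_right_zero, rule gaussian_exp_abs_tendsto_0)
    show "(K \<longlongrightarrow> 0) at_bot"
      unfolding K_def by (rule tendsto_mult_right_zero, rule gaussian_exp_abs_tendsto_0)
    show "((\<lambda>y. h (Complex u y)) \<longlongrightarrow> h (of_real u)) (at_right 0)" if "u \<noteq> 0" for u
    proof -
      have "isCont (phi kap) (of_real u)"
        using phi_has_field_derivative[OF minus_i_times_notin_nonpos(2)[OF that]] by (rule DERIV_isCont)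
      then have "isCont h (of_real u)" unfolding h_def[abs_def] by (intro continuous_intros) auto
      moreover have "((\<lambda>y. Complex u y) \<longlongrightarrow> Complex u 0) (at_right 0)" by (intro tendsto_intros)
      ultimately show ?thesis unfolding complex_of_real_def by (rule isCont_tendsto_compose)
    qed
  qed
  also have "\<dots> = (\<integral>v. h (Complex (- X + v) X) \<partial>lborel)"
    using lborel_integral_real_affine[of 1 "\<lambda>u. h (Complex u X)" "- X"] by simp
  also have "\<dots> = (\<integral>v. exp (a\<^sup>2 / 2) * (of_real v ^ n * (phi kap (a + of_real v) * of_real (exp (- v\<^sup>2 / 2)))) \<partial>lborel)"
  proof (rule Bochner_Integration.integral_cong[OF refl])
    fix v :: real
    have t: "Complex (- X + v) X = a + of_real v" by (simp add: a_def complex_eq_iff)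
    have e: "- (a + of_real v)\<^sup>2 / 2 + a * (a + of_real v) = a\<^sup>2 / 2 + of_real (- v\<^sup>2 / 2)"
      by (simp add: power2_eq_square field_simps)
    show "h (Complex (- X + v) X) = exp (a\<^sup>2 / 2) * (of_real v ^ n * (phi kap (a + of_real v) * of_real (exp (- v\<^sup>2 / 2))))"
      unfolding h_def t e exp_add exp_of_real by (simp add: mult_ac)
  qed
  finally show ?thesis unfolding hr by simp
qed

text \<open>The logarithmic derivative of \<open>phi\<close> is at most \<open>kap / X\<close> at
  height X, so far before the crossing \<open>phi\<close> is nearly constant on the width of the
  Gaussian.\<close>

lemma phi_lipschitz:
  assumes kap: "kap > 0" and X: "X > 0"
  shows "cmod (phi kap (Complex (- X) X + of_real v) - phi kap (Complex (- X) X)) \<le> kap * exp (pi * kap) / X * \<bar>v\<bar>"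
proof -
  let ?S = "{z. Im z = X}"
  have "cmod (phi kap (Complex (- X) X + of_real v) - phi kap (Complex (- X) X))
     \<le> kap * exp (pi * kap) / X * cmod (Complex (- X) X + of_real v - Complex (- X) X)"
  proof (rule field_differentiable_bound[of ?S])
    show "convex ?S" by (auto simp: convex_def simp flip: distrib_right)
    fix z assume z: "z \<in> ?S"
    then have "Im z > 0" using X by simp
    then show "(phi kap has_field_derivative - \<i> * of_real kap / z * phi kap z) (at z within ?S)"
      by (intro has_field_derivative_at_within[OF phi_has_field_derivative] minus_i_times_notin_nonpos)
    have "X \<le> cmod z" using z abs_Im_le_cmod[of z] by simp
    then have "kap / cmod z \<le> kap / X" using kap X by (intro divide_left_mono mult_pos_pos) auto
    then have "kap / cmod z * cmod (phi kap z) \<le> kap / X * exp (pi * kap)"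
      using kap X \<open>Im z > 0\<close> by (intro mult_mono norm_phi) auto
    then show "cmod (- \<i> * of_real kap / z * phi kap z) \<le> kap * exp (pi * kap) / X"
      using kap by (simp add: norm_mult norm_divide)
  qed auto
  then show ?thesis by simp
qed

text \<open>The second spinor component, obtained by solving the first equation of the two-level
  system for it.\<close>

definition lzD :: "real \<Rightarrow> real \<Rightarrow> complex" where
  "lzD kap x = \<i> / of_real (sqrt kap) * (lzF1 kap x + \<i> * of_real x * lzF kap x)"

text \<open>After the shift, \<open>phi\<close> may be replaced by its value at the saddle point up
  to O(\<open>1 / X\<close>). The zeroth Gaussian moment together with
  \<open>cmod phi \<ge> 1\<close> bounds the first component from below; the first moment vanishes,
  so the second component is O(\<open>1 / X\<close>).\<close>

lemma lz_before_crossing: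
  assumes kap: "kap > 0" and X: "X > 0"
  shows "sqrt (2 * pi) - kap * exp (pi * kap) / X * (\<integral>v. \<bar>v\<bar> * exp (- v\<^sup>2 / 2) \<partial>lborel) \<le> cmod (lzF kap (- sqrt 2 * X))"
    and "cmod (lzF1 kap (- sqrt 2 * X) + \<i> * of_real (- sqrt 2 * X) * lzF kap (- sqrt 2 * X))
      \<le> kap * exp (pi * kap) / X * (\<integral>v. v\<^sup>2 * exp (- v\<^sup>2 / 2) \<partial>lborel)"
proof -
  define a where "a = Complex (- X) X"
  define c where "c = kap * exp (pi * kap) / X"
  have a: "cc * of_real (- sqrt 2 * X) = a"
    by (simp add: cc_def a_def complex_eq_iff)
  \<comment> \<open>\<open>a^2\<close> is purely imaginary, so the prefactor from completing the
    square has modulus 1.\<close>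
  have "Re (a\<^sup>2 / 2) = 0" by (simp add: a_def power2_eq_square)
  then have ea: "cmod (exp (a\<^sup>2 / 2)) = 1" by simp
  let ?e = "\<lambda>v::real. complex_of_real (exp (- v\<^sup>2 / 2))"
  define d where "d v = phi kap (a + of_real v) - phi kap a" for v :: real
  have d: "cmod (d v) \<le> c * \<bar>v\<bar>" for v
    using phi_lipschitz[OF kap X, of v] by (simp add: d_def a_def c_def)
  have [measurable]: "d \<in> borel_measurable borel"
  proof -
    have "isCont d v" for v
    proof -
      have "Im (a + of_real v) > 0" using X by (simp add: a_def)
      from DERIV_isCont[OF phi_has_field_derivative[OF minus_i_times_notin_nonpos(1)[OF this]]]
      have "isCont (phi kap) (a + of_real v)" .
      then have "isCont (\<lambda>v. phi kap (a + of_real v)) v"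
        by (rule isCont_o2[rotated]) (intro continuous_intros)
      then show ?thesis unfolding d_def by (intro continuous_intros)
    qed
    then show ?thesis by (intro borel_measurable_continuous_onI continuous_at_imp_continuous_on) auto
  qed
  have int: "integrable lborel (\<lambda>v. of_real v ^ n * (d v * ?e v))"
      "cmod (\<integral>v. of_real v ^ n * (d v * ?e v) \<partial>lborel) \<le> c * (\<integral>v. \<bar>v\<bar> ^ Suc n * exp (- v\<^sup>2 / 2) \<partial>lborel)"
    if n: "n \<le> 1" for n
  proof -
    have I: "integrable lborel (\<lambda>v::real. \<bar>v\<bar> ^ Suc n * exp (- v\<^sup>2 / 2))"
      using n gaussian_moments(5,6) by (cases n) (auto simp: power2_eq_square)
    have b: "cmod (of_real v ^ n * (d v * ?e v)) \<le> c * (\<bar>v\<bar> ^ Suc n * exp (- v\<^sup>2 / 2))" for v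
      using mult_right_mono[OF d[of v], of "\<bar>v\<bar> ^ n * exp (- v\<^sup>2 / 2)"] by (simp add: norm_mult norm_power mult_ac)
    show int: "integrable lborel (\<lambda>v. of_real v ^ n * (d v * ?e v))"
    proof (rule Bochner_Integration.integrable_bound[OF integrable_mult_right[OF I, of c]])
      show "AE v in lborel. norm (of_real v ^ n * (d v * ?e v)) \<le> norm (c * (\<bar>v\<bar> ^ Suc n * exp (- v\<^sup>2 / 2)))"
        unfolding real_norm_def by (intro AE_I2 order_trans[OF b abs_ge_self])
    qed measurable
    have "cmod (\<integral>v. of_real v ^ n * (d v * ?e v) \<partial>lborel) \<le> (\<integral>v. c * (\<bar>v\<bar> ^ Suc n * exp (- v\<^sup>2 / 2)) \<partial>lborel)"
      by (rule Bochner_Integration.integral_norm_bound_integral[OF int integrable_mult_right[OF I] b])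
    then show "cmod (\<integral>v. of_real v ^ n * (d v * ?e v) \<partial>lborel) \<le> c * (\<integral>v. \<bar>v\<bar> ^ Suc n * exp (- v\<^sup>2 / 2) \<partial>lborel)"
      by simp
  qed
  have split: "(\<integral>v. of_real v ^ n * (phi kap (a + of_real v) * ?e v) \<partial>lborel)
      = phi kap a * (\<integral>v. of_real v ^ n * ?e v \<partial>lborel) + (\<integral>v. of_real v ^ n * (d v * ?e v) \<partial>lborel)"
    if n: "n \<le> 1" for n
  proof -
    have "integrable lborel (\<lambda>v. complex_of_real (v ^ n * exp (- v\<^sup>2 / 2)))"
      using n gaussian_moments(1,3) by (cases n) (auto simp del: of_real_mult)
    then have "integrable lborel (\<lambda>v. phi kap a * (of_real v ^ n * ?e v))"
      by (intro integrable_mult_right) simp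
    from Bochner_Integration.integral_add[OF this int(1)[OF n]]
    show ?thesis by (simp add: d_def algebra_simps)
  qed
  have F: "lzF kap (- sqrt 2 * X) = exp (a\<^sup>2 / 2) * (\<integral>v. phi kap (a + of_real v) * ?e v \<partial>lborel)"
    using lz_shift[OF kap X, of 0] unfolding lzF_def a a_def[symmetric] by simp
  have m0: "(\<integral>v. ?e v \<partial>lborel) = of_real (sqrt (2 * pi))"
    using gaussian_moments(2) by simp
  have m1: "(\<integral>v. of_real v * ?e v \<partial>lborel) = 0"
    using gaussian_moments(4) by (simp flip: of_real_mult)
  have "cmod (lzF kap (- sqrt 2 * X)) = cmod (phi kap a * of_real (sqrt (2 * pi)) + (\<integral>v. d v * ?e v \<partial>lborel))"
    using split[of 0] unfolding F norm_mult ea power_0 mult_1 m0 by simp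
  then have "cmod (phi kap a) * sqrt (2 * pi) - cmod (\<integral>v. d v * ?e v \<partial>lborel) \<le> cmod (lzF kap (- sqrt 2 * X))"
    using norm_diff_ineq[of "phi kap a * of_real (sqrt (2 * pi))" "\<integral>v. d v * ?e v \<partial>lborel"]
    by (simp add: norm_mult)
  moreover have "1 * sqrt (2 * pi) \<le> cmod (phi kap a) * sqrt (2 * pi)"
    using X by (intro mult_right_mono norm_phi kap) (auto simp: a_def)
  moreover have "cmod (\<integral>v. d v * ?e v \<partial>lborel) \<le> c * (\<integral>v. \<bar>v\<bar> * exp (- v\<^sup>2 / 2) \<partial>lborel)"
    using int(2)[of 0] by simp
  ultimately show "sqrt (2 * pi) - kap * exp (pi * kap) / X * (\<integral>v. \<bar>v\<bar> * exp (- v\<^sup>2 / 2) \<partial>lborel) \<le> cmod (lzF kap (- sqrt 2 * X))"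
    unfolding c_def by linarith
  have "lzF1 kap (- sqrt 2 * X) + \<i> * of_real (- sqrt 2 * X) * lzF kap (- sqrt 2 * X)
      = cc * (\<integral>u. (of_real u - a) ^ 1 * (lzG kap u * exp (a * of_real u)) \<partial>lborel)"
  proof -
    \<comment> \<open>From \<open>cc * x = a\<close> and \<open>cc^2 = - \<i>\<close>; it turns the
      factor \<open>cc * u + \<i> * x\<close> of the integrand into
      \<open>cc * (u - a)\<close>.\<close>
    have ic: "\<i> * of_real (- sqrt 2 * X) = - (cc * a)"
      unfolding a[symmetric] using cc_sq by (metis (no_types, lifting) mult.assoc mult_minus_left minus_minus)
    have "cc * ((of_real u - a) ^ 1 * (lzG kap u * exp (a * of_real u)))
      = (cc * of_real u * lzG kap u) * exp (a * of_real u) + \<i> * of_real (- sqrt 2 * X) * (lzG kap u * exp (a * of_real u))" for u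
      unfolding ic by (simp add: algebra_simps)
    then have "cc * (\<integral>u. (of_real u - a) ^ 1 * (lzG kap u * exp (a * of_real u)) \<partial>lborel)
      = (\<integral>u. (cc * of_real u * lzG kap u) * exp (a * of_real u) + \<i> * of_real (- sqrt 2 * X) * (lzG kap u * exp (a * of_real u)) \<partial>lborel)"
      by (simp only: integral_mult_right_zero[symmetric])
    also have "\<dots> = (\<integral>u. (cc * of_real u * lzG kap u) * exp (a * of_real u) \<partial>lborel)
        + \<i> * of_real (- sqrt 2 * X) * (\<integral>u. lzG kap u * exp (a * of_real u) \<partial>lborel)"
      using lz_transform(1,3)[OF kap, of cc "- sqrt 2 * X"] unfolding a
      by (subst Bochner_Integration.integral_add) auto
    finally show ?thesis unfolding lzF_def lzF1_def a by simp
  qed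
  also have "\<dots> = cc * (exp (a\<^sup>2 / 2) * (\<integral>v. of_real v ^ 1 * (phi kap (a + of_real v) * ?e v) \<partial>lborel))"
    using lz_shift[OF kap X, of 1] unfolding a_def[symmetric] by simp
  also have "cmod \<dots> = cmod (\<integral>v. of_real v ^ 1 * (d v * ?e v) \<partial>lborel)"
    using split[of 1] unfolding norm_mult ea norm_cc power_one_right m1 by simp
  also have "\<dots> \<le> c * (\<integral>v. v\<^sup>2 * exp (- v\<^sup>2 / 2) \<partial>lborel)"
    using int(2)[of 1] by (simp add: power2_eq_square)
  finally show "cmod (lzF1 kap (- sqrt 2 * X) + \<i> * of_real (- sqrt 2 * X) * lzF kap (- sqrt 2 * X))
      \<le> kap * exp (pi * kap) / X * (\<integral>v. v\<^sup>2 * exp (- v\<^sup>2 / 2) \<partial>lborel)"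
    unfolding c_def .
qed

section \<open>Bloch vectors in the rotating frame of the instantaneous eigenbasis\<close>

definition bloch_solution ::
    "real \<Rightarrow> (real \<Rightarrow> real) \<Rightarrow> real \<Rightarrow> real set \<Rightarrow> (real \<Rightarrow> real) \<Rightarrow> (real \<Rightarrow> real) \<Rightarrow> (real \<Rightarrow> real) \<Rightarrow> bool" where
  "bloch_solution g gam eps S r1 r2 r3 \<longleftrightarrow> (\<forall>s\<in>S.
     (r1 has_real_derivative (- s * r2 s - gam s * inverse (om g s) * (s\<^sup>2 * r1 s - g * s * r3 s)) / eps) (at s within S) \<and>
     (r2 has_real_derivative (s * r1 s - g * r3 s - gam s * inverse (om g s) * (s\<^sup>2 + g\<^sup>2) * r2 s) / eps) (at s within S) \<and>
     (r3 has_real_derivative (g * r2 s - gam s * inverse (om g s) * (g\<^sup>2 * r3 s - g * s * r1 s)) / eps) (at s within S))"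

definition frame_z :: "real \<Rightarrow> (real \<Rightarrow> real) \<Rightarrow> (real \<Rightarrow> real) \<Rightarrow> real \<Rightarrow> real" where
  "frame_z g r1 r3 s = (g * r1 s + s * r3 s) * inverse (om g s)"

definition frame_w :: "real \<Rightarrow> (real \<Rightarrow> real) \<Rightarrow> (real \<Rightarrow> real) \<Rightarrow> (real \<Rightarrow> real) \<Rightarrow> real \<Rightarrow> complex" where
  "frame_w g r1 r2 r3 s = Complex ((g * r3 s - s * r1 s) * inverse (om g s)) (- r2 s)"

lemma inverse_om_sq: "g > 0 \<Longrightarrow> (inverse (om g s))\<^sup>2 * (s\<^sup>2 + g\<^sup>2) = 1"
  using om_pos[of g s] by (simp add: om_sq[symmetric] power_inverse)

lemma om_eq: "g > 0 \<Longrightarrow> om g s = inverse (om g s) * (s\<^sup>2 + g\<^sup>2)"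
  using om_pos[of g s] unfolding om_sq[symmetric] by (simp add: power2_eq_square)

lemma frame_norm:
  assumes "g > 0"
  shows "(frame_z g r1 r3 s)\<^sup>2 + (cmod (frame_w g r1 r2 r3 s))\<^sup>2 = (r1 s)\<^sup>2 + (r2 s)\<^sup>2 + (r3 s)\<^sup>2"
proof -
  have "(frame_z g r1 r3 s)\<^sup>2 + (cmod (frame_w g r1 r2 r3 s))\<^sup>2
     = ((inverse (om g s))\<^sup>2 * (s\<^sup>2 + g\<^sup>2)) * ((r1 s)\<^sup>2 + (r3 s)\<^sup>2) + (r2 s)\<^sup>2"
    unfolding frame_z_def frame_w_def cmod_power2 by (simp add: power2_eq_square algebra_simps)
  then show ?thesis using inverse_om_sq[OF assms] by simp
qed

lemma bloch_imp_adiabatic: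
  assumes sol: "bloch_solution g gam eps S r1 r2 r3" and g: "g > 0"
  shows "adiabatic_solution g gam eps S (frame_z g r1 r3) (frame_w g r1 r2 r3)"
  unfolding adiabatic_solution_def
proof (intro ballI conjI)
  fix s assume s: "s \<in> S"
  define v where "v = inverse (om g s)"
  define e where "e = inverse eps"
  have v1: "v\<^sup>2 * (s\<^sup>2 + g\<^sup>2) = 1" unfolding v_def by (rule inverse_om_sq[OF g])
  \<comment> \<open>With \<open>om\<close> rewritten, all derivative identities below are polynomial
    and hold modulo the single relation \<open>v1\<close>.\<close>
  have om: "om g s = v * (s\<^sup>2 + g\<^sup>2)" unfolding v_def by (rule om_eq[OF g])
  have d1: "(r1 has_real_derivative (- s * r2 s - gam s * v * (s\<^sup>2 * r1 s - g * s * r3 s)) * e) (at s within S)"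
    and d2: "(r2 has_real_derivative (s * r1 s - g * r3 s - gam s * v * (s\<^sup>2 + g\<^sup>2) * r2 s) * e) (at s within S)"
    and d3: "(r3 has_real_derivative (g * r2 s - gam s * v * (g\<^sup>2 * r3 s - g * s * r1 s)) * e) (at s within S)"
    using sol s by (auto simp: bloch_solution_def v_def e_def divide_inverse)
  have dv: "((\<lambda>s. inverse (om g s)) has_real_derivative - (s * v ^ 3)) (at s within S)"
    unfolding v_def by (rule DERIV_inverse_om[OF g])
  have dz: "(frame_z g r1 r3 has_real_derivative g * v\<^sup>2 * ((g * r3 s - s * r1 s) * v)) (at s within S)"
  proof -
    have "(frame_z g r1 r3 has_real_derivative
       (g * ((- s * r2 s - gam s * v * (s\<^sup>2 * r1 s - g * s * r3 s)) * e)
        + (1 * r3 s + (g * r2 s - gam s * v * (g\<^sup>2 * r3 s - g * s * r1 s)) * e * s)) * inverse (om g s)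
        + - (s * v ^ 3) * (g * r1 s + s * r3 s)) (at s within S)"
      unfolding frame_z_def[abs_def] by (intro DERIV_mult DERIV_add DERIV_cmult DERIV_ident d1 d3 dv)
    moreover have "(g * ((- s * r2 s - gam s * v * (s\<^sup>2 * r1 s - g * s * r3 s)) * e)
        + (1 * r3 s + (g * r2 s - gam s * v * (g\<^sup>2 * r3 s - g * s * r1 s)) * e * s)) * v
        + - (s * v ^ 3) * (g * r1 s + s * r3 s) = g * v\<^sup>2 * ((g * r3 s - s * r1 s) * v)"
      using v1 by algebra
    ultimately show ?thesis by (simp add: v_def)
  qed
  then show "(frame_z g r1 r3 has_real_derivative g * (inverse (om g s))\<^sup>2 * Re (frame_w g r1 r2 r3 s)) (at s within S)"
    by (simp add: frame_w_def v_def)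
  have du: "((\<lambda>s. (g * r3 s - s * r1 s) * inverse (om g s)) has_real_derivative
      - (g * v\<^sup>2 * ((g * r1 s + s * r3 s) * v)) + om g s * e * (r2 s - gam s * ((g * r3 s - s * r1 s) * v))) (at s within S)"
  proof -
    have "((\<lambda>s. (g * r3 s - s * r1 s) * inverse (om g s)) has_real_derivative
       (g * ((g * r2 s - gam s * v * (g\<^sup>2 * r3 s - g * s * r1 s)) * e)
        - (1 * r1 s + (- s * r2 s - gam s * v * (s\<^sup>2 * r1 s - g * s * r3 s)) * e * s)) * inverse (om g s)
        + - (s * v ^ 3) * (g * r3 s - s * r1 s)) (at s within S)"
      by (intro DERIV_mult DERIV_diff DERIV_cmult DERIV_ident d1 d3 dv)
    moreover have "(g * ((g * r2 s - gam s * v * (g\<^sup>2 * r3 s - g * s * r1 s)) * e)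
        - (1 * r1 s + (- s * r2 s - gam s * v * (s\<^sup>2 * r1 s - g * s * r3 s)) * e * s)) * v
        + - (s * v ^ 3) * (g * r3 s - s * r1 s)
       = - (g * v\<^sup>2 * ((g * r1 s + s * r3 s) * v)) + om g s * e * (r2 s - gam s * ((g * r3 s - s * r1 s) * v))"
      unfolding om using v1 by algebra
    ultimately show ?thesis by (simp add: v_def)
  qed
  have dy: "((\<lambda>s. - r2 s) has_real_derivative om g s * e * ((g * r3 s - s * r1 s) * v + gam s * r2 s)) (at s within S)"
  proof -
    have "- ((s * r1 s - g * r3 s - gam s * v * (s\<^sup>2 + g\<^sup>2) * r2 s) * e)
        = om g s * e * ((g * r3 s - s * r1 s) * v + gam s * r2 s)"
      unfolding om using v1 by algebra
    with DERIV_minus[OF d2] show ?thesis by simp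
  qed
  have "(frame_w g r1 r2 r3 has_vector_derivative
      Complex (- (g * v\<^sup>2 * ((g * r1 s + s * r3 s) * v)) + om g s * e * (r2 s - gam s * ((g * r3 s - s * r1 s) * v)))
        (om g s * e * ((g * r3 s - s * r1 s) * v + gam s * r2 s))) (at s within S)"
    unfolding frame_w_def[abs_def] Complex_eq
    by (intro has_vector_derivative_add has_vector_derivative_mult_right has_vector_derivative_of_real du dy)
  then show "(frame_w g r1 r2 r3 has_vector_derivative
      (- of_real (g * (inverse (om g s))\<^sup>2 * frame_z g r1 r3 s)
        + of_real (om g s / eps) * (\<i> - of_real (gam s)) * frame_w g r1 r2 r3 s)) (at s within S)"
  proof (rule has_vector_derivative_eq_rhs)
    have "om g s / eps = om g s * e" by (simp add: e_def divide_inverse)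
    then show "Complex (- (g * v\<^sup>2 * ((g * r1 s + s * r3 s) * v)) + om g s * e * (r2 s - gam s * ((g * r3 s - s * r1 s) * v)))
        (om g s * e * ((g * r3 s - s * r1 s) * v + gam s * r2 s))
      = - of_real (g * (inverse (om g s))\<^sup>2 * frame_z g r1 r3 s)
        + of_real (om g s / eps) * (\<i> - of_real (gam s)) * frame_w g r1 r2 r3 s"
      unfolding frame_z_def frame_w_def v_def[symmetric] complex_eq_iff by (simp add: algebra_simps)
  qed
qed

text \<open>The field direction tends to \<open>(0, 0, 1)\<close> at plus infinity and to
  \<open>(0, 0, - 1)\<close> at minus infinity, hence the sign in the second limit.\<close>

lemma adiabatic_limits:
  assumes g: "g > 0"
    and b: "\<And>s. \<bar>r1 s\<bar> \<le> 1" "\<And>s. \<bar>r3 s\<bar> \<le> 1"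
  shows "(r3 \<longlongrightarrow> l) at_top \<Longrightarrow> (frame_z g r1 r3 \<longlongrightarrow> l) at_top"
    and "(r3 \<longlongrightarrow> l) at_bot \<Longrightarrow> (frame_z g r1 r3 \<longlongrightarrow> - l) at_bot"
    and "(r1 \<longlongrightarrow> 0) at_bot \<Longrightarrow> (r2 \<longlongrightarrow> 0) at_bot \<Longrightarrow> (frame_w g r1 r2 r3 \<longlongrightarrow> 0) at_bot"
proof -
  have v: "((\<lambda>s. g * inverse (om g s)) \<longlongrightarrow> 0) at_top" "((\<lambda>s. g * inverse (om g s)) \<longlongrightarrow> 0) at_bot"
    unfolding om_def using g by real_asymp+
  have s: "((\<lambda>s. s * inverse (om g s)) \<longlongrightarrow> 1) at_top" "((\<lambda>s. s * inverse (om g s)) \<longlongrightarrow> - 1) at_bot"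
    unfolding om_def using g by real_asymp+
  have bz: "((\<lambda>s. g * inverse (om g s) * r s) \<longlongrightarrow> 0) F"
    if "\<And>s. \<bar>r s\<bar> \<le> 1" "((\<lambda>s. g * inverse (om g s)) \<longlongrightarrow> 0) F" for r F
  proof (rule Lim_null_comparison[OF _ tendsto_rabs_zero[OF that(2)]])
    show "\<forall>\<^sub>F s in F. norm (g * inverse (om g s) * r s) \<le> \<bar>g * inverse (om g s)\<bar>"
      using that(1) by (intro always_eventually allI) (simp add: abs_mult mult_left_le)
  qed
  have z: "frame_z g r1 r3 = (\<lambda>s. g * inverse (om g s) * r1 s + s * inverse (om g s) * r3 s)"
    by (simp add: fun_eq_iff frame_z_def algebra_simps)
  show "(frame_z g r1 r3 \<longlongrightarrow> l) at_top" if "(r3 \<longlongrightarrow> l) at_top"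
    using tendsto_add[OF bz[OF b(1) v(1)] tendsto_mult[OF s(1) that]] unfolding z by simp
  show "(frame_z g r1 r3 \<longlongrightarrow> - l) at_bot" if "(r3 \<longlongrightarrow> l) at_bot"
    using tendsto_add[OF bz[OF b(1) v(2)] tendsto_mult[OF s(2) that]] unfolding z by simp
  show "(frame_w g r1 r2 r3 \<longlongrightarrow> 0) at_bot" if "(r1 \<longlongrightarrow> 0) at_bot" "(r2 \<longlongrightarrow> 0) at_bot"
  proof -
    have "((\<lambda>s. Complex (g * inverse (om g s) * r3 s - s * inverse (om g s) * r1 s) (- r2 s)) \<longlongrightarrow> Complex (0 - (- 1) * 0) (- 0)) at_bot"
      by (intro tendsto_Complex tendsto_diff tendsto_minus tendsto_mult bz b v s that)
    then show ?thesis unfolding frame_w_def[abs_def] by (simp add: algebra_simps zero_complex.code)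
  qed
qed

text \<open>
  \<open>phi kap (- u) = exp (pi kap) * phi kap u\<close> for \<open>u > 0\<close>, so only the decaying half of the contour
  survives. This is where the factor \<open>exp (- 2 pi kap)\<close> in the transition probability comes from.
\<close>

lemma lzF_reflection:
  assumes kap: "kap > 0"
  shows "((\<lambda>x. lzF kap x - lzF kap (- x) / of_real (exp (pi * kap))) \<longlongrightarrow> 0) at_top"
proof -
  define q where "q = exp (pi * kap)"
  define E where "E t = lzG kap t - lzG kap (- t) / of_real q" for t
  have q: "q \<ge> 1" using kap by (simp add: q_def)
  have [measurable]: "E \<in> borel_measurable borel" unfolding E_def[abs_def] by measurable
  have eq: "lzF kap x - lzF kap (- x) / of_real q = (\<integral>t. E t * exp (cc * of_real x * of_real t) \<partial>lborel)" for x
  proof -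
    have "lzF kap (- x) = (\<integral>t. lzG kap (- t) * exp (cc * of_real x * of_real t) \<partial>lborel)"
      using lborel_integral_real_affine[of "- 1" "\<lambda>t. lzG kap t * exp (cc * of_real (- x) * of_real t)" 0]
      unfolding lzF_def by simp
    moreover have "integrable lborel (\<lambda>t. lzG kap (- t) * exp (cc * of_real x * of_real t))"
      using lborel_integrable_real_affine[OF lz_transform(1)[OF kap, of cc "- x"], of "- 1" 0] by simp
    ultimately show ?thesis
      using lz_transform(1)[OF kap, of cc x]
      unfolding E_def lzF_def by (simp add: left_diff_distrib)
  qed
  have E0: "E t = 0" if "t > 0" for t
    using phi_of_real_neg[OF that, of kap] q by (simp add: E_def lzG_def q_def)
  have Eb: "cmod (E t) \<le> 2 * q * exp (- t\<^sup>2 / 2)" for t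
  proof -
    have "cmod (lzG kap (- t) / of_real q) \<le> cmod (lzG kap (- t))"
      using q by (simp add: norm_divide divide_le_eq mult_le_cancel_left1)
    then show ?thesis
      using norm_lzG[OF kap, of t] norm_lzG[OF kap, of "- t"] norm_triangle_ineq4[of "lzG kap t" "lzG kap (- t) / of_real q"]
      unfolding E_def q_def by simp
  qed
  \<comment> \<open>For \<open>t < 0\<close> and \<open>x \<ge> 0\<close> this is at most 1 and
    tends to 0 as x grows, which is what dominated convergence asks for.\<close>
  have re: "cmod (exp (cc * of_real x * of_real t)) = exp (t / sqrt 2 * x)" for x t
    by (simp add: cc_def mult.commute)
  have "((\<lambda>x. \<integral>t. E t * exp (cc * of_real x * of_real t) \<partial>lborel) \<longlongrightarrow> (\<integral>t. 0 \<partial>(lborel :: real measure))) at_top"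
  proof (rule integral_dominated_convergence_at_top[where s = "\<lambda>x t. E t * exp (cc * of_real x * of_real t)"
        and f = "\<lambda>_. 0" and w = "\<lambda>t. 2 * q * exp (- t\<^sup>2 / 2)"])
    show "integrable lborel (\<lambda>t::real. 2 * q * exp (- t\<^sup>2 / 2))"
      by (intro integrable_mult_right gaussian_moments)
    have "AE t in lborel. t \<noteq> (0::real)" by (rule AE_lborel_singleton)
    then show "AE t in lborel. ((\<lambda>x. E t * exp (cc * of_real x * of_real t)) \<longlongrightarrow> 0) at_top"
    proof eventually_elim
      case (elim t)
      show ?case
      proof (cases "t > 0")
        case False
        then have "t / sqrt 2 < 0" using elim by (simp add: divide_less_0_iff)
        then have "filterlim (\<lambda>x. t / sqrt 2 * x) at_bot at_top"
          by (rule filterlim_tendsto_neg_mult_at_bot[OF tendsto_const _ filterlim_ident])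
        then have "((\<lambda>x. exp (t / sqrt 2 * x)) \<longlongrightarrow> 0) at_top"
          by (rule filterlim_compose[OF exp_at_bot])
        then have "((\<lambda>x. exp (cc * of_real x * of_real t)) \<longlongrightarrow> 0) at_top"
          by (subst tendsto_norm_zero_iff[symmetric]) (simp only: re)
        then show ?thesis by (rule tendsto_mult_right_zero)
      qed (simp add: E0)
    qed
    show "\<forall>\<^sub>F x in at_top. AE t in lborel. norm (E t * exp (cc * of_real x * of_real t)) \<le> 2 * q * exp (- t\<^sup>2 / 2)"
      using eventually_ge_at_top[of 0]
    proof eventually_elim
      case (elim x)
      show ?case
      proof (rule AE_I2)
        fix t :: real
        show "norm (E t * exp (cc * of_real x * of_real t)) \<le> 2 * q * exp (- t\<^sup>2 / 2)"
        proof (cases "t > 0")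
          case True then show ?thesis using E0 q by simp
        next
          case False
          then have "t / sqrt 2 * x \<le> 0" using elim by (intro mult_nonpos_nonneg divide_nonpos_nonneg) auto
          then have "cmod (exp (cc * of_real x * of_real t)) \<le> 1" unfolding re by simp
          then show ?thesis unfolding norm_mult
            by (intro order_trans[OF mult_left_le Eb[of t]]) auto
        qed
      qed
    qed
  qed measurable
  then show ?thesis unfolding eq[symmetric] q_def by simp
qed

lemma lzD_derivs:
  assumes kap: "kap > 0"
  shows "(lzF kap has_vector_derivative (- \<i> * of_real (sqrt kap) * lzD kap x - \<i> * of_real x * lzF kap x)) (at x)"
    and "(lzD kap has_vector_derivative (- \<i> * of_real (sqrt kap) * lzF kap x)) (at x)"
proof -
  have k: "complex_of_real (sqrt kap) \<noteq> 0" using kap by simp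
  have kk: "complex_of_real (sqrt kap) * of_real (sqrt kap) = of_real kap"
    using kap by (simp flip: of_real_mult)
  have "- \<i> * of_real (sqrt kap) * lzD kap x - \<i> * of_real x * lzF kap x = lzF1 kap x"
    using k by (simp add: lzD_def field_simps)
  then show "(lzF kap has_vector_derivative (- \<i> * of_real (sqrt kap) * lzD kap x - \<i> * of_real x * lzF kap x)) (at x)"
    using lzF_derivs(1)[OF kap, of x] by simp
  have "(lzD kap has_vector_derivative
      \<i> / of_real (sqrt kap) * (lzF2 kap x + (\<i> * of_real x * lzF1 kap x + \<i> * of_real 1 * lzF kap x))) (at x)"
    unfolding lzD_def[abs_def]
    by (intro has_vector_derivative_mult_right has_vector_derivative_add has_vector_derivative_mult lzF_derivs kap
        has_vector_derivative_of_real DERIV_ident)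
  moreover have "\<i> / of_real (sqrt kap) * (lzF2 kap x + (\<i> * of_real x * lzF1 kap x + \<i> * of_real 1 * lzF kap x))
      = - \<i> * of_real (sqrt kap) * lzF kap x"
  proof -
    have "lzF2 kap x + (\<i> * of_real x * lzF1 kap x + \<i> * of_real 1 * lzF kap x) = - of_real kap * lzF kap x"
      using lzF_ode[OF kap, of x] by (simp add: algebra_simps eq_neg_iff_add_eq_0)
    then show ?thesis unfolding kk[symmetric] using k by simp
  qed
  ultimately show "(lzD kap has_vector_derivative (- \<i> * of_real (sqrt kap) * lzF kap x)) (at x)" by simp
qed

text \<open>Together with \<open>lzR2\<close> and \<open>lzR3\<close> this is the Bloch vector of
  the spinor \<open>(lzF, lzD)\<close>. Being sesquilinear, it is blind to the common phase by which
  this spinor differs from a solution of the symmetric two-level system.\<close>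

definition lzR1 :: "real \<Rightarrow> real \<Rightarrow> real" where "lzR1 kap x = 2 * Re (cnj (lzF kap x) * lzD kap x)"
definition lzR2 :: "real \<Rightarrow> real \<Rightarrow> real" where "lzR2 kap x = 2 * Im (cnj (lzF kap x) * lzD kap x)"
definition lzR3 :: "real \<Rightarrow> real \<Rightarrow> real" where "lzR3 kap x = (cmod (lzF kap x))\<^sup>2 - (cmod (lzD kap x))\<^sup>2"
definition lzN :: "real \<Rightarrow> real \<Rightarrow> real" where "lzN kap x = (cmod (lzF kap x))\<^sup>2 + (cmod (lzD kap x))\<^sup>2"

lemma lzR_derivs:
  assumes kap: "kap > 0"
  shows "(lzR1 kap has_real_derivative - x * lzR2 kap x) (at x)"
    and "(lzR2 kap has_real_derivative x * lzR1 kap x - 2 * sqrt kap * lzR3 kap x) (at x)"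
    and "(lzR3 kap has_real_derivative 2 * sqrt kap * lzR2 kap x) (at x)"
    and "(lzN kap has_real_derivative 0) (at x)"
proof -
  let ?F = "lzF kap" and ?D = "lzD kap" and ?k = "sqrt kap"
  define F' where "F' = - \<i> * of_real ?k * ?D x - \<i> * of_real x * ?F x"
  define D' where "D' = - \<i> * of_real ?k * ?F x"
  have dF: "(?F has_vector_derivative F') (at x)" and dD: "(?D has_vector_derivative D') (at x)"
    unfolding F'_def D'_def by (rule lzD_derivs[OF kap])+
  have dP: "((\<lambda>x. cnj (?F x) * ?D x) has_vector_derivative (cnj (?F x) * D' + cnj F' * ?D x)) (at x)"
    by (intro has_vector_derivative_mult has_vector_derivative_cnj dF dD)
  have dFF: "((\<lambda>x. (cmod (?F x))\<^sup>2) has_real_derivative 2 * (?F x \<bullet> F')) (at x)"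
    unfolding has_real_derivative_iff_has_vector_derivative power2_norm_eq_inner
    using bounded_bilinear.has_vector_derivative[OF bounded_bilinear_inner dF dF] by (simp add: inner_commute)
  have dDD: "((\<lambda>x. (cmod (?D x))\<^sup>2) has_real_derivative 2 * (?D x \<bullet> D')) (at x)"
    unfolding has_real_derivative_iff_has_vector_derivative power2_norm_eq_inner
    using bounded_bilinear.has_vector_derivative[OF bounded_bilinear_inner dD dD] by (simp add: inner_commute)
  have "((\<lambda>x. Re (cnj (?F x) * ?D x)) has_real_derivative Re (cnj (?F x) * D' + cnj F' * ?D x)) (at x)"
    "((\<lambda>x. Im (cnj (?F x) * ?D x)) has_real_derivative Im (cnj (?F x) * D' + cnj F' * ?D x)) (at x)"
    unfolding has_real_derivative_iff_has_vector_derivative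
    by (rule bounded_linear.has_vector_derivative[OF bounded_linear_Re dP],
        rule bounded_linear.has_vector_derivative[OF bounded_linear_Im dP])
  note dRI = this
  have 1: "2 * Re (cnj (?F x) * D' + cnj F' * ?D x) = - x * lzR2 kap x"
    by (simp add: lzR2_def D'_def F'_def algebra_simps)
  have 2: "2 * Im (cnj (?F x) * D' + cnj F' * ?D x) = x * lzR1 kap x - 2 * ?k * lzR3 kap x"
    by (simp add: lzR1_def lzR3_def D'_def F'_def cmod_power2) (simp add: algebra_simps power2_eq_square)
  have 3: "2 * (?F x \<bullet> F') - 2 * (?D x \<bullet> D') = 2 * ?k * lzR2 kap x"
    "2 * (?F x \<bullet> F') + 2 * (?D x \<bullet> D') = 0"
    by (simp_all add: lzR2_def D'_def F'_def inner_complex_def algebra_simps)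
  show "(lzR1 kap has_real_derivative - x * lzR2 kap x) (at x)"
    using DERIV_cmult[OF dRI(1), of 2] unfolding 1 lzR1_def[abs_def] .
  show "(lzR2 kap has_real_derivative x * lzR1 kap x - 2 * ?k * lzR3 kap x) (at x)"
    using DERIV_cmult[OF dRI(2), of 2] unfolding 2 lzR2_def[abs_def] .
  show "(lzR3 kap has_real_derivative 2 * ?k * lzR2 kap x) (at x)"
    using DERIV_diff[OF dFF dDD] unfolding 3 lzR3_def[abs_def] .
  show "(lzN kap has_real_derivative 0) (at x)"
    using DERIV_add[OF dFF dDD] unfolding 3 lzN_def[abs_def] .
qed

lemma lzN_const: "kap > 0 \<Longrightarrow> lzN kap x = lzN kap 0"
  using DERIV_isconst_all[of "lzN kap" x 0] lzR_derivs(4) by blast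

lemma lzR_norm: "(lzR1 kap x)\<^sup>2 + (lzR2 kap x)\<^sup>2 + (lzR3 kap x)\<^sup>2 = (lzN kap x)\<^sup>2"
proof -
  have "(lzR1 kap x)\<^sup>2 + (lzR2 kap x)\<^sup>2 = 4 * (cmod (cnj (lzF kap x) * lzD kap x))\<^sup>2"
    unfolding cmod_power2 lzR1_def lzR2_def power_mult_distrib by simp
  also have "\<dots> = 4 * (cmod (lzF kap x))\<^sup>2 * (cmod (lzD kap x))\<^sup>2"
    by (simp add: norm_mult power_mult_distrib)
  finally show ?thesis
    unfolding lzR3_def lzN_def by (simp add: power2_eq_square algebra_simps)
qed

lemma lzD_at_bot: assumes kap: "kap > 0" shows "(lzD kap \<longlongrightarrow> 0) at_bot"
proof -
  define c where "c = kap * exp (pi * kap) * (\<integral>v. v\<^sup>2 * exp (- v\<^sup>2 / 2) \<partial>lborel) * sqrt 2 / sqrt kap"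
  show ?thesis
  proof (rule Lim_null_comparison)
    show "((\<lambda>x. c / - x) \<longlongrightarrow> 0) at_bot" by real_asymp
    show "\<forall>\<^sub>F x in at_bot. cmod (lzD kap x) \<le> c / - x"
      using eventually_le_at_bot[of "-1"]
    proof eventually_elim
      case (elim x)
      define X where "X = - x / sqrt 2"
      have X: "X > 0" "- sqrt 2 * X = x" using elim by (auto simp: X_def divide_less_0_iff)
      have "cmod (lzD kap x) = 1 / sqrt kap * cmod (lzF1 kap x + \<i> * of_real x * lzF kap x)"
        using kap by (simp add: lzD_def norm_mult norm_divide)
      also have "\<dots> \<le> 1 / sqrt kap * (kap * exp (pi * kap) / X * (\<integral>v. v\<^sup>2 * exp (- v\<^sup>2 / 2) \<partial>lborel))"
        using lz_before_crossing(2)[OF kap X(1)] kap unfolding X(2) by (intro mult_left_mono) auto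
      also have "\<dots> = c / - x" by (simp add: c_def X_def)
      finally show ?case .
    qed
  qed
qed

text \<open>The normalization will divide by this constant of motion. Far before the crossing it is
  bounded below by the squared modulus of \<open>lzF\<close>, which is positive there.\<close>

lemma lzN_pos: assumes kap: "kap > 0" shows "lzN kap 0 > 0"
proof -
  define c where "c = kap * exp (pi * kap) * (\<integral>v. \<bar>v\<bar> * exp (- v\<^sup>2 / 2) \<partial>lborel)"
  have "((\<lambda>X. p - c / X) \<longlongrightarrow> p) at_top" for p by real_asymp
  moreover have "(0::real) < sqrt (2 * pi)" by simp
  ultimately have "\<forall>\<^sub>F X in at_top. 0 < sqrt (2 * pi) - c / X" by (rule order_tendstoD)
  then have "\<forall>\<^sub>F X in at_top. X > 0 \<and> 0 < sqrt (2 * pi) - c / X"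
    using eventually_gt_at_top[of 0] by eventually_elim simp
  then obtain X where X: "X > 0" "0 < sqrt (2 * pi) - c / X"
    using eventually_happens'[OF trivial_limit_at_top_linorder] by blast
  have "c / X = kap * exp (pi * kap) / X * (\<integral>v. \<bar>v\<bar> * exp (- v\<^sup>2 / 2) \<partial>lborel)" by (simp add: c_def)
  then have "cmod (lzF kap (- sqrt 2 * X)) > 0"
    using lz_before_crossing(1)[OF kap X(1)] X(2) by linarith
  then have "lzN kap (- sqrt 2 * X) > 0"
    unfolding lzN_def by (intro add_pos_nonneg zero_less_power) auto
  then show ?thesis using lzN_const[OF kap, of "- sqrt 2 * X"] by simp
qed

text \<open>Before the crossing the second component vanishes, so the conserved norm sits in the
  first. Reflection ties the limit at plus infinity to it with the factor
  \<open>exp (- pi * kap)\<close>, which is squared here.\<close>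

lemma lzF_limits:
  assumes kap: "kap > 0"
  shows "((\<lambda>x. (cmod (lzF kap x))\<^sup>2) \<longlongrightarrow> lzN kap 0) at_bot"
    and "((\<lambda>x. (cmod (lzF kap x))\<^sup>2) \<longlongrightarrow> lzN kap 0 * exp (- 2 * pi * kap)) at_top"
proof -
  have "((\<lambda>x. lzN kap 0 - (cmod (lzD kap x))\<^sup>2) \<longlongrightarrow> lzN kap 0 - (cmod 0)\<^sup>2) at_bot"
    by (intro tendsto_intros lzD_at_bot kap)
  moreover have "lzN kap 0 - (cmod (lzD kap x))\<^sup>2 = (cmod (lzF kap x))\<^sup>2" for x
    using lzN_const[OF kap, of x] by (simp add: lzN_def)
  ultimately show bot: "((\<lambda>x. (cmod (lzF kap x))\<^sup>2) \<longlongrightarrow> lzN kap 0) at_bot" by simp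
  let ?q = "exp (pi * kap)"
  have "((\<lambda>x. sqrt ((cmod (lzF kap x))\<^sup>2)) \<longlongrightarrow> sqrt (lzN kap 0)) at_bot"
    by (intro tendsto_intros bot)
  then have m: "((\<lambda>x. cmod (lzF kap (- x))) \<longlongrightarrow> sqrt (lzN kap 0)) at_top"
    by (simp add: at_bot_mirror filterlim_filtermap)
  have "((\<lambda>x. cmod (lzF kap x) - cmod (lzF kap (- x) / of_real ?q)) \<longlongrightarrow> 0) at_top"
    by (rule Lim_null_comparison[OF _ tendsto_norm_zero[OF lzF_reflection[OF kap]]])
      (intro always_eventually allI, unfold real_norm_def, rule norm_triangle_ineq3)
  from tendsto_add[OF this tendsto_divide[OF m tendsto_const, of ?q]]
  have "((\<lambda>x. cmod (lzF kap x)) \<longlongrightarrow> sqrt (lzN kap 0) / ?q) at_top"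
    by (simp add: norm_divide)
  then have "((\<lambda>x. (cmod (lzF kap x))\<^sup>2) \<longlongrightarrow> (sqrt (lzN kap 0) / ?q)\<^sup>2) at_top"
    by (intro tendsto_intros)
  moreover have "(sqrt (lzN kap 0) / ?q)\<^sup>2 = lzN kap 0 * exp (- 2 * pi * kap)"
  proof -
    have "exp (- 2 * pi * kap) = inverse (?q\<^sup>2)"
      unfolding exp_double[symmetric] exp_minus[symmetric] by (simp add: mult_ac)
    then show ?thesis using lzN_pos[OF kap] by (simp add: power_mult_distrib power_inverse divide_inverse)
  qed
  ultimately show "((\<lambda>x. (cmod (lzF kap x))\<^sup>2) \<longlongrightarrow> lzN kap 0 * exp (- 2 * pi * kap)) at_top" by simp
qed

lemma landau_zener_solution:
  assumes g: "g > 0" and eps: "eps > 0"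
  obtains Z W where "adiabatic_solution g (\<lambda>_. 0) eps UNIV Z W"
    and "\<And>s. (Z s)\<^sup>2 + (cmod (W s))\<^sup>2 = 1"
    and "(Z \<longlongrightarrow> - 1) at_bot" "(W \<longlongrightarrow> 0) at_bot"
    and "(Z \<longlongrightarrow> 2 * exp (- pi * g\<^sup>2 / (2 * eps)) - 1) at_top"
proof -
  \<comment> \<open>In the variable \<open>s / sqrt eps\<close> the field becomes x and the coupling
    \<open>2 * sqrt kap = g / sqrt eps\<close>; thus \<open>2 * pi * kap\<close> is the Landau-Zener
    exponent.\<close>
  define kap where "kap = g\<^sup>2 / (4 * eps)"
  have kap: "kap > 0" using g eps by (simp add: kap_def)
  define N where "N = lzN kap 0"
  have N: "N > 0" unfolding N_def by (rule lzN_pos[OF kap])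
  have sk: "2 * sqrt kap = g / sqrt eps"
    using g eps by (simp add: kap_def real_sqrt_divide real_sqrt_mult)
  have se: "sqrt eps * sqrt eps = eps" "sqrt eps > 0" using eps by auto
  define r1 where "r1 s = lzR1 kap (s / sqrt eps) / N" for s
  define r2 where "r2 s = lzR2 kap (s / sqrt eps) / N" for s
  define r3 where "r3 s = lzR3 kap (s / sqrt eps) / N" for s
  have chain: "((\<lambda>s. f (s / sqrt eps) / N) has_real_derivative f' / sqrt eps / N) (at s)"
    if "(f has_real_derivative f') (at (s / sqrt eps))" for f f' s
  proof -
    have "((\<lambda>s. s / sqrt eps) has_real_derivative 1 / sqrt eps) (at s)"
      by (rule DERIV_cdivide[OF DERIV_ident])
    from DERIV_cdivide[OF DERIV_chain2[OF that this], of N] show ?thesis by simp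
  qed
  have bloch: "bloch_solution g (\<lambda>_. 0) eps UNIV r1 r2 r3"
    unfolding bloch_solution_def
  proof (intro ballI conjI)
    fix s
    have "- (s / sqrt eps) * lzR2 kap (s / sqrt eps) / sqrt eps / N = (- s * r2 s - 0) / eps"
      using N se by (simp add: r2_def field_simps)
    with chain[OF lzR_derivs(1)[OF kap], of s]
    show "(r1 has_real_derivative (- s * r2 s - 0 * inverse (om g s) * (s\<^sup>2 * r1 s - g * s * r3 s)) / eps) (at s)"
      by (simp add: r1_def[abs_def])
    have "(s / sqrt eps * lzR1 kap (s / sqrt eps) - 2 * sqrt kap * lzR3 kap (s / sqrt eps)) / sqrt eps / N = (s * r1 s - g * r3 s) / eps"
      unfolding sk using N se by (simp add: r1_def r3_def field_simps)
    with chain[OF lzR_derivs(2)[OF kap], of s]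
    show "(r2 has_real_derivative (s * r1 s - g * r3 s - 0 * inverse (om g s) * (s\<^sup>2 + g\<^sup>2) * r2 s) / eps) (at s)"
      by (simp add: r2_def[abs_def])
    have "2 * sqrt kap * lzR2 kap (s / sqrt eps) / sqrt eps / N = (g * r2 s) / eps"
      unfolding sk using N se by (simp add: r2_def field_simps)
    with chain[OF lzR_derivs(3)[OF kap], of s]
    show "(r3 has_real_derivative (g * r2 s - 0 * inverse (om g s) * (g\<^sup>2 * r3 s - g * s * r1 s)) / eps) (at s)"
      by (simp add: r3_def[abs_def])
  qed
  have norm: "(r1 s)\<^sup>2 + (r2 s)\<^sup>2 + (r3 s)\<^sup>2 = 1" for s
  proof -
    have "(r1 s)\<^sup>2 + (r2 s)\<^sup>2 + (r3 s)\<^sup>2 = (lzN kap (s / sqrt eps))\<^sup>2 / N\<^sup>2"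
      unfolding r1_def r2_def r3_def power_divide lzR_norm[symmetric] by (simp add: add_divide_distrib)
    then show ?thesis using lzN_const[OF kap, of "s / sqrt eps"] N by (simp add: N_def)
  qed
  have b1: "\<bar>r1 s\<bar> \<le> 1" and b3: "\<bar>r3 s\<bar> \<le> 1" for s
  proof -
    have "(r1 s)\<^sup>2 \<le> 1" "(r3 s)\<^sup>2 \<le> 1"
      using norm[of s] zero_le_power2[of "r1 s"] zero_le_power2[of "r2 s"] zero_le_power2[of "r3 s"] by linarith+
    then show "\<bar>r1 s\<bar> \<le> 1" "\<bar>r3 s\<bar> \<le> 1" by (simp_all add: abs_square_le_1)
  qed
  have xbot: "filterlim (\<lambda>s. s / sqrt eps) at_bot at_bot" and xtop: "filterlim (\<lambda>s. s / sqrt eps) at_top at_top"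
    using se(2) by real_asymp+
  have R3: "lzR3 kap x = 2 * (cmod (lzF kap x))\<^sup>2 - N" for x
    using lzN_const[OF kap, of x] by (simp add: lzR3_def lzN_def N_def)
  have "((\<lambda>x. (2 * (cmod (lzF kap x))\<^sup>2 - N) / N) \<longlongrightarrow> (2 * N - N) / N) at_bot"
    "((\<lambda>x. (2 * (cmod (lzF kap x))\<^sup>2 - N) / N) \<longlongrightarrow> (2 * (N * exp (- 2 * pi * kap)) - N) / N) at_top"
    using N by (intro tendsto_divide tendsto_diff tendsto_mult tendsto_const lzF_limits[OF kap, folded N_def]; simp)+
  from filterlim_compose[OF this(1) xbot] filterlim_compose[OF this(2) xtop]
  have r3lim: "(r3 \<longlongrightarrow> 1) at_bot" "(r3 \<longlongrightarrow> 2 * exp (- 2 * pi * kap) - 1) at_top"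
    using N by (auto simp: r3_def[abs_def] R3 diff_divide_distrib)
  have coh: "((\<lambda>x. cnj (lzF kap x) * lzD kap x) \<longlongrightarrow> 0) at_bot"
  proof (rule Lim_null_comparison)
    have "((\<lambda>x. sqrt ((cmod (lzF kap x))\<^sup>2) * cmod (lzD kap x)) \<longlongrightarrow> sqrt N * cmod 0) at_bot"
      using lzF_limits(1)[OF kap] lzD_at_bot[OF kap] by (intro tendsto_intros) (auto simp: N_def)
    then show "((\<lambda>x. cmod (lzF kap x) * cmod (lzD kap x)) \<longlongrightarrow> 0) at_bot" by simp
  qed (simp add: norm_mult)
  have "((\<lambda>x. lzR1 kap x / N) \<longlongrightarrow> 2 * Re 0 / N) at_bot" "((\<lambda>x. lzR2 kap x / N) \<longlongrightarrow> 2 * Im 0 / N) at_bot"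
    unfolding lzR1_def lzR2_def using N
    by (intro tendsto_divide tendsto_mult tendsto_const tendsto_Re tendsto_Im coh; simp)+
  from filterlim_compose[OF this(1) xbot] filterlim_compose[OF this(2) xbot]
  have rlim: "(r1 \<longlongrightarrow> 0) at_bot" "(r2 \<longlongrightarrow> 0) at_bot"
    by (auto simp: r1_def[abs_def] r2_def[abs_def])
  have "- 2 * pi * kap = - pi * g\<^sup>2 / (2 * eps)" by (simp add: kap_def)
  then have top: "(r3 \<longlongrightarrow> 2 * exp (- pi * g\<^sup>2 / (2 * eps)) - 1) at_top" using r3lim(2) by simp
  show ?thesis
  proof (rule that)
    show "adiabatic_solution g (\<lambda>_. 0) eps UNIV (frame_z g r1 r3) (frame_w g r1 r2 r3)"
      by (rule bloch_imp_adiabatic[OF bloch g])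
    show "(frame_z g r1 r3 s)\<^sup>2 + (cmod (frame_w g r1 r2 r3 s))\<^sup>2 = 1" for s
      unfolding frame_norm[OF g] by (rule norm)
    show "(frame_z g r1 r3 \<longlongrightarrow> - 1) at_bot" by (rule adiabatic_limits(2)[OF g b1 b3 r3lim(1)])
    show "(frame_w g r1 r2 r3 \<longlongrightarrow> 0) at_bot" by (rule adiabatic_limits(3)[OF g b1 b3 rlim])
    show "(frame_z g r1 r3 \<longlongrightarrow> 2 * exp (- pi * g\<^sup>2 / (2 * eps)) - 1) at_top"
      by (rule adiabatic_limits(1)[OF g b1 b3 top])
  qed
qed

section \<open>Dephased transition probability\<close>

text \<open>Twice the integrand of the theorem, made explicit; the factor 2 is undone by the
  transition probability \<open>(1 + z) / 2\<close>.\<close>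

definition correction :: "real \<Rightarrow> (real \<Rightarrow> real) \<Rightarrow> real \<Rightarrow> real" where
  "correction g gam s = gam s * g\<^sup>2 * inverse (om g s) ^ 5 / (1 + (gam s)\<^sup>2)"

lemma unit_ball_bounds:
  assumes "a\<^sup>2 + (cmod b)\<^sup>2 \<le> 1"
  shows "\<bar>a\<bar> \<le> 1" "cmod b \<le> 1"
proof -
  have "a\<^sup>2 \<le> 1" "(cmod b)\<^sup>2 \<le> 1\<^sup>2"
    using assms zero_le_power2[of a] zero_le_power2[of "cmod b"] by (simp, linarith)+
  then show "\<bar>a\<bar> \<le> 1" "cmod b \<le> 1"
    by (auto simp: abs_square_le_1 intro: power2_le_imp_le)
qed

context dephasing
begin

lemma continuous_on_correction: "continuous_on S (correction g gam)"
proof -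
  have "continuous_on S gam"
    using DERIV_gam by (intro continuous_at_imp_continuous_on ballI DERIV_isCont)
  moreover have "continuous_on S (om g)"
    using DERIV_om[OF g] by (intro continuous_at_imp_continuous_on ballI DERIV_isCont)
  moreover have "om g s \<noteq> 0" for s using om_pos[OF g, of s] by simp
  moreover have "1 + (gam s)\<^sup>2 \<noteq> 0" for s
    by (metis add_pos_nonneg less_irrefl zero_le_power2 zero_less_one)
  ultimately show ?thesis
    unfolding correction_def[abs_def] by (intro continuous_intros) auto
qed

text \<open>
  The generator without dephasing is antisymmetric, so pairing the dephased solution with the time-reversed
  Landau-Zener solution \<open>s \<mapsto> (- Z (- s), cnj (W (- s)))\<close> gives a quantity whose derivative is exactly
  \<open>- (gam om / eps) Re (W (- s) w s)\<close>: no derivative of \<open>gam\<close> enters at first order in \<open>gam\<close>,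
  which is why the remainder is proportional to \<open>sup gam\<close>.
\<close>

lemma pairing_estimate:
  assumes eps: "eps > 0"
    and Z: "adiabatic_solution g (\<lambda>_. 0) eps UNIV Z W" "\<And>s. (Z s)\<^sup>2 + (cmod (W s))\<^sup>2 = 1"
      "(Z \<longlongrightarrow> - 1) at_bot" "(W \<longlongrightarrow> 0) at_bot"
    and T: "T > 0" "v T ^ 3 \<le> eps"
    and sol: "adiabatic_solution g gam eps {- T..} z w" "z (- T) = - 1" "w (- T) = 0"
    and \<Gamma>: "\<And>s. gam s \<le> \<Gamma>"
  shows "\<bar>- z T * Z (- T) + Re (W (- T) * w T) - Z T - eps * integral {- T..T} (correction g gam)\<bar>
     \<le> pair_const g B * (pi / g) * \<Gamma> * eps\<^sup>2"
proof -
  \<comment> \<open>Zero dephasing is an instance with the same \<open>B\<close>, so the estimates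
    for both solutions share their constants.\<close>
  interpret Z: dephasing g B "\<lambda>_. 0" "\<lambda>_. 0" "\<lambda>_. 0"
    using g B by unfold_locales auto
  have Z1: "\<bar>Z s\<bar> \<le> 1" and W1: "cmod (W s) \<le> 1" for s
    using unit_ball_bounds[of "Z s" "W s"] Z(2)[of s] by auto
  have z1: "\<bar>z s\<bar> \<le> 1" and w1: "cmod (w s) \<le> 1" if "s \<ge> - T" for s
    using unit_ball_bounds[of "z s" "w s"] adiabatic_norm_antimono[OF sol(1) g eps gam_nonneg order_refl that] sol(2,3) by auto
  have err: "\<bar>Re (W (- s) * w s) + eps\<^sup>2 * g\<^sup>2 * v s ^ 6 / (1 + (gam s)\<^sup>2)\<bar> \<le> pair_const g B * eps ^ 3 * v s ^ 3"
    if s: "- T \<le> s" "s \<le> T" for s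
  proof (rule pairing_error[OF eps w1[OF s(1)] W1])
    have vm: "v (- s) = v s" by (simp add: v_def)
    have al: "Z.al (- s) = of_real (g * v s ^ 3) * inverse \<i>"
      by (simp add: Z.al_def Z.j_def vm)
    note WB = Z.bounds_from_minus_infinity[OF Z(1) eps Z1 W1 Z(3,4)]
    show "cmod (W (- s)) \<le> 5 * N * (eps + eps\<^sup>2) * v s ^ 3" if "s \<ge> 0"
      using WB(1)[of "- s"] that by (simp add: vm)
    show "cmod (w s) \<le> 5 * N * (eps + eps\<^sup>2) * v s ^ 3" if "s \<le> 0"
      using decay_before_crossing[OF sol(1) eps z1 w1 s(1) that] sol(3) by simp
    have s2: "second_const g B * eps\<^sup>2 \<le> 2 * second_const g B * eps\<^sup>2"
      using second_const_nonneg by (intro mult_right_mono) auto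
    show "cmod (W (- s) + of_real eps * (of_real (g * v s ^ 3) * inverse \<i>)) \<le> 2 * second_const g B * eps\<^sup>2"
      if "eps \<le> 1"
      using WB(2)[of "- s"] that s2 unfolding al by linarith
    show "cmod (w s + of_real eps * al s) \<le> 2 * second_const g B * eps\<^sup>2" if "eps \<le> 1"
    proof -
      \<comment> \<open>A start at \<open>- T\<close> rather than at minus infinity adds an error
        \<open>eps * v^3\<close>; the assumption on \<open>T\<close> makes it at most
        \<open>eps^2\<close>, whence the factor 2.\<close>
      have "eps * v (- T) ^ 3 \<le> eps * eps" using eps T(2) by (intro mult_left_mono) (auto simp: v_def)
      then have "second_const g B * (eps\<^sup>2 + 0 + 0 + eps * v (- T) ^ 3) \<le> second_const g B * (2 * eps\<^sup>2)"
        using second_const_nonneg by (intro mult_left_mono) (auto simp: power2_eq_square)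
      then show ?thesis
        using second_order_bound[OF sol(1) eps that z1 w1 s(1)] sol(2,3) by simp
    qed
  qed
  define c where "c = pair_const g B * \<Gamma> * eps\<^sup>2"
  define J where "J s = integral {- T..s} (correction g gam)" for s
  \<comment> \<open>The predicted correction is subtracted in advance, so that only the pairing
    error remains in the derivative of \<open>Q\<close>. At \<open>- T\<close> the initial data
    reduce \<open>Q\<close> to \<open>Z T\<close>.\<close>
  define Q where "Q s = - z s * Z (- s) + Re (W (- s) * w s) - eps * J s" for s
  define Q' where "Q' s = - (gam s * (om g s / eps) * Re (W (- s) * w s)) - eps * correction g gam s" for s
  have "\<bar>Q T - Q (- T)\<bar> \<le> c * (arctan (T / g) / g) - c * (arctan (- T / g) / g)"
  proof (rule abs_diff_le_comparison)
    fix s assume s: "- T \<le> s" "s \<le> T"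
    show "((\<lambda>s. c * (arctan (s / g) / g)) has_real_derivative c * (inverse (om g s))\<^sup>2) (at s within {- T..T})"
      by (intro DERIV_cmult DERIV_arctan_om g)
    show "\<bar>Q' s\<bar> \<le> c * (inverse (om g s))\<^sup>2"
    proof -
      have v: "v s > 0" by (rule v_pos)
      have omv: "om g s * v s = 1" by simp
      have "eps * correction g gam s = gam s * (om g s / eps) * (eps\<^sup>2 * g\<^sup>2 * v s ^ 6 / (1 + (gam s)\<^sup>2))"
      proof -
        have "gam s * (om g s / eps) * (eps\<^sup>2 * g\<^sup>2 * v s ^ 6 / (1 + (gam s)\<^sup>2))
          = (om g s * v s) * (eps * (gam s * g\<^sup>2 * v s ^ 5 / (1 + (gam s)\<^sup>2)))"
          using eps by (simp add: power_numeral_reduce)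
        then show ?thesis unfolding omv unfolding correction_def v_def by simp
      qed
      then have "Q' s = - (gam s * (om g s / eps) * (Re (W (- s) * w s) + eps\<^sup>2 * g\<^sup>2 * v s ^ 6 / (1 + (gam s)\<^sup>2)))"
        unfolding Q'_def by (simp add: distrib_left)
      then have "\<bar>Q' s\<bar> = gam s * (om g s / eps) * \<bar>Re (W (- s) * w s) + eps\<^sup>2 * g\<^sup>2 * v s ^ 6 / (1 + (gam s)\<^sup>2)\<bar>"
        using gam_nonneg[of s] om_pos[OF g, of s] eps by (simp add: abs_mult)
      also have "\<dots> \<le> \<Gamma> * (om g s / eps) * (pair_const g B * eps ^ 3 * v s ^ 3)"
        using gam_nonneg[of s] \<Gamma>[of s] om_pos[OF g, of s] eps by (intro mult_mono err s) auto
      \<comment> \<open>\<open>om * v = 1\<close> uses up one factor \<open>v\<close>; the remaining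
        \<open>v^2\<close> is integrable.\<close>
      also have "\<dots> = (om g s * v s) * (c * (v s)\<^sup>2)"
        using eps by (simp add: c_def power_numeral_reduce)
      finally show ?thesis unfolding omv by (simp add: v_def)
    qed
    have "- s \<in> UNIV" by simp
    with Z(1) have dZ0: "(Z has_real_derivative g * (inverse (om g s))\<^sup>2 * Re (W (- s))) (at (- s))"
      and dW0: "(W has_vector_derivative (- of_real (g * (inverse (om g s))\<^sup>2 * Z (- s))
        + of_real (om g s / eps) * \<i> * W (- s))) (at (- s))"
      unfolding adiabatic_solution_def by (metis om_minus, metis (no_types, lifting) om_minus diff_zero of_real_0)
    have dz: "(z has_real_derivative g * (inverse (om g s))\<^sup>2 * Re (w s)) (at s within {- T..T})"
      and dw: "(w has_vector_derivative (- of_real (g * (inverse (om g s))\<^sup>2 * z s)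
        + of_real (om g s / eps) * (\<i> - of_real (gam s)) * w s)) (at s within {- T..T})"
      using adiabatic_solution_subset[OF sol(1), of "{- T..T}"] s by (auto simp: adiabatic_solution_def)
    have dm: "(uminus has_real_derivative - 1) (at s within {- T..T})"
      by (auto intro!: derivative_eq_intros)
    have dZ: "((\<lambda>s. Z (- s)) has_real_derivative g * (inverse (om g s))\<^sup>2 * Re (W (- s)) * - 1) (at s within {- T..T})"
      by (rule DERIV_chain2[OF dZ0 dm])
    have dW: "((\<lambda>s. W (- s)) has_vector_derivative (- 1) *\<^sub>R (- of_real (g * (inverse (om g s))\<^sup>2 * Z (- s))
        + of_real (om g s / eps) * \<i> * W (- s))) (at s within {- T..T})"
      using vector_diff_chain_within[OF dm[unfolded has_real_derivative_iff_has_vector_derivative]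
          has_vector_derivative_at_within[OF dW0]] by (simp add: o_def)
    have dJ: "(J has_real_derivative correction g gam s) (at s within {- T..T})"
      unfolding J_def[abs_def]
      by (rule integral_has_real_derivative) (use s continuous_on_correction in auto)
    have dWw: "((\<lambda>s. Re (W (- s) * w s)) has_real_derivative
        Re (W (- s) * (- of_real (g * (inverse (om g s))\<^sup>2 * z s) + of_real (om g s / eps) * (\<i> - of_real (gam s)) * w s)
         + (- 1) *\<^sub>R (- of_real (g * (inverse (om g s))\<^sup>2 * Z (- s)) + of_real (om g s / eps) * \<i> * W (- s)) * w s)) (at s within {- T..T})"
      unfolding has_real_derivative_iff_has_vector_derivative
      by (intro bounded_linear.has_vector_derivative[OF bounded_linear_Re] has_vector_derivative_mult dW dw)
    have "(Q has_real_derivative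
        (- (g * (inverse (om g s))\<^sup>2 * Re (w s)) * Z (- s) + (g * (inverse (om g s))\<^sup>2 * Re (W (- s)) * - 1) * - z s)
        + Re (W (- s) * (- of_real (g * (inverse (om g s))\<^sup>2 * z s) + of_real (om g s / eps) * (\<i> - of_real (gam s)) * w s)
         + (- 1) *\<^sub>R (- of_real (g * (inverse (om g s))\<^sup>2 * Z (- s)) + of_real (om g s / eps) * \<i> * W (- s)) * w s)
        - eps * correction g gam s) (at s within {- T..T})"
      unfolding Q_def[abs_def] by (intro DERIV_diff DERIV_add DERIV_mult DERIV_minus DERIV_cmult dz dZ dWw dJ)
    moreover have ident: "(- (k * Re b) * A + (k * Re a * - 1) * - B)
        + Re (a * (- of_real (k * B) + of_real h * (\<i> - of_real y) * b)
         + (- 1) *\<^sub>R (- of_real (k * A) + of_real h * \<i> * a) * b) = - (y * h * Re (a * b))"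
      for k A B h y :: real and a b :: complex
      by (simp add: algebra_simps)
    ultimately show "(Q has_real_derivative Q' s) (at s within {- T..T})"
      unfolding Q'_def by (simp only: ident)
  qed (use T in simp)
  also have "\<dots> = c * (arctan (T / g) / g - arctan (- T / g) / g)" by (simp add: right_diff_distrib)
  also have "\<dots> \<le> c * (pi / g)"
  proof (intro mult_left_mono arctan_diff_le g)
    have "\<Gamma> \<ge> 0" using gam_nonneg[of 0] \<Gamma>[of 0] by linarith
    moreover have "pair_const g B \<ge> 0"
      using N_facts(1) g second_const_nonneg by (simp add: pair_const_def)
    ultimately show "c \<ge> 0" by (simp add: c_def)
  qed
  also have "\<dots> = pair_const g B * (pi / g) * \<Gamma> * eps\<^sup>2" by (simp add: c_def mult_ac)
  finally show ?thesis by (simp add: Q_def J_def sol(2,3))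
qed

lemma correction_integrable:
  assumes "\<And>s. gam s \<le> B"
  shows "integrable lborel (correction g gam)"
proof -
  \<comment> \<open>The integrand is O(\<open>v^5\<close>): \<open>v^3\<close> is bounded by
    \<open>1 / g^3\<close>, and \<open>v^2\<close> is compared with \<open>1 / (1 + s^2)\<close> at
    the cost of \<open>1 + 1 / g^2\<close>.\<close>
  define c where "c = B * g\<^sup>2 * (1 / g ^ 3) * (1 + 1 / g\<^sup>2)"
  have "integrable lborel (\<lambda>s::real. c * inverse (1 + s\<^sup>2))"
    using integrable_inverse_1_plus_square by (intro integrable_mult_right) (simp add: set_integrable_def)
  then show ?thesis
  proof (rule Bochner_Integration.integrable_bound)
    show "correction g gam \<in> borel_measurable lborel"
      using borel_measurable_continuous_onI[OF continuous_on_correction] by simp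
    show "AE s in lborel. norm (correction g gam s) \<le> norm (c * inverse (1 + s\<^sup>2))"
    proof (rule AE_I2)
      fix s
      have "correction g gam s \<le> gam s * g\<^sup>2 * v s ^ 5"
        unfolding correction_def v_def[symmetric]
        using divide_left_mono[of 1 "1 + (gam s)\<^sup>2" "gam s * g\<^sup>2 * v s ^ 5"] gam_nonneg[of s] v_pos[of s]
        by (simp add: add_pos_nonneg)
      also have "\<dots> \<le> B * g\<^sup>2 * v s ^ 5"
        using assms[of s] v_pos[of s] by (intro mult_right_mono) auto
      also have "\<dots> = B * g\<^sup>2 * (v s ^ 3 * (v s)\<^sup>2)" by (simp add: power_numeral_reduce)
      also have "\<dots> \<le> B * g\<^sup>2 * (1 / g ^ 3 * ((1 + 1 / g\<^sup>2) * inverse (1 + s\<^sup>2)))"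
      proof (intro mult_left_mono mult_mono v3_le)
        have q: "1 + s\<^sup>2 > 0" by (simp add: add_pos_nonneg)
        have "(1 + 1 / g\<^sup>2) * (s\<^sup>2 + g\<^sup>2) = (1 + s\<^sup>2) + (g\<^sup>2 + s\<^sup>2 / g\<^sup>2)"
          using g by (simp add: field_simps)
        then have "1 + s\<^sup>2 \<le> (1 + 1 / g\<^sup>2) * (s\<^sup>2 + g\<^sup>2)" by simp
        then have "(v s)\<^sup>2 * (1 + s\<^sup>2) \<le> (v s)\<^sup>2 * ((1 + 1 / g\<^sup>2) * (s\<^sup>2 + g\<^sup>2))"
          by (rule mult_left_mono) simp
        also have "\<dots> = (1 + 1 / g\<^sup>2) * ((v s)\<^sup>2 * (s\<^sup>2 + g\<^sup>2))" by (simp only: mult_ac)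
        also have "\<dots> = 1 + 1 / g\<^sup>2" unfolding v_def inverse_om_sq[OF g] by simp
        finally show "(v s)\<^sup>2 \<le> (1 + 1 / g\<^sup>2) * inverse (1 + s\<^sup>2)"
          unfolding divide_inverse[symmetric] pos_le_divide_eq[OF q] .
      qed (use B g in auto)
      also have "\<dots> = c * inverse (1 + s\<^sup>2)" by (simp add: c_def)
      finally have "correction g gam s \<le> c * inverse (1 + s\<^sup>2)" .
      moreover have "0 \<le> correction g gam s"
        unfolding correction_def v_def[symmetric] using gam_nonneg[of s] v_pos[of s] by (auto intro!: divide_nonneg_nonneg)
      ultimately show "norm (correction g gam s) \<le> norm (c * inverse (1 + s\<^sup>2))" by simp
    qed
  qed
qed

end

section \<open>Existence of the infinite-time limit and its expansion\<close>

lemma tendsto_at_top_if_Cauchy_rate: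
  fixes f \<delta> :: "real \<Rightarrow> real"
  assumes f: "\<And>T T'. T > 0 \<Longrightarrow> T \<le> T' \<Longrightarrow> \<bar>f T' - f T\<bar> \<le> \<delta> T" and \<delta>: "(\<delta> \<longlongrightarrow> 0) at_top"
  shows "\<exists>l. (f \<longlongrightarrow> l) at_top"
proof -
  have \<delta>n: "(\<lambda>n. \<delta> (real (Suc n))) \<longlonglongrightarrow> 0"
    by (rule filterlim_compose[OF \<delta>]) (rule filterlim_compose[OF filterlim_real_sequentially filterlim_Suc])
  have "Cauchy (\<lambda>n. f (real (Suc n)))"
  proof (rule metric_CauchyI)
    fix e :: real assume "e > 0"
    then have "\<forall>\<^sub>F n in sequentially. \<delta> (real (Suc n)) < e / 2"
      using order_tendstoD(2)[OF \<delta>n, of "e / 2"] by simp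
    then obtain M where M: "\<delta> (real (Suc M)) < e / 2" by (auto simp: eventually_sequentially)
    have "dist (f (real (Suc m))) (f (real (Suc n))) < e" if "m \<ge> M" "n \<ge> M" for m n
      using f[of "real (Suc M)" "real (Suc m)"] f[of "real (Suc M)" "real (Suc n)"] M that
      unfolding dist_real_def by (simp del: of_nat_Suc)
    then show "\<exists>M. \<forall>m\<ge>M. \<forall>n\<ge>M. dist (f (real (Suc m))) (f (real (Suc n))) < e" by blast
  qed
  then obtain l where l: "(\<lambda>n. f (real (Suc n))) \<longlonglongrightarrow> l"
    using Cauchy_convergent convergent_def by blast
  have "\<bar>f T - l\<bar> \<le> \<delta> T" if "T > 0" for T
  proof (rule tendsto_upperbound[OF _ _ sequentially_bot])
    show "(\<lambda>n. \<bar>f T - f (real (Suc n))\<bar>) \<longlonglongrightarrow> \<bar>f T - l\<bar>" by (intro tendsto_intros l)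
    have "\<forall>\<^sub>F n in sequentially. T \<le> real (Suc n)"
      using eventually_ge_at_top[of "nat \<lceil>T\<rceil>"] by eventually_elim linarith
    then show "\<forall>\<^sub>F n in sequentially. \<bar>f T - f (real (Suc n))\<bar> \<le> \<delta> T"
      by eventually_elim (use f[OF that] abs_minus_commute in metis)
  qed
  then have "\<forall>\<^sub>F T in at_top. norm (f T - l) \<le> \<delta> T"
    by (intro eventually_mono[OF eventually_gt_at_top[of 0]]) auto
  then have "((\<lambda>T. f T - l) \<longlongrightarrow> 0) at_top" by (rule Lim_null_comparison[OF _ \<delta>])
  then show ?thesis using LIM_zero_iff by blast
qed

context dephasing
begin

lemma z_variation:
  assumes sol: "adiabatic_solution g gam eps S z w" and S: "{a..b} \<subseteq> S"
    and w1: "\<And>s. s \<in> S \<Longrightarrow> cmod (w s) \<le> 1" and ab: "a \<le> b" "0 < a \<or> b < 0"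
  shows "\<bar>z b - z a\<bar> \<le> g / a - g / b"
proof -
  have "\<bar>z b - z a\<bar> \<le> - g / b - (- g / a)"
  proof (rule abs_diff_le_comparison[OF ab(1)])
    fix s assume s: "a \<le> s" "s \<le> b"
    show "(z has_real_derivative g * (inverse (om g s))\<^sup>2 * Re (w s)) (at s within {a..b})"
      using adiabatic_solution_subset[OF sol S] s by (auto simp: adiabatic_solution_def)
    have s0: "s \<noteq> 0" using s ab by auto
    show "((\<lambda>s. - g / s) has_real_derivative g / s\<^sup>2) (at s within {a..b})"
      using s0 by (auto intro!: derivative_eq_intros simp: power2_eq_square)
    have "\<bar>Re (w s)\<bar> \<le> 1" using abs_Re_le_cmod[of "w s"] w1[of s] s S by force
    moreover have "(inverse (om g s))\<^sup>2 \<le> 1 / s\<^sup>2"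
      using s0 le_imp_inverse_le[of "s\<^sup>2" "s\<^sup>2 + g\<^sup>2"]
      unfolding power_inverse om_sq by (simp add: inverse_eq_divide)
    ultimately have "g * (inverse (om g s))\<^sup>2 * \<bar>Re (w s)\<bar> \<le> g * (1 / s\<^sup>2) * 1"
      using g by (intro mult_mono) auto
    then show "\<bar>g * (inverse (om g s))\<^sup>2 * Re (w s)\<bar> \<le> g / s\<^sup>2" using g by (simp add: abs_mult)
  qed
  then show ?thesis by simp
qed

text \<open>Start and end time move together, so different \<open>T\<close> belong to different
  solutions. The one started at \<open>- T'\<close> is still close to the ground state at
  \<open>- T\<close>; contraction keeps it as close to the one started at \<open>- T\<close>, and
  after \<open>T\<close> the integrated rotation speed is too small to change \<open>z\<close> by
  more than \<open>g / T\<close>.\<close>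

lemma transition_limit_exists:
  assumes eps: "eps > 0"
    and sol: "\<And>a. adiabatic_solution g gam eps {a..} (zz a) (ww a)"
    and init: "\<And>a. zz a a = - 1" "\<And>a. ww a a = 0"
  shows "\<exists>l. ((\<lambda>T. zz (- T) T) \<longlongrightarrow> l) at_top"
proof (rule tendsto_at_top_if_Cauchy_rate)
  define c where "c = 5 * N * (eps + eps\<^sup>2)"
  have unit: "\<bar>zz a s\<bar> \<le> 1 \<and> cmod (ww a s) \<le> 1" if "a \<le> s" for a s
  proof -
    have "(zz a s)\<^sup>2 + (cmod (ww a s))\<^sup>2 \<le> 1"
      using adiabatic_norm_antimono[OF sol g eps gam_nonneg order_refl that] init by simp
    then show ?thesis using unit_ball_bounds by blast
  qed
  show "\<bar>zz (- T') T' - zz (- T) T\<bar> \<le> 2 * g / T + c * v (- T) ^ 3" if T: "T > 0" "T \<le> T'" for T T'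
  proof -
    let ?z = "zz (- T')" and ?w = "ww (- T')"
    have w1: "\<And>s. s \<in> {- T'..} \<Longrightarrow> cmod (?w s) \<le> 1" using unit by auto
    have "\<bar>?z (- T) - ?z (- T')\<bar> \<le> g / (- T') - g / (- T)"
      by (rule z_variation[OF sol _ w1]) (use T in auto)
    moreover have "0 \<le> g / T'" using g T by simp
    ultimately have z0: "\<bar>?z (- T) + 1\<bar> \<le> g / T" by (simp add: init)
    have w0: "cmod (?w (- T)) \<le> c * v (- T) ^ 3"
      using decay_before_crossing[OF sol eps, of "- T'" "- T"] unit T by (simp add: init c_def)
    have "\<bar>?z T' - ?z T\<bar> \<le> g / T - g / T'"
      by (rule z_variation[OF sol _ w1]) (use T in auto)
    then have zT: "\<bar>?z T' - ?z T\<bar> \<le> g / T" using \<open>0 \<le> g / T'\<close> by linarith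
    have "adiabatic_solution g gam eps {- T..} ?z ?w"
      by (rule adiabatic_solution_subset[OF sol]) (use T in auto)
    from adiabatic_norm_antimono[OF adiabatic_solution_diff[OF this sol] g eps gam_nonneg order_refl, of T] T
    have "(?z T - zz (- T) T)\<^sup>2 + (cmod (?w T - ww (- T) T))\<^sup>2 \<le> (?z (- T) + 1)\<^sup>2 + (cmod (?w (- T)))\<^sup>2"
      by (simp add: init)
    also have "\<dots> \<le> (\<bar>?z (- T) + 1\<bar> + cmod (?w (- T)))\<^sup>2"
      by (simp add: power2_sum)
    finally have "(?z T - zz (- T) T)\<^sup>2 \<le> (\<bar>?z (- T) + 1\<bar> + cmod (?w (- T)))\<^sup>2"
      using zero_le_power2[of "cmod (?w T - ww (- T) T)"] by linarith
    then have "\<bar>?z T - zz (- T) T\<bar> \<le> \<bar>?z (- T) + 1\<bar> + cmod (?w (- T))"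
      by (simp flip: abs_le_square_iff)
    then show ?thesis using z0 w0 zT by simp
  qed
  have "((\<lambda>T. v (- T)) \<longlongrightarrow> 0) at_top"
    using tendsto_v_at_bot by (simp add: at_bot_mirror filterlim_filtermap)
  then have "((\<lambda>T. 2 * g / T + c * v (- T) ^ 3) \<longlongrightarrow> 0 + c * 0 ^ 3) at_top"
    by (intro tendsto_intros tendsto_divide_0[OF tendsto_const] filterlim_at_top_imp_at_infinity filterlim_ident)
  then show "((\<lambda>T. 2 * g / T + c * v (- T) ^ 3) \<longlongrightarrow> 0) at_top" by simp
qed

text \<open>In the pairing estimate \<open>Z (- T)\<close> tends to -1 and \<open>W (- T)\<close> to
  0, so the pairing reduces to the final \<open>z\<close>, while \<open>Z T\<close> contributes the
  Landau-Zener value. Integer \<open>T\<close> suffice, as the limit is already known to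
  exist.\<close>

lemma transition_expansion:
  assumes eps: "eps > 0"
    and sol: "\<And>a. adiabatic_solution g gam eps {a..} (zz a) (ww a)"
    and init: "\<And>a. zz a a = - 1" "\<And>a. ww a a = 0"
    and gam_le: "\<And>s. gam s \<le> B" and \<Gamma>: "\<And>s. gam s \<le> \<Gamma>"
  shows "\<exists>l. ((\<lambda>T. zz (- T) T) \<longlongrightarrow> l) at_top \<and>
    \<bar>l - (2 * exp (- pi * g\<^sup>2 / (2 * eps)) - 1) - eps * (\<integral>s. correction g gam s \<partial>lborel)\<bar>
      \<le> pair_const g B * (pi / g) * \<Gamma> * eps\<^sup>2"
proof -
  obtain l where l: "((\<lambda>T. zz (- T) T) \<longlongrightarrow> l) at_top"
    using transition_limit_exists[OF eps sol init] by blast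
  obtain Z W where Z: "adiabatic_solution g (\<lambda>_. 0) eps UNIV Z W" "\<And>s. (Z s)\<^sup>2 + (cmod (W s))\<^sup>2 = 1"
      "(Z \<longlongrightarrow> - 1) at_bot" "(W \<longlongrightarrow> 0) at_bot"
      "(Z \<longlongrightarrow> 2 * exp (- pi * g\<^sup>2 / (2 * eps)) - 1) at_top"
    using landau_zener_solution[OF g eps] by metis
  have n: "filterlim real at_top sequentially" by (rule filterlim_real_sequentially)
  have nb: "filterlim (\<lambda>n. - real n) at_bot sequentially"
    by (rule filterlim_compose[OF filterlim_uminus_at_bot_at_top n])
  have wb: "cmod (ww a s) \<le> 1" if "a \<le> s" for a s
  proof -
    have "(zz a s)\<^sup>2 + (cmod (ww a s))\<^sup>2 \<le> 1"
      using adiabatic_norm_antimono[OF sol g eps gam_nonneg order_refl that] init by simp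
    then show ?thesis by (rule unit_ball_bounds)
  qed
  have "(\<lambda>n. W (- real n) * ww (- real n) (real n)) \<longlonglongrightarrow> 0"
  proof (rule Lim_null_comparison)
    show "(\<lambda>n. cmod (W (- real n))) \<longlonglongrightarrow> 0"
      using filterlim_compose[OF tendsto_norm_zero[OF Z(4)] nb] .
    show "\<forall>\<^sub>F n in sequentially. norm (W (- real n) * ww (- real n) (real n)) \<le> cmod (W (- real n))"
      by (intro always_eventually allI) (simp add: norm_mult mult_left_le wb)
  qed
  from tendsto_Re[OF this]
  have Ww: "(\<lambda>n. Re (W (- real n) * ww (- real n) (real n))) \<longlonglongrightarrow> 0" by simp
  have J: "(\<lambda>n. integral {- real n..real n} (correction g gam)) \<longlonglongrightarrow> (\<integral>s. correction g gam s \<partial>lborel)"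
  proof (rule has_integral_truncations_tendsto[OF correction_integrable[OF gam_le]])
    show "(correction g gam has_integral integral {- real n..real n} (correction g gam)) {- real n..real n}" for n
      by (intro integrable_integral integrable_continuous_interval continuous_on_correction)
  qed
  have "(\<lambda>n. \<bar>- zz (- real n) (real n) * Z (- real n) + Re (W (- real n) * ww (- real n) (real n)) - Z (real n)
      - eps * integral {- real n..real n} (correction g gam)\<bar>) \<longlonglongrightarrow>
    \<bar>- l * - 1 + 0 - (2 * exp (- pi * g\<^sup>2 / (2 * eps)) - 1) - eps * (\<integral>s. correction g gam s \<partial>lborel)\<bar>"
    by (intro tendsto_rabs tendsto_diff tendsto_add tendsto_mult tendsto_minus tendsto_const Ww J
        filterlim_compose[OF l n] filterlim_compose[OF Z(3) nb] filterlim_compose[OF Z(5) n])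
  moreover have "\<forall>\<^sub>F n in sequentially. \<bar>- zz (- real n) (real n) * Z (- real n)
      + Re (W (- real n) * ww (- real n) (real n)) - Z (real n)
      - eps * integral {- real n..real n} (correction g gam)\<bar> \<le> pair_const g B * (pi / g) * \<Gamma> * eps\<^sup>2"
  proof -
    have "(\<lambda>n. v (- real n) ^ 3) \<longlonglongrightarrow> 0 ^ 3"
      by (intro tendsto_power filterlim_compose[OF tendsto_v_at_bot nb])
    then have "\<forall>\<^sub>F n in sequentially. v (- real n) ^ 3 < eps"
      using eps by (intro order_tendstoD(2)) auto
    then show ?thesis
      using eventually_gt_at_top[of 0]
    proof eventually_elim
      case (elim n)
      then have "v (real n) ^ 3 \<le> eps" by (simp add: v_def)
      with elim show ?case
        by (intro pairing_estimate[OF eps Z(1-4) _ _ sol init \<Gamma>]) auto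
    qed
  qed
  ultimately have "\<bar>- l * - 1 + 0 - (2 * exp (- pi * g\<^sup>2 / (2 * eps)) - 1) - eps * (\<integral>s. correction g gam s \<partial>lborel)\<bar>
      \<le> pair_const g B * (pi / g) * \<Gamma> * eps\<^sup>2"
    by (rule tendsto_upperbound) simp
  then show ?thesis using l by auto
qed

end

section \<open>From the propagator and the projections to adiabatic solutions\<close>

lemma spin_proj_trace: "spin_proj \<sigma> g s $ 1 $ 1 + spin_proj \<sigma> g s $ 2 $ 2 = 1"
proof -
  have "1/2 * (1 + \<sigma> * s / om g s) + 1/2 * (1 - \<sigma> * s / om g s) = 1" by (simp add: field_simps)
  then show ?thesis unfolding spin_proj_nth of_real_add[symmetric] by simp
qed

lemma vec2_has_vector_derivative_nth:
  fixes f :: "real \<Rightarrow> mat2"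
  assumes "(f has_vector_derivative D) F"
  shows "((\<lambda>s. f s $ i $ j) has_vector_derivative D $ i $ j) F"
  using bounded_linear.has_vector_derivative[OF bounded_linear_vec_nth
      bounded_linear.has_vector_derivative[OF bounded_linear_vec_nth assms]] .

text \<open>The Bloch equations have real coefficients, so the real and imaginary parts of the
  complex Bloch vector solve them separately; \<open>R\<close> covers both cases.\<close>

lemma propagator_bloch:
  fixes a :: real and P :: mat2
  assumes U: "is_propagator g gam eps U" and g: "g > 0"
    and R: "R = Re \<or> R = Im"
  defines "\<rho> \<equiv> \<lambda>s. U s a P"
  shows "bloch_solution g gam eps {a..} (\<lambda>s. R (\<rho> s $ 1 $ 2 + \<rho> s $ 2 $ 1))
      (\<lambda>s. R (\<i> * (\<rho> s $ 1 $ 2 - \<rho> s $ 2 $ 1))) (\<lambda>s. R (\<rho> s $ 1 $ 1 - \<rho> s $ 2 $ 2))"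
    and "\<And>s. s \<ge> a \<Longrightarrow> \<rho> s $ 1 $ 1 + \<rho> s $ 2 $ 2 = P $ 1 $ 1 + P $ 2 $ 2"
proof -
  define L where "L s = Lind g gam s (\<rho> s)" for s
  have d: "(\<rho> has_vector_derivative (1 / eps) *\<^sub>R L s) (at s within {a..})" if "s \<ge> a" for s
    using U that unfolding is_propagator_def \<rho>_def L_def by blast
  have d': "((\<lambda>s. \<rho> s $ i $ j) has_vector_derivative (1 / eps) *\<^sub>R (L s $ i $ j)) (at s within {a..})"
    if "s \<ge> a" for s i j
    using vec2_has_vector_derivative_nth[OF d[OF that], of i j] by simp
  have bl: "bounded_linear R" using R bounded_linear_Re bounded_linear_Im by blast
  have Rs: "R (x - y) = R x - R y" "R (- x) = - R x" "R (of_real c * x) = c * R x" "R (c *\<^sub>R x) = c * R x" for x y c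
    using R by auto
  show "bloch_solution g gam eps {a..} (\<lambda>s. R (\<rho> s $ 1 $ 2 + \<rho> s $ 2 $ 1))
      (\<lambda>s. R (\<i> * (\<rho> s $ 1 $ 2 - \<rho> s $ 2 $ 1))) (\<lambda>s. R (\<rho> s $ 1 $ 1 - \<rho> s $ 2 $ 2))"
    unfolding bloch_solution_def
  proof (intro ballI conjI)
    fix s assume "s \<in> {a..}"
    then have s: "s \<ge> a" by simp
    note LB = Lind_bloch[OF g, where gam = gam and s = s and \<rho> = "\<rho> s", folded L_def]
    have "((\<lambda>s. \<rho> s $ 1 $ 2 + \<rho> s $ 2 $ 1) has_vector_derivative (1 / eps) *\<^sub>R (L s $ 1 $ 2 + L s $ 2 $ 1)) (at s within {a..})"
      unfolding scaleR_add_right by (intro has_vector_derivative_add d' s)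
    from bounded_linear.has_vector_derivative[OF bl this]
    show "((\<lambda>s. R (\<rho> s $ 1 $ 2 + \<rho> s $ 2 $ 1)) has_real_derivative
        (- s * R (\<i> * (\<rho> s $ 1 $ 2 - \<rho> s $ 2 $ 1)) - gam s * inverse (om g s) *
         (s\<^sup>2 * R (\<rho> s $ 1 $ 2 + \<rho> s $ 2 $ 1) - g * s * R (\<rho> s $ 1 $ 1 - \<rho> s $ 2 $ 2))) / eps) (at s within {a..})"
      unfolding LB has_real_derivative_iff_has_vector_derivative mult_minus_left Rs by simp
    have "((\<lambda>s. \<i> * (\<rho> s $ 1 $ 2 - \<rho> s $ 2 $ 1)) has_vector_derivative \<i> * ((1 / eps) *\<^sub>R (L s $ 1 $ 2 - L s $ 2 $ 1))) (at s within {a..})"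
      unfolding scaleR_diff_right by (intro has_vector_derivative_mult_right has_vector_derivative_diff d' s)
    then have "((\<lambda>s. \<i> * (\<rho> s $ 1 $ 2 - \<rho> s $ 2 $ 1)) has_vector_derivative (1 / eps) *\<^sub>R (\<i> * (L s $ 1 $ 2 - L s $ 2 $ 1))) (at s within {a..})"
      by simp
    from bounded_linear.has_vector_derivative[OF bl this]
    show "((\<lambda>s. R (\<i> * (\<rho> s $ 1 $ 2 - \<rho> s $ 2 $ 1))) has_real_derivative
        (s * R (\<rho> s $ 1 $ 2 + \<rho> s $ 2 $ 1) - g * R (\<rho> s $ 1 $ 1 - \<rho> s $ 2 $ 2)
         - gam s * inverse (om g s) * (s\<^sup>2 + g\<^sup>2) * R (\<i> * (\<rho> s $ 1 $ 2 - \<rho> s $ 2 $ 1))) / eps) (at s within {a..})"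
      unfolding LB has_real_derivative_iff_has_vector_derivative Rs by simp
    have "((\<lambda>s. \<rho> s $ 1 $ 1 - \<rho> s $ 2 $ 2) has_vector_derivative (1 / eps) *\<^sub>R (L s $ 1 $ 1 - L s $ 2 $ 2)) (at s within {a..})"
      unfolding scaleR_diff_right by (intro has_vector_derivative_diff d' s)
    from bounded_linear.has_vector_derivative[OF bl this]
    show "((\<lambda>s. R (\<rho> s $ 1 $ 1 - \<rho> s $ 2 $ 2)) has_real_derivative
        (g * R (\<i> * (\<rho> s $ 1 $ 2 - \<rho> s $ 2 $ 1)) - gam s * inverse (om g s) *
         (g\<^sup>2 * R (\<rho> s $ 1 $ 1 - \<rho> s $ 2 $ 2) - g * s * R (\<rho> s $ 1 $ 2 + \<rho> s $ 2 $ 1))) / eps) (at s within {a..})"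
      unfolding LB has_real_derivative_iff_has_vector_derivative Rs by simp
  qed
  show "\<rho> s $ 1 $ 1 + \<rho> s $ 2 $ 2 = P $ 1 $ 1 + P $ 2 $ 2" if s: "s \<ge> a" for s
  proof -
    have "\<rho> a = P" using U by (simp add: is_propagator_def \<rho>_def)
    have "cmod (\<rho> s $ 1 $ 1 + \<rho> s $ 2 $ 2 - (P $ 1 $ 1 + P $ 2 $ 2))
        \<le> cmod (\<rho> a $ 1 $ 1 + \<rho> a $ 2 $ 2 - (P $ 1 $ 1 + P $ 2 $ 2)) + (0 - 0)"
    proof (rule dissipative_comparison[OF s, where lam = "\<lambda>_. 0" and E = "\<lambda>_. 0" and K = "\<lambda>_. 0" and K' = "\<lambda>_. 0"])
      fix t assume t: "a \<le> t" "t \<le> s"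
      note LB = Lind_bloch(1)[OF g, where gam = gam and s = t and \<rho> = "\<rho> t", folded L_def]
      have "((\<lambda>s. \<rho> s $ 1 $ 1 + \<rho> s $ 2 $ 2 - (P $ 1 $ 1 + P $ 2 $ 2)) has_vector_derivative
          (1 / eps) *\<^sub>R (L t $ 1 $ 1 + L t $ 2 $ 2) - 0) (at t within {a..})"
        unfolding scaleR_add_right by (intro has_vector_derivative_diff has_vector_derivative_add d' t has_vector_derivative_const)
      then have "((\<lambda>s. \<rho> s $ 1 $ 1 + \<rho> s $ 2 $ 2 - (P $ 1 $ 1 + P $ 2 $ 2)) has_vector_derivative 0) (at t within {a..s})"
        unfolding LB by (rule has_vector_derivative_within_subset[where S = "{a..}", OF has_vector_derivative_eq_rhs]) auto
      then show "((\<lambda>s. \<rho> s $ 1 $ 1 + \<rho> s $ 2 $ 2 - (P $ 1 $ 1 + P $ 2 $ 2)) has_vector_derivative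
          0 * (\<rho> t $ 1 $ 1 + \<rho> t $ 2 $ 2 - (P $ 1 $ 1 + P $ 2 $ 2)) + 0) (at t within {a..s})" by simp
    qed auto
    then show ?thesis by (simp add: \<open>\<rho> a = P\<close>)
  qed
qed

text \<open>The imaginary part of the Bloch vector starts at 0 and contraction keeps it there, so
  the trace against the projection is real.\<close>

lemma propagator_adiabatic:
  assumes U: "is_propagator g gam eps U" and g: "g > 0" and eps: "eps > 0" and gam: "\<And>s. gam s \<ge> 0"
  shows "\<exists>z w. adiabatic_solution g gam eps {a..} z w \<and> z a = - 1 \<and> w a = 0 \<and>
     (\<forall>T\<ge>a. trace (Pp g T ** U T a (Pm g a)) = complex_of_real ((1 + z T) / 2))"
proof -
  define \<rho> where "\<rho> s = U s a (Pm g a)" for s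
  define r1 where "r1 R s = R (\<rho> s $ 1 $ 2 + \<rho> s $ 2 $ 1)" for R :: "complex \<Rightarrow> real" and s
  define r2 where "r2 R s = R (\<i> * (\<rho> s $ 1 $ 2 - \<rho> s $ 2 $ 1))" for R :: "complex \<Rightarrow> real" and s
  define r3 where "r3 R s = R (\<rho> s $ 1 $ 1 - \<rho> s $ 2 $ 2)" for R :: "complex \<Rightarrow> real" and s
  have \<rho>a: "\<rho> a = spin_proj (- 1) g a" using U by (simp add: is_propagator_def \<rho>_def Pm_eq[OF g])
  have o: "om g a > 0" by (rule om_pos[OF g])
  have sol: "adiabatic_solution g gam eps {a..} (frame_z g (r1 R) (r3 R)) (frame_w g (r1 R) (r2 R) (r3 R))"
    if "R = Re \<or> R = Im" for R
    unfolding r1_def[abs_def] r2_def[abs_def] r3_def[abs_def] \<rho>_def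
    by (rule bloch_imp_adiabatic[OF propagator_bloch(1)[OF U g that] g])
  have init_Re: "r1 Re a = - g * inverse (om g a)" "r2 Re a = 0" "r3 Re a = - a * inverse (om g a)"
    and init_Im: "r1 Im a = 0" "r2 Im a = 0" "r3 Im a = 0"
  proof -
    have e: "1/2 * (- 1 * g / om g a) + 1/2 * (- 1 * g / om g a) = - g * inverse (om g a)"
      "1/2 * (1 + - 1 * a / om g a) - 1/2 * (1 - - 1 * a / om g a) = - a * inverse (om g a)"
      using o by (simp_all add: field_simps)
    have "\<rho> a $ 1 $ 2 + \<rho> a $ 2 $ 1 = of_real (- g * inverse (om g a))"
      "\<rho> a $ 1 $ 1 - \<rho> a $ 2 $ 2 = of_real (- a * inverse (om g a))"
      "\<i> * (\<rho> a $ 1 $ 2 - \<rho> a $ 2 $ 1) = 0"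
      unfolding \<rho>a spin_proj_nth of_real_add[symmetric] of_real_diff[symmetric] e by simp_all
    then show "r1 Re a = - g * inverse (om g a)" "r2 Re a = 0" "r3 Re a = - a * inverse (om g a)"
      "r1 Im a = 0" "r2 Im a = 0" "r3 Im a = 0"
      unfolding r1_def r2_def r3_def by (simp_all only: Re_complex_of_real Im_complex_of_real zero_complex.sel)
  qed
  have "frame_z g (r1 Re) (r3 Re) a = - ((inverse (om g a))\<^sup>2 * (a\<^sup>2 + g\<^sup>2))"
    unfolding frame_z_def init_Re by (simp add: algebra_simps power2_eq_square)
  then have z0: "frame_z g (r1 Re) (r3 Re) a = - 1" using inverse_om_sq[OF g] by simp
  have w0: "frame_w g (r1 Re) (r2 Re) (r3 Re) a = 0"
    unfolding frame_w_def init_Re by (simp add: complex_eq_iff)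
  have "trace (Pp g T ** U T a (Pm g a)) = complex_of_real ((1 + frame_z g (r1 Re) (r3 Re) T) / 2)" if T: "T \<ge> a" for T
  proof -
    have "(frame_z g (r1 Im) (r3 Im) T)\<^sup>2 + (cmod (frame_w g (r1 Im) (r2 Im) (r3 Im) T))\<^sup>2
        \<le> (frame_z g (r1 Im) (r3 Im) a)\<^sup>2 + (cmod (frame_w g (r1 Im) (r2 Im) (r3 Im) a))\<^sup>2"
      by (rule adiabatic_norm_antimono[OF sol g eps gam order_refl T]) simp
    also have "\<dots> = 0" unfolding frame_norm[OF g] init_Im by simp
    finally have "(frame_z g (r1 Im) (r3 Im) T)\<^sup>2 \<le> 0"
      using zero_le_power2[of "cmod (frame_w g (r1 Im) (r2 Im) (r3 Im) T)"] by linarith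
    then have im: "frame_z g (r1 Im) (r3 Im) T = 0" by simp
    have tr: "\<rho> T $ 1 $ 1 + \<rho> T $ 2 $ 2 = 1"
      using propagator_bloch(2)[OF U g disjI1[OF refl] T, of "Pm g a"]
      unfolding \<rho>_def Pm_eq[OF g] spin_proj_trace .
    define h where "h = complex_of_real (1/2)"
    define v where "v = complex_of_real (inverse (om g T))"
    have e: "spin_proj 1 g T $ 1 $ 1 = h * (1 + of_real T * v)" "spin_proj 1 g T $ 1 $ 2 = h * (of_real g * v)"
      "spin_proj 1 g T $ 2 $ 1 = h * (of_real g * v)" "spin_proj 1 g T $ 2 $ 2 = h * (1 - of_real T * v)"
      unfolding spin_proj_nth h_def v_def mult_1 divide_inverse[of T] divide_inverse[of g] by simp_all
    have "trace (Pp g T ** \<rho> T) = h * (\<rho> T $ 1 $ 1 + \<rho> T $ 2 $ 2)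
       + h * ((of_real g * (\<rho> T $ 1 $ 2 + \<rho> T $ 2 $ 1) + of_real T * (\<rho> T $ 1 $ 1 - \<rho> T $ 2 $ 2)) * v)"
      unfolding Pp_eq[OF g] trace_def sum_2 matrix_matrix_mult_def vec_lambda_beta e
      by (simp add: algebra_simps)
    also have "(of_real g * (\<rho> T $ 1 $ 2 + \<rho> T $ 2 $ 1) + of_real T * (\<rho> T $ 1 $ 1 - \<rho> T $ 2 $ 2)) * v
       = Complex (frame_z g (r1 Re) (r3 Re) T) (frame_z g (r1 Im) (r3 Im) T)"
      by (simp add: complex_eq_iff frame_z_def r1_def r3_def v_def del: of_real_inverse)
    finally show ?thesis unfolding tr im unfolding \<rho>_def by (simp add: complex_eq_iff h_def add_divide_distrib)
  qed
  then show ?thesis using sol[of Re] z0 w0 by blast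
qed

lemma Pp_vector_derivative:
  assumes g: "g > 0"
  shows "vector_derivative (Pp g) (at s) = (1/2 * g * inverse (om g s) ^ 3) *\<^sub>R
     (\<chi> i j. complex_of_real (if i = 1 \<and> j = 1 then g else if i = 2 \<and> j = 2 then - g else - s))"
proof (rule vector_derivative_at)
  define X Y I :: mat2 where "X = (\<chi> i j. if i = j then 0 else 1)"
    and "Y = (\<chi> i j. if i = 1 \<and> j = 1 then 1 else if i = 2 \<and> j = 2 then - 1 else 0)"
    and "I = (\<chi> i j. if i = j then 1 else 0)"
  define v where "v = inverse (om g s)"
  have v1: "v\<^sup>2 * (s\<^sup>2 + g\<^sup>2) = 1" unfolding v_def by (rule inverse_om_sq[OF g])
  have dv: "((\<lambda>s. inverse (om g s)) has_real_derivative - (s * v ^ 3)) (at s)"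
    unfolding v_def by (rule DERIV_inverse_om[OF g])
  have P: "Pp g = (\<lambda>s. (1/2) *\<^sub>R I + ((g/2 * inverse (om g s)) *\<^sub>R X + (s/2 * inverse (om g s)) *\<^sub>R Y))"
    unfolding Pp_eq[OF g]
    by (auto simp: fun_eq_iff vec_eq_iff forall_2 spin_proj_nth X_def Y_def I_def scaleR_conv_of_real[where 'a = complex] field_simps)
  have dX: "((\<lambda>s. g/2 * inverse (om g s)) has_real_derivative g/2 * - (s * v ^ 3)) (at s)"
    by (intro DERIV_cmult dv)
  have "((\<lambda>s. s/2 * inverse (om g s)) has_real_derivative 1/2 * inverse (om g s) + - (s * v ^ 3) * (s/2)) (at s)"
    by (intro DERIV_mult DERIV_cdivide DERIV_ident dv)
  then have "((\<lambda>s. s/2 * inverse (om g s)) has_real_derivative 1/2 * v + - (s * v ^ 3) * (s/2)) (at s)"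
    unfolding v_def[symmetric] .
  moreover have "1/2 * v + - (s * v ^ 3) * (s/2) = g\<^sup>2/2 * v ^ 3"
    using v1 by algebra
  ultimately have dY: "((\<lambda>s. s/2 * inverse (om g s)) has_real_derivative g\<^sup>2/2 * v ^ 3) (at s)"
    by (simp only:)
  have sc: "((\<lambda>s. f s *\<^sub>R A) has_vector_derivative f' *\<^sub>R A) (at s)"
    if "(f has_real_derivative f') (at s)" for f f' and A :: mat2
    using has_vector_derivative_scaleR[OF that has_vector_derivative_const[of A]] by simp
  have "(Pp g has_vector_derivative (0 + ((g/2 * - (s * v ^ 3)) *\<^sub>R X + (g\<^sup>2/2 * v ^ 3) *\<^sub>R Y))) (at s)"
    unfolding P by (intro has_vector_derivative_add has_vector_derivative_const sc dX dY)
  moreover have "0 + ((g/2 * - (s * v ^ 3)) *\<^sub>R X + (g\<^sup>2/2 * v ^ 3) *\<^sub>R Y) = (1/2 * g * inverse (om g s) ^ 3) *\<^sub>R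
     (\<chi> i j. complex_of_real (if i = 1 \<and> j = 1 then g else if i = 2 \<and> j = 2 then - g else - s))"
    by (auto simp: vec_eq_iff forall_2 X_def Y_def v_def scaleR_conv_of_real[where 'a = complex] power2_eq_square)
  ultimately show "(Pp g has_vector_derivative (1/2 * g * inverse (om g s) ^ 3) *\<^sub>R
     (\<chi> i j. complex_of_real (if i = 1 \<and> j = 1 then g else if i = 2 \<and> j = 2 then - g else - s))) (at s)" by simp
qed

text \<open>The derivative of the projection is traceless and real symmetric, so its square is a
  multiple of the identity and the trace reduces to that of a rank one projection.\<close>

lemma trace_curvature:
  assumes g: "g > 0"
  shows "trace (Pm g s ** vector_derivative (Pp g) (at s) ** vector_derivative (Pp g) (at s) ** Pm g s)
    = complex_of_real (g\<^sup>2 * inverse (om g s) ^ 4 / 4)"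
proof -
  define M :: mat2 where "M = (\<chi> i j. complex_of_real (if i = 1 \<and> j = 1 then g else if i = 2 \<and> j = 2 then - g else - s))"
  define v where "v = inverse (om g s)"
  define d where "d = 1/2 * g * v ^ 3"
  have v1: "v\<^sup>2 * (s\<^sup>2 + g\<^sup>2) = 1" unfolding v_def by (rule inverse_om_sq[OF g])
  have D: "vector_derivative (Pp g) (at s) = d *\<^sub>R M"
    unfolding Pp_vector_derivative[OF g] M_def d_def v_def ..
  have MM: "(d *\<^sub>R M) ** (d *\<^sub>R M) = (d\<^sup>2 * (s\<^sup>2 + g\<^sup>2)) *\<^sub>R mat 1"
    by (simp add: vec_eq_iff forall_2 matrix_matrix_mult_def sum_2 M_def mat_def scaleR_conv_of_real[where 'a = complex] power2_eq_square algebra_simps)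
  have c: "d\<^sup>2 * (s\<^sup>2 + g\<^sup>2) = g\<^sup>2 * v ^ 4 / 4"
  proof -
    have "d\<^sup>2 * (s\<^sup>2 + g\<^sup>2) = g\<^sup>2 * v ^ 4 / 4 * (v\<^sup>2 * (s\<^sup>2 + g\<^sup>2))"
      by (simp add: d_def power2_eq_square power_numeral_reduce)
    then show ?thesis unfolding v1 by simp
  qed
  have PP: "Pm g s ** Pm g s = Pm g s" and tr: "trace (Pm g s) = 1"
  proof -
    show "trace (Pm g s) = 1"
      unfolding Pm_eq[OF g] trace_def sum_2 by (rule spin_proj_trace)
    show "Pm g s ** Pm g s = Pm g s"
      unfolding Pm_eq[OF g] by (rule spin_proj_idem[OF g]) simp
  qed
  have "Pm g s ** (d *\<^sub>R M) ** (d *\<^sub>R M) ** Pm g s = Pm g s ** ((d *\<^sub>R M) ** (d *\<^sub>R M)) ** Pm g s"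
    by (simp only: matrix_mul_assoc)
  also have "\<dots> = (g\<^sup>2 * v ^ 4 / 4) *\<^sub>R (Pm g s ** Pm g s)"
    unfolding MM c by (simp add: vec_eq_iff forall_2 matrix_matrix_mult_def sum_2 mat_def scaleR_conv_of_real[where 'a = complex] algebra_simps)
  finally have "Pm g s ** (d *\<^sub>R M) ** (d *\<^sub>R M) ** Pm g s = (g\<^sup>2 * v ^ 4 / 4) *\<^sub>R Pm g s" unfolding PP .
  then have "trace (Pm g s ** (d *\<^sub>R M) ** (d *\<^sub>R M) ** Pm g s) = (g\<^sup>2 * v ^ 4 / 4) *\<^sub>R trace (Pm g s)"
    by (simp add: trace_def scaleR_sum_right)
  then show ?thesis unfolding D tr v_def by (simp add: scaleR_conv_of_real)
qed

theorem theorem3p3: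
  fixes g B :: real
  assumes "g > 0"
  shows "\<exists>C. \<forall>(gam :: real \<Rightarrow> real) eps U.
     smooth_fun gam \<and> (\<forall>s. 0 \<le> gam s) \<and>
     (\<forall>s. \<bar>gam s\<bar> \<le> B \<and> \<bar>deriv gam s\<bar> \<le> B \<and> \<bar>deriv (deriv gam) s\<bar> \<le> B) \<and>
     eps > 0 \<and> is_propagator g gam eps U \<longrightarrow>
     (\<exists>(p::complex) (I::complex).
        ((\<lambda>T. trace (Pp g T ** U T (- T) (Pm g (- T)))) \<longlongrightarrow> p) at_top \<and>
        ((\<lambda>tau. complex_of_real (gam tau / (1 + (gam tau)^2) / en g tau) *
            trace (Pm g tau ** vector_derivative (Pp g) (at tau)
                   ** vector_derivative (Pp g) (at tau) ** Pm g tau)) has_integral I) UNIV \<and>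
        cmod (p - complex_of_real (exp (- pi * g^2 / (2 * eps))) - complex_of_real eps * I)
          \<le> C * (SUP s. gam s) * eps^2)"
proof (intro exI[of _ "pair_const g B * (pi / g) / 2"] allI impI, elim conjE)
  \<comment> \<open>The constant is half of the one for \<open>z\<close>, because the probability is
    \<open>(1 + z) / 2\<close>; it depends on \<open>g\<close> and \<open>B\<close> alone.\<close>
  fix gam :: "real \<Rightarrow> real" and eps U
  assume smooth: "smooth_fun gam" and nonneg: "\<forall>s. 0 \<le> gam s"
    and bounds: "\<forall>s. \<bar>gam s\<bar> \<le> B \<and> \<bar>deriv gam s\<bar> \<le> B \<and> \<bar>deriv (deriv gam) s\<bar> \<le> B"
    and eps: "eps > 0" and U: "is_propagator g gam eps U"
  have diff: "((deriv ^^ n) gam) differentiable (at x)" for n x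
    using smooth by (simp add: smooth_fun_def)
  have "gam differentiable (at x)" "deriv gam differentiable (at x)" for x
    using diff[of 0 x] diff[of 1 x] by simp_all
  then interpret dephasing g B gam "deriv gam" "deriv (deriv gam)"
    using assms nonneg bounds by unfold_locales (auto simp: DERIV_deriv_iff_real_differentiable)
  define \<Gamma> where "\<Gamma> = (SUP s. gam s)"
  have gam_le: "gam s \<le> B" for s using bounds abs_le_D1 by blast
  \<comment> \<open>Boundedness by \<open>B\<close> makes the conditionally complete supremum a
    genuine upper bound.\<close>
  then have \<Gamma>: "gam s \<le> \<Gamma>" for s
    unfolding \<Gamma>_def by (intro cSUP_upper bdd_aboveI2[of _ _ B]) auto
  define J where "J = (\<integral>s. correction g gam s \<partial>lborel)"
  obtain zz ww where sol: "\<And>a. adiabatic_solution g gam eps {a..} (zz a) (ww a)"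
      "\<And>a. zz a a = - 1" "\<And>a. ww a a = 0"
    and tr: "\<And>a T. T \<ge> a \<Longrightarrow> trace (Pp g T ** U T a (Pm g a)) = complex_of_real ((1 + zz a T) / 2)"
    using propagator_adiabatic[OF U g eps gam_nonneg] by metis
  obtain l where l: "((\<lambda>T. zz (- T) T) \<longlongrightarrow> l) at_top"
    and err: "\<bar>l - (2 * exp (- pi * g\<^sup>2 / (2 * eps)) - 1) - eps * J\<bar> \<le> pair_const g B * (pi / g) * \<Gamma> * eps\<^sup>2"
    using transition_expansion[OF eps sol gam_le \<Gamma>] unfolding J_def by blast
  show "\<exists>(p::complex) (I::complex).
        ((\<lambda>T. trace (Pp g T ** U T (- T) (Pm g (- T)))) \<longlongrightarrow> p) at_top \<and>
        ((\<lambda>tau. complex_of_real (gam tau / (1 + (gam tau)^2) / en g tau) *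
            trace (Pm g tau ** vector_derivative (Pp g) (at tau)
                   ** vector_derivative (Pp g) (at tau) ** Pm g tau)) has_integral I) UNIV \<and>
        cmod (p - complex_of_real (exp (- pi * g^2 / (2 * eps))) - complex_of_real eps * I)
          \<le> pair_const g B * (pi / g) / 2 * (SUP s. gam s) * eps^2"
  proof (intro exI conjI)
    have "((\<lambda>T. complex_of_real ((1 + zz (- T) T) / 2)) \<longlongrightarrow> of_real ((1 + l) / 2)) at_top"
      by (intro tendsto_of_real tendsto_divide tendsto_add tendsto_const l) simp
    moreover have "\<forall>\<^sub>F T in at_top. complex_of_real ((1 + zz (- T) T) / 2) = trace (Pp g T ** U T (- T) (Pm g (- T)))"
      using eventually_ge_at_top[of 0] by eventually_elim (simp add: tr)
    ultimately show "((\<lambda>T. trace (Pp g T ** U T (- T) (Pm g (- T)))) \<longlongrightarrow> of_real ((1 + l) / 2)) at_top"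
      by (rule Lim_transform_eventually)
    have integrand: "complex_of_real (gam s / (1 + (gam s)^2) / en g s) *
            trace (Pm g s ** vector_derivative (Pp g) (at s) ** vector_derivative (Pp g) (at s) ** Pm g s)
        = complex_of_real (1/2 * correction g gam s)" for s
    proof -
      have "gam s / (1 + (gam s)^2) / en g s * (g\<^sup>2 * inverse (om g s) ^ 4 / 4) = 1/2 * correction g gam s"
      proof -
        have "en g s = om g s / 2" by (simp add: en_def om_def)
        define k i where "k = gam s / (1 + (gam s)\<^sup>2)" and "i = inverse (om g s)"
        have "k / en g s = k * (2 * i)"
          unfolding \<open>en g s = om g s / 2\<close> i_def
          by (simp only: divide_inverse inverse_mult_distrib inverse_inverse_eq mult_ac)
        then have "k / en g s * (g\<^sup>2 * i ^ 4 / 4) = 1/2 * (k * g\<^sup>2 * i ^ 5)"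
          by (simp add: power_numeral_reduce)
        then show ?thesis by (simp add: correction_def k_def i_def)
      qed
      then show ?thesis unfolding trace_curvature[OF g] of_real_mult[symmetric] by (simp only:)
    qed
    have "(correction g gam has_integral J) UNIV"
      unfolding J_def by (rule has_integral_integral_lborel[OF correction_integrable[OF gam_le]])
    then have "((\<lambda>s. complex_of_real (1/2 * correction g gam s)) has_integral of_real (1/2 * J)) UNIV"
      by (intro has_integral_of_real has_integral_mult_right)
    then show "((\<lambda>tau. complex_of_real (gam tau / (1 + (gam tau)^2) / en g tau) *
            trace (Pm g tau ** vector_derivative (Pp g) (at tau)
                   ** vector_derivative (Pp g) (at tau) ** Pm g tau)) has_integral of_real (1/2 * J)) UNIV"
      unfolding integrand .
    have "complex_of_real ((1 + l) / 2) - complex_of_real (exp (- pi * g^2 / (2 * eps))) - complex_of_real eps * of_real (1/2 * J)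
      = of_real (1/2 * (l - (2 * exp (- pi * g\<^sup>2 / (2 * eps)) - 1) - eps * J))"
      unfolding of_real_mult[symmetric] of_real_diff[symmetric] by (simp add: field_simps)
    then have "cmod (complex_of_real ((1 + l) / 2) - complex_of_real (exp (- pi * g^2 / (2 * eps))) - complex_of_real eps * of_real (1/2 * J))
      = 1/2 * \<bar>l - (2 * exp (- pi * g\<^sup>2 / (2 * eps)) - 1) - eps * J\<bar>"
      by (simp only: norm_of_real abs_mult)
    also have "\<dots> \<le> 1/2 * (pair_const g B * (pi / g) * \<Gamma> * eps\<^sup>2)" using err by simp
    finally show "cmod (complex_of_real ((1 + l) / 2) - complex_of_real (exp (- pi * g^2 / (2 * eps))) - complex_of_real eps * of_real (1/2 * J))
      \<le> pair_const g B * (pi / g) / 2 * (SUP s. gam s) * eps^2"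
      unfolding \<Gamma>_def by simp
  qed
qed

end
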